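(* For all $D \in \mathcal{D}iscs$ and all primes $p$, \begin{align*} h(p^6 D) &= h(p^4 D) + p \big( h(D) - h(D/p^2) \big), \\ \hat h(p^6 D) &= \hat h(p^4 D) + p \big( \hat h(D) - \hat h(D/p^2) \big), \end{align*} with the convention that $h(a) = \hat h(a) = 0$ for every $a \notin \mathcal{D}iscs$ (in particular for non-integers $a$).
   Context: $\mathcal{D}iscs = (4\mathbb{Z}\setminus\{0\}) \cup (1+4\mathbb{Z})$. A cubic ring is a commutative ring with unit isomorphic to $\mathbb{Z}^3$ as a $\mathbb{Z}$-module, with discriminant $\det[\operatorname{tr}(\alpha_i\alpha_j)]$ for a $\mathbb{Z}$-basis $(\alpha_i)$; it is $\mathbb{Z}$-mat if every element has trace divisible by $3$. For $D\in\mathcal{D}iscs$, $h(D)$ is the sum of $1/\lvert\operatorname{Aut} C\rvert$ over isomorphism classes of cubic rings $C$ of discriminant $D$, and $\hat h(D)$ is the sum of $1/\lvert\operatorname{Aut} C\rvert$ over isomorphism classes of $\mathbb{Z}$-mat cubic rings $C$ of discriminant $-27D$. *)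

theory Defs
  imports "HOL-Computational_Algebra.Primes" "HOL-Analysis.Determinants"
    "HOL-Algebra.QuotRing" "HOL-Algebra.Bij" "HOL-Algebra.Elementary_Groups"
begin

definition Discs :: "int set" where
  "Discs = ({D. 4 dvd D} - {0}) \<union> {D. D mod 4 = 1}"

definition cubic_ring :: "('a, 'm) ring_scheme \<Rightarrow> bool" where
  "cubic_ring R \<longleftrightarrow>
     cring R \<and> add_monoid R \<cong> integer_group \<times>\<times> integer_group \<times>\<times> integer_group"

definition lin_comb :: "('a, 'm) ring_scheme \<Rightarrow> (3 \<Rightarrow> 'a) \<Rightarrow> int ^ 3 \<Rightarrow> 'a" where
  "lin_comb R b n = (\<Oplus>\<^bsub>R\<^esub>i\<in>UNIV. [n $ i] \<cdot>\<^bsub>R\<^esub> b i)"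

definition is_zbasis :: "('a, 'm) ring_scheme \<Rightarrow> (3 \<Rightarrow> 'a) \<Rightarrow> bool" where
  "is_zbasis R b \<longleftrightarrow>
     range b \<subseteq> carrier R \<and> (\<forall>x\<in>carrier R. \<exists>!n. x = lin_comb R b n)"

definition coords :: "('a, 'm) ring_scheme \<Rightarrow> (3 \<Rightarrow> 'a) \<Rightarrow> 'a \<Rightarrow> int ^ 3" where
  "coords R b x = (THE n. x = lin_comb R b n)"

text \<open>The trace of an element is the trace of the multiplication map, and, like the discriminant,
  it does not depend on the chosen basis.\<close>

definition ring_trace :: "('a, 'm) ring_scheme \<Rightarrow> 'a \<Rightarrow> int" where
  "ring_trace R x =
     (let b = (SOME b. is_zbasis R b)
      in trace (\<chi> i j. coords R b (x \<otimes>\<^bsub>R\<^esub> b j) $ i))"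

definition cubic_disc :: "('a, 'm) ring_scheme \<Rightarrow> int" where
  "cubic_disc R =
     (let b = (SOME b. is_zbasis R b)
      in det (\<chi> i j. ring_trace R (b i \<otimes>\<^bsub>R\<^esub> b j)))"

definition zmat :: "('a, 'm) ring_scheme \<Rightarrow> bool" where
  "zmat R \<longleftrightarrow> (\<forall>x\<in>carrier R. 3 dvd ring_trace R x)"

definition ring_aut :: "('a, 'm) ring_scheme \<Rightarrow> ('a \<Rightarrow> 'a) set" where
  "ring_aut R = ring_hom R R \<inter> Bij (carrier R)"

text \<open>Isomorphism classes are formed among rings whose carrier is a subset of
  \<^typ>\<open>int \<times> int \<times> int\<close>. By transport of structure along an additive isomorphism with
  $\mathbb{Z}^3$, every cubic ring is isomorphic to one of these, so no class is missed.
  The sums below range over finite sets, because there are only finitely many cubic rings of a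
  given nonzero discriminant up to isomorphism, and the automorphism groups are finite.\<close>

definition weighted_count :: "(int \<times> int \<times> int) ring set \<Rightarrow> rat" where
  "weighted_count \<C> =
     (\<Sum>c \<in> \<C> // {(R, S). R \<in> \<C> \<and> S \<in> \<C> \<and> R \<simeq> S}.
        1 / of_nat (card (ring_aut (SOME R. R \<in> c))))"

definition h :: "rat \<Rightarrow> rat" where
  "h a = (if a \<in> of_int ` Discs
          then weighted_count {R. cubic_ring R \<and> of_int (cubic_disc R) = a}
          else 0)"

definition h_hat :: "rat \<Rightarrow> rat" where
  "h_hat a = (if a \<in> of_int ` Discs
              then weighted_count {R. cubic_ring R \<and> zmat R \<and> of_int (cubic_disc R) = - 27 * a}
              else 0)"

end

(*
Cubic rings correspond to integral binary cubic forms up to GL2(Z) (Delone--Faddeev), automorphisms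
being stabilisers, so h and h_hat become masses of sets of forms. Let N_k be the mass of the forms
of discriminant p^(2k) D. The pairs (ring of discriminant p^4 D, subring of index p) are also the
pairs (ring of discriminant p^6 D, overring of index p). The subrings of index p of a ring belong to
the roots of its form modulo p. A form divisible by p has p + 1 roots; any other form whose
discriminant is divisible by p has exactly one multiple root, and at most one simple root. On the
other side, a form of discriminant p^6 D not divisible by p has exactly one overring, and the
overrings of p f belong to the roots of f. With S_k the mass of the simple roots this reads
  S_2 + N_2 + p N_0 = (N_3 - N_1) + (S_1 + N_1 + p N_(-1)),
and S_1 = S_2, because passing to the subring of a simple root produces a form with a double and
a simple root, from which it is recovered as the unique overring.

The same count works for Z-mat rings unless p = 3. In that case a Z-mat form has only multiple roots
modulo 3, N_0 and N_(-1) are replaced by the masses of all forms of discriminants -27 D and -3 D, and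
the forms among these that are not Z-mat, being those with a simple root modulo 3, have equal masses.

Splitting the masses requires the finiteness of the class number: for positive discriminant the
Hessian is reduced, for negative discriminant the definite quadratic factor over the reals.
*)
theory Submission
  imports Defs "HOL-Number_Theory.Cong"
begin

section \<open>Weighted orbit counts\<close>


text \<open>A ring with a distinguished subring or overring of index p is represented by a form with
  the point (1 : 0) marked, taken up to \<open>Gam0 p\<close>. One mass under \<open>Gam0 p\<close>
  is then read in two ways: \<open>mass_subgroup\<close> turns it into a \<open>GL2\<close> mass in
  which each form counts with the number of its admissible points, and \<open>phi\<close>, the
  substitution by an Atkin-Lehner matrix, matches roots at discriminant E with overring points at
  discriminant p^2 E without leaving \<open>Gam0 p\<close>. The exponent 6 comes from triple roots
  at p = 3: there all of 3^6 is needed before the multiple root of a form not divisible by 3 yields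
  an overring (\<open>multiple_over\<close>). The prime 2 needs 16 | disc at a double root, which
  holds at p^4 D. Sums over infinite sets are 0 by convention, so a mass may be split into parts
  only when there are finitely many orbits; this is what the reduction theory is for.\<close>

locale set_action = group G for G (structure) +
  fixes act :: "'a \<Rightarrow> 'x \<Rightarrow> 'x"
  assumes act_one: "act \<one> x = x"
    and act_mult: "g \<in> carrier G \<Longrightarrow> k \<in> carrier G \<Longrightarrow> act (g \<otimes> k) x = act g (act k x)"
begin

definition orb :: "'a set \<Rightarrow> 'x \<Rightarrow> 'x set" where
  "orb K x = (\<lambda>g. act g x) ` K"

definition stab :: "'a set \<Rightarrow> 'x \<Rightarrow> 'a set" where
  "stab K x = {g \<in> K. act g x = x}"

text \<open>The representative is immaterial because stabilisers along an orbit are conjugate. An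
  infinite stabiliser has \<open>card\<close> 0 and so gives the weight 1 / 0 = 0.\<close>

definition orbit_wt :: "'a set \<Rightarrow> 'x set \<Rightarrow> rat" where
  "orbit_wt K O' = 1 / of_nat (card (stab K (SOME x. x \<in> O')))"

definition mass :: "'a set \<Rightarrow> 'x set \<Rightarrow> rat" where
  "mass K X = (\<Sum>O' \<in> orb K ` X. orbit_wt K O')"

text \<open>A mass whose orbits carry an extra weight, later the number of points at which a form
  has a local property. Only the chosen representatives are evaluated, so linearity is immediate for
  every \<open>w\<close>.\<close>

definition wsum :: "'x set \<Rightarrow> ('x \<Rightarrow> rat) \<Rightarrow> rat" where
  "wsum X w = (\<Sum>O' \<in> orb (carrier G) ` X. w (SOME x. x \<in> O') * orbit_wt (carrier G) O')"

definition invariant :: "'a set \<Rightarrow> 'x set \<Rightarrow> bool" where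
  "invariant K X \<longleftrightarrow> (\<forall>g\<in>K. \<forall>x\<in>X. act g x \<in> X)"

lemma act_inv: "g \<in> carrier G \<Longrightarrow> act (inv g) (act g x) = x"
  by (metis act_mult act_one inv_closed l_inv)

lemma act_inv': "g \<in> carrier G \<Longrightarrow> act g (act (inv g) x) = x"
  by (metis act_mult act_one inv_closed r_inv)

lemma inv_cancel_left:
  assumes "g \<in> carrier G" "k \<in> carrier G"
  shows "inv g \<otimes> (g \<otimes> k) = k" "g \<otimes> (inv g \<otimes> k) = k"
  using assms by (simp_all add: m_assoc[symmetric])

lemma orb_self: "subgroup K G \<Longrightarrow> x \<in> orb K x"
  unfolding orb_def using act_one subgroup.one_closed by (metis imageI)

lemma orb_eq:
  assumes K: "subgroup K G" and y: "y \<in> orb K x"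
  shows "orb K y = orb K x"
proof -
  obtain g where g: "g \<in> K" "y = act g x" using y by (auto simp: orb_def)
  have gG: "g \<in> carrier G" using g K by (meson subgroup.mem_carrier)
  have 1: "act k y \<in> orb K x" if "k \<in> K" for k
  proof -
    have "act k y = act (k \<otimes> g) x" using g act_mult gG that K by (metis subgroup.mem_carrier)
    then show ?thesis using that g K by (auto simp: orb_def subgroup.m_closed)
  qed
  have 2: "act k x \<in> orb K y" if "k \<in> K" for k
  proof -
    have kG: "k \<in> carrier G" using that K by (meson subgroup.mem_carrier)
    have "act (k \<otimes> inv g) y = act k x"
      using act_mult[of k "inv g" y] kG gG g(2) act_inv by auto
    moreover have "k \<otimes> inv g \<in> K" using that g K by (simp add: subgroup.m_closed subgroup.m_inv_closed)
    ultimately show ?thesis by (metis orb_def imageI)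
  qed
  show ?thesis using 1 2 by (auto simp: orb_def)
qed

lemma orb_eq_iff:
  assumes "subgroup K G" shows "orb K x = orb K y \<longleftrightarrow> x \<in> orb K y"
  using assms orb_eq orb_self by metis

lemma card_stab_orb:
  assumes K: "subgroup K G" and y: "y \<in> orb K x"
  shows "card (stab K y) = card (stab K x)"
proof -
  obtain g where g: "g \<in> K" "y = act g x" using y by (auto simp: orb_def)
  have gG: "g \<in> carrier G" and KG: "K \<subseteq> carrier G"
    using g K by (auto simp: subgroup.mem_carrier)
  note cl = subgroup.m_closed[OF K] subgroup.m_inv_closed[OF K] subgroup.mem_carrier[OF K]
  have conj: "u \<otimes> k \<otimes> inv u \<in> stab K (act u z)" if "u \<in> K" "k \<in> stab K z" for u k z
    using that by (auto simp: stab_def cl act_mult act_inv)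
  have "bij_betw (\<lambda>k. g \<otimes> k \<otimes> inv g) (stab K x) (stab K y)"
  proof (rule bij_betw_byWitness[where f' = "\<lambda>k. inv g \<otimes> k \<otimes> g"])
    show "(\<lambda>k. g \<otimes> k \<otimes> inv g) ` stab K x \<subseteq> stab K y"
      using conj[OF g(1)] g(2) by auto
    show "(\<lambda>k. inv g \<otimes> k \<otimes> g) ` stab K y \<subseteq> stab K x"
      using conj[of "inv g" _ y] g gG cl(2) act_inv by auto
    show "\<forall>k\<in>stab K x. inv g \<otimes> (g \<otimes> k \<otimes> inv g) \<otimes> g = k"
      "\<forall>k\<in>stab K y. g \<otimes> (inv g \<otimes> k \<otimes> g) \<otimes> inv g = k"
      using gG KG by (auto simp: stab_def m_assoc inv_cancel_left subset_iff)
  qed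
  then show ?thesis by (metis bij_betw_same_card)
qed

lemma some_in_orb: "subgroup K G \<Longrightarrow> (SOME y. y \<in> orb K x) \<in> orb K x"
  using orb_self someI by metis

lemma orbit_wt_orb: "subgroup K G \<Longrightarrow> orbit_wt K (orb K x) = 1 / of_nat (card (stab K x))"
  unfolding orbit_wt_def using card_stab_orb some_in_orb by metis

lemma some_in_invariant:
  assumes "invariant K X" "O' \<in> orb K ` X" "subgroup K G"
  shows "(SOME x. x \<in> O') \<in> X" "O' = orb K (SOME x. x \<in> O')"
proof -
  obtain x where x: "x \<in> X" "O' = orb K x" using assms by auto
  have "(SOME x. x \<in> O') \<in> O'" using some_in_orb assms(3) x by simp
  then show "(SOME x. x \<in> O') \<in> X" "O' = orb K (SOME x. x \<in> O')"
    using x assms(1) orb_eq[OF assms(3)] by (auto simp: orb_def invariant_def)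
qed

text \<open>Orbits go to orbits and stabilisers to stabilisers of the same size, even if the action
  is twisted by \<open>\<sigma>\<close>. The twist is trivial for scaling a form and is
  \<open>sig\<close> for passing to a subring.\<close>

lemma mass_transport:
  assumes K: "subgroup K G" and inv: "invariant K X"
    and \<sigma>: "bij_betw \<sigma> K K" and \<phi>: "bij_betw \<phi> X Y"
    and eqv: "\<And>k x. k \<in> K \<Longrightarrow> x \<in> X \<Longrightarrow> \<phi> (act k x) = act (\<sigma> k) (\<phi> x)"
  shows "mass K X = mass K Y"
proof -
  have orb: "orb K (\<phi> x) = \<phi> ` orb K x" if "x \<in> X" for x
  proof -
    have "orb K (\<phi> x) = (\<lambda>g. act g (\<phi> x)) ` (\<sigma> ` K)" using \<sigma> by (simp add: orb_def bij_betw_def)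
    then show ?thesis using that eqv by (auto simp: orb_def image_iff)
  qed
  have sub: "orb K x \<subseteq> X" if "x \<in> X" for x using inv that by (auto simp: orb_def invariant_def)
  have Y: "Y = \<phi> ` X" using \<phi> by (auto simp: bij_betw_def)
  have stab: "card (stab K (\<phi> x)) = card (stab K x)" if x: "x \<in> X" for x
  proof -
    have "stab K (\<phi> x) = \<sigma> ` stab K x"
    proof (intro equalityI subsetI)
      fix k assume "k \<in> stab K (\<phi> x)"
      then have k: "k \<in> K" "act k (\<phi> x) = \<phi> x" by (auto simp: stab_def)
      then obtain l where l: "l \<in> K" "k = \<sigma> l" using \<sigma> by (auto simp: bij_betw_def)
      have "\<phi> (act l x) = \<phi> x" using eqv l k x by simp
      then have "act l x = x" using \<phi> x inv l by (auto simp: bij_betw_def inj_on_def invariant_def)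
      then show "k \<in> \<sigma> ` stab K x" using l by (auto simp: stab_def)
    next
      fix k assume "k \<in> \<sigma> ` stab K x"
      then obtain l where l: "l \<in> K" "k = \<sigma> l" "act l x = x" by (auto simp: stab_def)
      then show "k \<in> stab K (\<phi> x)" using eqv[of l x] x \<sigma> by (auto simp: stab_def bij_betw_def)
    qed
    moreover have "inj_on \<sigma> (stab K x)" using \<sigma> by (auto simp: bij_betw_def inj_on_def stab_def)
    ultimately show ?thesis by (simp add: card_image)
  qed
  have im: "orb K ` Y = image \<phi> ` (orb K ` X)"
    unfolding Y using orb by (auto simp: image_iff)
  have inj: "inj_on (image \<phi>) (orb K ` X)"
  proof (rule inj_onI)
    fix A B assume "A \<in> orb K ` X" "B \<in> orb K ` X" "\<phi> ` A = \<phi> ` B"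
    moreover have "A \<subseteq> X" "B \<subseteq> X" using sub \<open>A \<in> orb K ` X\<close> \<open>B \<in> orb K ` X\<close> by blast+
    ultimately show "A = B" using \<phi> inj_on_image_eq_iff[of \<phi> X A B] by (simp add: bij_betw_def)
  qed
  have "mass K Y = (\<Sum>O' \<in> orb K ` X. orbit_wt K (\<phi> ` O'))"
    unfolding mass_def im by (simp add: sum.reindex[OF inj] o_def)
  also have "\<dots> = mass K X"
    unfolding mass_def
  proof (rule sum.cong[OF refl])
    fix O' assume "O' \<in> orb K ` X"
    then obtain x where x: "x \<in> X" "O' = orb K x" by auto
    show "orbit_wt K (\<phi> ` O') = orbit_wt K O'"
      using x orb[OF x(1)] orbit_wt_orb[OF K] stab by metis
  qed
  finally show ?thesis by simp
qed

lemma carrier_subgroup: "subgroup (carrier G) G"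
  by (simp add: subgroup_self)

lemma wsum_cong:
  assumes "invariant (carrier G) X" "\<And>x. x \<in> X \<Longrightarrow> w x = w' x"
  shows "wsum X w = wsum X w'"
  unfolding wsum_def by (rule sum.cong[OF refl])
    (use some_in_invariant[OF assms(1) _ carrier_subgroup] assms(2) in auto)

lemma wsum_add: "wsum X (\<lambda>x. w x + w' x) = wsum X w + wsum X w'"
  unfolding wsum_def by (simp add: sum.distrib ring_distribs)

lemma wsum_mult: "wsum X (\<lambda>x. k * w x) = k * wsum X w"
  unfolding wsum_def by (simp add: sum_distrib_left mult.assoc)

lemma wsum_one: "wsum X (\<lambda>x. 1) = mass (carrier G) X"
  unfolding wsum_def mass_def by simp

text \<open>Finiteness is essential: an infinite sum is 0 by default, whereas the part selected by
  \<open>P\<close> could be finite and nonzero.\<close>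

lemma wsum_restrict:
  assumes fin: "finite (orb (carrier G) ` X)" and X: "invariant (carrier G) X"
    and P: "invariant (carrier G) {x \<in> X. P x}"
  shows "wsum X (\<lambda>x. if P x then w x else 0) = wsum {x \<in> X. P x} w"
proof -
  let ?G = "carrier G"
  have *: "P (SOME x. x \<in> O') \<longleftrightarrow> O' \<in> orb ?G ` {x \<in> X. P x}" if O: "O' \<in> orb ?G ` X" for O'
  proof
    assume "P (SOME x. x \<in> O')"
    then show "O' \<in> orb ?G ` {x \<in> X. P x}"
      using some_in_invariant[OF X O carrier_subgroup] by blast
  next
    assume "O' \<in> orb ?G ` {x \<in> X. P x}"
    then show "P (SOME x. x \<in> O')"
      using some_in_invariant[OF P _ carrier_subgroup] by blast
  qed
  have "wsum X (\<lambda>x. if P x then w x else 0) =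
     (\<Sum>O' \<in> orb ?G ` X. if O' \<in> orb ?G ` {x \<in> X. P x} then
        w (SOME x. x \<in> O') * orbit_wt ?G O' else 0)"
    unfolding wsum_def by (rule sum.cong[OF refl]) (use * in auto)
  also have "\<dots> = wsum {x \<in> X. P x} w"
    unfolding wsum_def by (rule sum.mono_neutral_cong_right) (use fin in auto)
  finally show ?thesis .
qed

lemma mass_split:
  assumes fin: "finite (orb (carrier G) ` X)" and X: "invariant (carrier G) X"
    and P: "invariant (carrier G) {x \<in> X. P x}"
  shows "mass (carrier G) X = mass (carrier G) {x \<in> X. P x} + mass (carrier G) {x \<in> X. \<not> P x}"
proof -
  have P': "invariant (carrier G) {x \<in> X. \<not> P x}"
    unfolding invariant_def
  proof (intro ballI)
    fix g x assume g: "g \<in> carrier G" and x: "x \<in> {x \<in> X. \<not> P x}"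
    have "P x" if "P (act g x)"
    proof -
      have "act g x \<in> {x \<in> X. P x}" using that g x X by (auto simp: invariant_def)
      then have "act (inv g) (act g x) \<in> {x \<in> X. P x}" using P g unfolding invariant_def by blast
      then show ?thesis using act_inv[OF g] by simp
    qed
    then show "act g x \<in> {x \<in> X. \<not> P x}" using g x X by (auto simp: invariant_def)
  qed
  have "mass (carrier G) X = wsum X (\<lambda>x. (if P x then 1 else 0) + (if \<not> P x then 1 else 0))"
    unfolding wsum_one[symmetric] by (rule wsum_cong[OF X]) auto
  then show ?thesis
    by (simp only: wsum_add wsum_restrict[OF fin X P] wsum_restrict[OF fin X P'] wsum_one)
qed

text \<open>Finiteness of the stabilisers is not needed: both sides are 0 if the stabiliser of \<open>x\<close> is
  infinite, because then so is its intersection with any subgroup of finite index.\<close>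

lemma card_stab_transversal:
  assumes K: "subgroup K G" and T: "T \<subseteq> carrier G"
    and tr: "\<And>g. g \<in> carrier G \<Longrightarrow> \<exists>!t. t \<in> T \<and> g \<otimes> inv t \<in> K"
    and s: "s \<in> carrier G"
  shows "card {t \<in> T. act t x \<in> orb K (act s x)} * card (stab K (act s x)) = card (stab (carrier G) x)"
proof -
  let ?F = "{t \<in> T. act t x \<in> orb K (act s x)}"
  note cl = subgroup.m_closed[OF K] subgroup.m_inv_closed[OF K] subgroup.mem_carrier[OF K]
  have "\<exists>g. g \<in> stab (carrier G) x \<and> s \<otimes> g \<otimes> inv t \<in> K" if t: "t \<in> ?F" for t
  proof -
    have tG: "t \<in> carrier G" using t T by auto
    obtain k where k: "k \<in> K" "act t x = act k (act s x)" using t by (auto simp: orb_def)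
    have kG: "k \<in> carrier G" using k cl by auto
    let ?g = "inv s \<otimes> (inv k \<otimes> t)"
    have "act ?g x = x" using k kG tG s by (simp add: act_mult act_inv)
    moreover have "s \<otimes> ?g \<otimes> inv t = inv k"
      using s kG tG by (simp add: m_assoc inv_cancel_left)
    ultimately show ?thesis using k kG tG s cl by (intro exI[of _ ?g]) (auto simp: stab_def)
  qed
  then obtain \<gamma> where \<gamma>: "\<And>t. t \<in> ?F \<Longrightarrow> \<gamma> t \<in> stab (carrier G) x \<and> s \<otimes> \<gamma> t \<otimes> inv t \<in> K"
    by metis
  have \<gamma>G: "\<gamma> t \<in> carrier G" "act (\<gamma> t) x = x" if "t \<in> ?F" for t
    using \<gamma>[OF that] by (auto simp: stab_def)
  \<comment> \<open>The conjugate of \<open>stab K (act s x)\<close> by \<open>inv s\<close> lies in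
    the stabiliser of \<open>x\<close>. Its right cosets there are indexed by the \<open>t\<close>
    for which \<open>act t x\<close> lies in the \<open>K\<close>-orbit of \<open>act s x\<close>,
    and \<open>\<gamma> t\<close> represents the coset of \<open>t\<close>.\<close>
  define \<Phi> where "\<Phi> = (\<lambda>(t, k). inv s \<otimes> k \<otimes> s \<otimes> \<gamma> t)"
  have coset: "s \<otimes> \<Phi> (t, k) \<otimes> inv t \<in> K" if t: "t \<in> ?F" and k: "k \<in> K" for t k
  proof -
    have tG: "t \<in> carrier G" using t T by auto
    have "s \<otimes> \<Phi> (t, k) \<otimes> inv t = k \<otimes> (s \<otimes> \<gamma> t \<otimes> inv t)"
      using s k tG \<gamma>G[OF t] cl(3)[OF k] by (simp add: \<Phi>_def m_assoc inv_cancel_left)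
    then show ?thesis using cl k \<gamma>[OF t] by auto
  qed
  have "bij_betw \<Phi> (?F \<times> stab K (act s x)) (stab (carrier G) x)"
    unfolding bij_betw_def
  proof
    show "inj_on \<Phi> (?F \<times> stab K (act s x))"
    proof (rule inj_onI, clarify)
      fix t k t' k'
      assume t: "t \<in> T" "act t x \<in> orb K (act s x)" and t': "t' \<in> T" "act t' x \<in> orb K (act s x)"
        and k: "k \<in> stab K (act s x)" and k': "k' \<in> stab K (act s x)"
        and eq: "\<Phi> (t, k) = \<Phi> (t', k')"
      have kG: "k \<in> carrier G" "k' \<in> carrier G" "k \<in> K" "k' \<in> K" using k k' cl by (auto simp: stab_def)
      have G: "\<Phi> (t, k) \<in> carrier G" using kG s \<gamma>G(1)[of t] t by (simp add: \<Phi>_def)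
      have "t = t'" using tr[of "s \<otimes> \<Phi> (t, k)"] coset[of t k] coset[of t' k'] t t' kG eq s G by auto
      moreover have "k = k'" using eq \<open>t = t'\<close> kG s \<gamma>G(1)[of t] t by (simp add: \<Phi>_def)
      ultimately show "t = t' \<and> k = k'" by simp
    qed
    show "\<Phi> ` (?F \<times> stab K (act s x)) = stab (carrier G) x"
    proof (intro equalityI subsetI)
      fix g assume "g \<in> \<Phi> ` (?F \<times> stab K (act s x))"
      then obtain t k where t: "t \<in> ?F" and k: "k \<in> stab K (act s x)" and g: "g = \<Phi> (t, k)" by auto
      have kG: "k \<in> carrier G" "act k (act s x) = act s x" using k cl by (auto simp: stab_def)
      show "g \<in> stab (carrier G) x"
        using kG s \<gamma>G[OF t] by (simp add: g \<Phi>_def stab_def act_mult act_inv)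
    next
      fix g assume "g \<in> stab (carrier G) x"
      then have g: "g \<in> carrier G" "act g x = x" by (auto simp: stab_def)
      obtain t where t: "t \<in> T" "s \<otimes> g \<otimes> inv t \<in> K" using tr[of "s \<otimes> g"] s g by auto
      have tG: "t \<in> carrier G" using t T by auto
      have "act (inv (s \<otimes> g \<otimes> inv t)) (act s x) = act t x"
      proof -
        have "act (s \<otimes> g \<otimes> inv t) (act t x) = act s x"
          using s g tG by (simp add: act_mult act_inv)
        then show ?thesis using act_inv[of "s \<otimes> g \<otimes> inv t" "act t x"] s g tG by simp
      qed
      then have tF: "t \<in> ?F" using t cl by (auto simp: orb_def intro!: image_eqI[of _ _ "inv (s \<otimes> g \<otimes> inv t)"])
      let ?k = "s \<otimes> g \<otimes> inv (\<gamma> t) \<otimes> inv s"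
      note gt = \<gamma>G[OF tF]
      have "?k = (s \<otimes> g \<otimes> inv t) \<otimes> inv (s \<otimes> \<gamma> t \<otimes> inv t)"
        using s g tG gt by (simp add: m_assoc inv_mult_group inv_cancel_left)
      then have kK: "?k \<in> K" using cl t(2) \<gamma>[OF tF] by simp
      have "act (inv (\<gamma> t)) x = x" using act_inv[of "\<gamma> t" x] gt by simp
      then have "?k \<in> stab K (act s x)"
        using kK s g gt by (simp add: stab_def act_mult act_inv)
      moreover have "\<Phi> (t, ?k) = g"
        using s g gt by (simp add: \<Phi>_def m_assoc inv_cancel_left)
      ultimately show "g \<in> \<Phi> ` (?F \<times> stab K (act s x))" using tF
        by (intro image_eqI[of _ _ "(t, ?k)"] SigmaI) simp_all
    qed
  qed
  from bij_betw_same_card[OF this] show ?thesis by (simp only: card_cartesian_product)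
qed

text \<open>The orbit of \<open>x\<close> under the whole group falls into the
  \<open>K\<close>-orbits of the \<open>act t x\<close>. By \<open>card_stab_transversal\<close> the
  weight of the \<open>K\<close>-orbit of \<open>act s x\<close> is the number of \<open>t\<close>
  leading into it, divided by the order of the stabiliser of \<open>x\<close>. So every
  \<open>t\<close> with \<open>act t x\<close> in \<open>Y\<close> contributes one over that
  order.\<close>

theorem mass_subgroup:
  assumes K: "subgroup K G" and T: "T \<subseteq> carrier G" "finite T"
    and tr: "\<And>g. g \<in> carrier G \<Longrightarrow> \<exists>!t. t \<in> T \<and> g \<otimes> inv t \<in> K"
    and X: "invariant (carrier G) X" and fin: "finite (orb (carrier G) ` X)"
    and Y: "invariant K Y" "Y \<subseteq> X"
  shows "mass K Y = wsum X (\<lambda>x. of_nat (card {t \<in> T. act t x \<in> Y}))"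
proof -
  let ?G = "carrier G"
  note cl = subgroup.m_closed[OF K] subgroup.m_inv_closed[OF K] subgroup.mem_carrier[OF K]
  define \<pi> where "\<pi> = (\<lambda>P. orb ?G (SOME y. y \<in> P))"
  have orbK: "orb ?G y = orb ?G z" if "y \<in> orb K z" for y z
    using that orb_eq[OF carrier_subgroup] cl(3) by (fastforce simp: orb_def)
  have \<pi>: "\<pi> (orb K y) = orb ?G y" for y
    unfolding \<pi>_def using orbK some_in_orb[OF K] by metis
  have surj: "\<exists>t\<in>T. orb K y = orb K (act t x)" if y: "y \<in> orb ?G x" for x y
  proof -
    obtain g where g: "g \<in> ?G" "y = act g x" using y by (auto simp: orb_def)
    obtain t where t: "t \<in> T" "g \<otimes> inv t \<in> K" using tr[OF g(1)] by auto
    have tG: "t \<in> ?G" using t T by auto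
    have "y = act (g \<otimes> inv t) (act t x)" using g tG by (simp add: act_mult act_inv)
    then have "y \<in> orb K (act t x)" using t by (auto simp: orb_def)
    then show ?thesis using t orb_eq[OF K] by auto
  qed
  have fib: "{P \<in> orb K ` Y. \<pi> P = orb ?G x} = (\<lambda>t. orb K (act t x)) ` {t \<in> T. act t x \<in> Y}" for x
  proof (intro equalityI subsetI)
    fix P assume "P \<in> {P \<in> orb K ` Y. \<pi> P = orb ?G x}"
    then obtain y where y: "y \<in> Y" "P = orb K y" "orb ?G y = orb ?G x" using \<pi> by auto
    then have "y \<in> orb ?G x" using orb_self[OF carrier_subgroup] by metis
    then obtain t where t: "t \<in> T" "orb K y = orb K (act t x)" using surj by metis
    then have "act t x \<in> orb K y" using orb_self[OF K] by metis
    then have "act t x \<in> Y" using Y(1) y(1) by (auto simp: orb_def invariant_def)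
    then show "P \<in> (\<lambda>t. orb K (act t x)) ` {t \<in> T. act t x \<in> Y}" using t y by auto
  next
    fix P assume "P \<in> (\<lambda>t. orb K (act t x)) ` {t \<in> T. act t x \<in> Y}"
    then obtain t where t: "t \<in> T" "act t x \<in> Y" "P = orb K (act t x)" by auto
    have "orb ?G (act t x) = orb ?G x"
      by (rule orb_eq[OF carrier_subgroup]) (use t T in \<open>auto simp: orb_def\<close>)
    then show "P \<in> {P \<in> orb K ` Y. \<pi> P = orb ?G x}" using t \<pi> by auto
  qed
  have inner: "(\<Sum>P \<in> {P \<in> orb K ` Y. \<pi> P = orb ?G x}. orbit_wt K P)
      = of_nat (card {t \<in> T. act t x \<in> Y}) / of_nat (card (stab ?G x))" for x
  proof -
    let ?B = "{t \<in> T. act t x \<in> Y}"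
    let ?f = "\<lambda>t. orb K (act t x)"
    have "of_nat (card ?B) / of_nat (card (stab ?G x)) = (\<Sum>t\<in>?B. 1 / rat_of_nat (card (stab ?G x)))"
      by simp
    also have "\<dots> = (\<Sum>P\<in>?f ` ?B. \<Sum>t\<in>{t \<in> ?B. ?f t = P}. 1 / rat_of_nat (card (stab ?G x)))"
      by (rule sum.image_gen) (use T in auto)
    also have "\<dots> = (\<Sum>P\<in>?f ` ?B. orbit_wt K P)"
    proof (rule sum.cong[OF refl])
      fix P assume "P \<in> ?f ` ?B"
      then obtain s where s: "s \<in> T" "act s x \<in> Y" "P = ?f s" by auto
      have sG: "s \<in> ?G" using s T by auto
      have "{t \<in> ?B. ?f t = P} = {t \<in> T. act t x \<in> orb K (act s x)}"
        using s Y(1) orb_eq_iff[OF K] by (auto simp: orb_def invariant_def)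
      then have c: "card {t \<in> ?B. ?f t = P} * card (stab K (act s x)) = card (stab ?G x)"
        using card_stab_transversal[OF K T(1) tr sG] by simp
      have ne: "card {t \<in> ?B. ?f t = P} \<noteq> 0" using s T by (auto simp: card_eq_0_iff)
      have "(\<Sum>t\<in>{t \<in> ?B. ?f t = P}. 1 / rat_of_nat (card (stab ?G x)))
         = rat_of_nat (card {t \<in> ?B. ?f t = P}) / rat_of_nat (card (stab ?G x))" by simp
      also have "\<dots> = 1 / rat_of_nat (card (stab K (act s x)))"
        unfolding c[symmetric] using ne by simp
      finally show "(\<Sum>t\<in>{t \<in> ?B. ?f t = P}. 1 / rat_of_nat (card (stab ?G x))) = orbit_wt K P"
        using orbit_wt_orb[OF K] s by simp
    qed
    finally show ?thesis unfolding fib by simp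
  qed
  have sub: "\<pi> ` (orb K ` Y) \<subseteq> orb ?G ` X" using \<pi> Y(2) by auto
  have "finite (orb K ` Y)"
  proof -
    have un: "orb K ` Y = (\<Union>Q\<in>orb ?G ` X. {P \<in> orb K ` Y. \<pi> P = Q})"
    proof (intro equalityI subsetI)
      fix P assume P: "P \<in> orb K ` Y"
      have "\<pi> P \<in> orb ?G ` X" by (rule subsetD[OF sub imageI[OF P]])
      then show "P \<in> (\<Union>Q\<in>orb ?G ` X. {P \<in> orb K ` Y. \<pi> P = Q})"
        using P by (intro UN_I[of "\<pi> P"]) simp_all
    next
      fix P assume "P \<in> (\<Union>Q\<in>orb ?G ` X. {P \<in> orb K ` Y. \<pi> P = Q})"
      then show "P \<in> orb K ` Y" by (elim UN_E CollectE conjE)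
    qed
    have "finite {P \<in> orb K ` Y. \<pi> P = Q}" if Q: "Q \<in> orb ?G ` X" for Q
    proof -
      obtain x where "Q = orb ?G x" using Q by blast
      then show ?thesis using fib[of x] T(2) by simp
    qed
    then show ?thesis by (subst un) (rule finite_UN_I[OF fin])
  qed
  then have "mass K Y = (\<Sum>Q\<in>orb ?G ` X. \<Sum>P \<in> {P \<in> orb K ` Y. \<pi> P = Q}. orbit_wt K P)"
    unfolding mass_def by (rule sum.group[symmetric, OF _ fin sub])
  also have "\<dots> = wsum X (\<lambda>x. of_nat (card {t \<in> T. act t x \<in> Y}))"
    unfolding wsum_def
  proof (rule sum.cong[OF refl])
    fix Q assume "Q \<in> orb ?G ` X"
    note Q = some_in_invariant[OF X this carrier_subgroup]
    show "(\<Sum>P \<in> {P \<in> orb K ` Y. \<pi> P = Q}. orbit_wt K P)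
      = of_nat (card {t \<in> T. act t (SOME x. x \<in> Q) \<in> Y}) * orbit_wt ?G Q"
      using inner[of "SOME x. x \<in> Q"] Q(2) by (simp add: orbit_wt_def)
  qed
  finally show ?thesis .
qed

text \<open>Right multiplication by \<open>g\<close> permutes the cosets represented by
  \<open>T\<close>. Injectivity gives one inequality, and the same argument for \<open>inv g\<close>
  the other.\<close>

lemma card_transversal_act:
  assumes K: "subgroup K G" and T: "T \<subseteq> carrier G" "finite T"
    and tr: "\<And>g. g \<in> carrier G \<Longrightarrow> \<exists>!t. t \<in> T \<and> g \<otimes> inv t \<in> K"
    and Y: "invariant K Y" and g: "g \<in> carrier G"
  shows "card {t \<in> T. act t (act g x) \<in> Y} = card {t \<in> T. act t x \<in> Y}"
proof -
  note cl = subgroup.m_closed[OF K] subgroup.m_inv_closed[OF K] subgroup.mem_carrier[OF K]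
  have le: "card {t \<in> T. act t (act g x) \<in> Y} \<le> card {t \<in> T. act t x \<in> Y}"
    if g: "g \<in> carrier G" for g x
  proof -
    define \<tau> where "\<tau> = (\<lambda>t. THE s. s \<in> T \<and> (t \<otimes> g) \<otimes> inv s \<in> K)"
    have \<tau>: "\<tau> t \<in> T \<and> (t \<otimes> g) \<otimes> inv (\<tau> t) \<in> K" if "t \<in> T" for t
      unfolding \<tau>_def by (rule theI') (use tr[of "t \<otimes> g"] that T g in auto)
    show ?thesis
    proof (rule card_inj_on_le[of \<tau>])
      show "inj_on \<tau> {t \<in> T. act t (act g x) \<in> Y}"
      proof (rule inj_onI)
        fix t t' assume "t \<in> {t \<in> T. act t (act g x) \<in> Y}" "t' \<in> {t \<in> T. act t (act g x) \<in> Y}"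
          and eq: "\<tau> t = \<tau> t'"
        then have t: "t \<in> T" "t' \<in> T" "t \<in> carrier G" "t' \<in> carrier G" using T by auto
        have s: "\<tau> t \<in> carrier G" using \<tau>[OF t(1)] T by auto
        have "((t \<otimes> g) \<otimes> inv (\<tau> t)) \<otimes> inv ((t' \<otimes> g) \<otimes> inv (\<tau> t)) = t \<otimes> inv t'"
          using t g s by (simp add: m_assoc inv_mult_group inv_cancel_left)
        then have "t \<otimes> inv t' \<in> K" using \<tau>[OF t(1)] \<tau>[OF t(2)] eq cl by metis
        moreover have "t \<otimes> inv t \<in> K" using t subgroup.one_closed[OF K] by simp
        ultimately show "t = t'" using tr[of t] t by auto
      qed
      show "\<tau> ` {t \<in> T. act t (act g x) \<in> Y} \<subseteq> {t \<in> T. act t x \<in> Y}"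
      proof (clarify, intro conjI)
        fix t assume t: "t \<in> T" "act t (act g x) \<in> Y"
        note \<tau>' = \<tau>[OF t(1)]
        show "\<tau> t \<in> T" using \<tau>' by simp
        have G: "t \<in> carrier G" "\<tau> t \<in> carrier G" using t \<tau>' T by auto
        let ?k = "(t \<otimes> g) \<otimes> inv (\<tau> t)"
        have "act (inv ?k) (act t (act g x)) = act (\<tau> t) x"
          using G g by (simp add: inv_mult_group act_mult act_inv)
        moreover have "act (inv ?k) (act t (act g x)) \<in> Y"
          using Y t cl(2) \<tau>' unfolding invariant_def by blast
        ultimately show "act (\<tau> t) x \<in> Y" by simp
      qed
    qed (use T in simp)
  qed
  show ?thesis using le[OF g, of x] le[of "inv g" "act g x"] g act_inv by force
qed

end

section \<open>Integral binary cubic forms\<close>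


type_synonym form = "int \<times> int \<times> int \<times> int"
type_synonym mat2 = "int \<times> int \<times> int \<times> int"

fun form_val :: "form \<Rightarrow> int \<Rightarrow> int \<Rightarrow> int" where
  "form_val (a, b, c, d) x y = a * x ^ 3 + b * x ^ 2 * y + c * x * y ^ 2 + d * y ^ 3"

fun form_disc :: "form \<Rightarrow> int" where
  "form_disc (a, b, c, d) =
     b ^ 2 * c ^ 2 - 4 * a * c ^ 3 - 4 * b ^ 3 * d - 27 * a ^ 2 * d ^ 2 + 18 * a * b * c * d"

fun hess :: "form \<Rightarrow> int \<times> int \<times> int" where
  "hess (a, b, c, d) = (b ^ 2 - 3 * a * c, b * c - 9 * a * d, c ^ 2 - 3 * b * d)"

fun mdet :: "mat2 \<Rightarrow> int" where
  "mdet (\<alpha>, \<beta>, \<gamma>, \<delta>) = \<alpha> * \<delta> - \<beta> * \<gamma>"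

fun mmul :: "mat2 \<Rightarrow> mat2 \<Rightarrow> mat2" where
  "mmul (\<alpha>, \<beta>, \<gamma>, \<delta>) (\<alpha>', \<beta>', \<gamma>', \<delta>') =
     (\<alpha> * \<alpha>' + \<beta> * \<gamma>', \<alpha> * \<beta>' + \<beta> * \<delta>', \<gamma> * \<alpha>' + \<delta> * \<gamma>', \<gamma> * \<beta>' + \<delta> * \<delta>')"

fun subst_form :: "mat2 \<Rightarrow> form \<Rightarrow> form" where
  "subst_form (\<alpha>, \<beta>, \<gamma>, \<delta>) (a, b, c, d) =
     (a * \<alpha> ^ 3 + b * \<alpha> ^ 2 * \<beta> + c * \<alpha> * \<beta> ^ 2 + d * \<beta> ^ 3,
      3 * a * \<alpha> ^ 2 * \<gamma> + b * (\<alpha> ^ 2 * \<delta> + 2 * \<alpha> * \<beta> * \<gamma>) + c * (2 * \<alpha> * \<beta> * \<delta> + \<beta> ^ 2 * \<gamma>) + 3 * d * \<beta> ^ 2 * \<delta>,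
      3 * a * \<alpha> * \<gamma> ^ 2 + b * (\<gamma> ^ 2 * \<beta> + 2 * \<alpha> * \<gamma> * \<delta>) + c * (\<alpha> * \<delta> ^ 2 + 2 * \<beta> * \<gamma> * \<delta>) + 3 * d * \<beta> * \<delta> ^ 2,
      a * \<gamma> ^ 3 + b * \<gamma> ^ 2 * \<delta> + c * \<gamma> * \<delta> ^ 2 + d * \<delta> ^ 3)"

fun scale :: "int \<Rightarrow> form \<Rightarrow> form" where
  "scale k (a, b, c, d) = (k * a, k * b, k * c, k * d)"

text \<open>The factor \<open>det M\<close> makes the action compatible with a change of basis of a cubic ring.\<close>

definition mact :: "mat2 \<Rightarrow> form \<Rightarrow> form" where
  "mact M f = scale (mdet M) (subst_form M f)"

definition GL2 :: "mat2 monoid" where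
  "GL2 = \<lparr>carrier = {M. \<bar>mdet M\<bar> = 1}, monoid.mult = mmul, one = (1, 0, 0, 1)\<rparr>"

text \<open>Lets identities between forms be proved on values, where the action of a matrix is a
  mere substitution.\<close>

lemma form_eqI:
  assumes "\<And>x y. form_val f x y = form_val g x y" shows "f = g"
proof -
  obtain a b c d where f: "f = (a, b, c, d)" by (cases f)
  obtain a' b' c' d' where g: "g = (a', b', c', d')" by (cases g)
  show ?thesis
    using assms[of 1 0] assms[of 0 1] assms[of 1 1] assms[of 1 "-1"] by (simp add: f g)
qed

lemma form_val_scale: "form_val (scale k f) x y = k * form_val f x y"
  by (cases f) (simp add: algebra_simps)

lemma form_val_subst:
  "form_val (subst_form (\<alpha>, \<beta>, \<gamma>, \<delta>) f) x y = form_val f (x * \<alpha> + y * \<gamma>) (x * \<beta> + y * \<delta>)"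
proof (cases f)
  case (fields a b c d)
  show ?thesis unfolding fields by (simp add: algebra_simps power2_eq_square power3_eq_cube)
qed

lemma form_val_mact:
  "form_val (mact (\<alpha>, \<beta>, \<gamma>, \<delta>) f) x y =
     (\<alpha> * \<delta> - \<beta> * \<gamma>) * form_val f (x * \<alpha> + y * \<gamma>) (x * \<beta> + y * \<delta>)"
  by (simp add: mact_def form_val_scale form_val_subst)

lemma mdet_mmul: "mdet (mmul M N) = mdet M * mdet N"
  by (cases M; cases N) (simp add: algebra_simps)

lemma mdet_sq: "\<bar>mdet M\<bar> = 1 \<Longrightarrow> mdet M * mdet M = 1"
  by (metis abs_mult_self_eq mult_1)

lemma group_GL2: "group GL2"
proof (rule groupI)
  fix M assume "M \<in> carrier GL2"
  then have M: "\<bar>mdet M\<bar> = 1" by (simp add: GL2_def)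
  obtain \<alpha> \<beta> \<gamma> \<delta> where [simp]: "M = (\<alpha>, \<beta>, \<gamma>, \<delta>)" by (cases M)
  let ?e = "\<alpha> * \<delta> - \<beta> * \<gamma>"
  let ?N = "(?e * \<delta>, - ?e * \<beta>, - ?e * \<gamma>, ?e * \<alpha>)"
  have e: "?e * ?e = 1" using mdet_sq[OF M] by simp
  have "mdet ?N = ?e * (?e * ?e)" by (simp add: algebra_simps)
  then have "?N \<in> carrier GL2" using e M by (simp add: GL2_def)
  moreover have "mmul ?N M = (?e * ?e, 0, 0, ?e * ?e)" by (simp add: algebra_simps)
  ultimately show "\<exists>N\<in>carrier GL2. N \<otimes>\<^bsub>GL2\<^esub> M = \<one>\<^bsub>GL2\<^esub>"
    unfolding e by (intro bexI[of _ ?N]) (auto simp: GL2_def)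
qed (auto simp: GL2_def mdet_mmul abs_mult algebra_simps)

lemma mact_one: "mact (1, 0, 0, 1) f = f"
  by (cases f) (simp add: mact_def)

lemma mact_mmul: "mact (mmul M N) f = mact M (mact N f)"
  by (rule form_eqI, cases M; cases N) (simp add: form_val_mact algebra_simps)

interpretation forms: set_action GL2 mact
proof (intro set_action.intro group_GL2 set_action_axioms.intro)
  show "mact \<one>\<^bsub>GL2\<^esub> f = f" for f by (simp add: GL2_def mact_one)
  show "mact (g \<otimes>\<^bsub>GL2\<^esub> k) f = mact g (mact k f)" for g k f by (simp add: GL2_def mact_mmul)
qed

lemma mem_GL2: "M \<in> carrier GL2 \<longleftrightarrow> \<bar>mdet M\<bar> = 1"
  by (simp add: GL2_def)

lemma hess_scale: "hess (scale k f) = (case hess f of (P, Q, R) \<Rightarrow> (k^2 * P, k^2 * Q, k^2 * R))"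
  by (cases f) (simp add: algebra_simps power2_eq_square)

lemma hess_subst:
  "hess (subst_form (\<alpha>, \<beta>, \<gamma>, \<delta>) f) = (case hess f of (P, Q, R) \<Rightarrow>
     let e = (\<alpha> * \<delta> - \<beta> * \<gamma>) ^ 2 in
     (e * (P * \<alpha> ^ 2 + Q * \<alpha> * \<beta> + R * \<beta> ^ 2),
      e * (2 * P * \<alpha> * \<gamma> + Q * (\<alpha> * \<delta> + \<beta> * \<gamma>) + 2 * R * \<beta> * \<delta>),
      e * (P * \<gamma> ^ 2 + Q * \<gamma> * \<delta> + R * \<delta> ^ 2)))"
proof (cases f)
  case (fields a b c d)
  show ?thesis unfolding fields by (simp add: Let_def, intro conjI; simp add: algebra_simps power2_eq_square power3_eq_cube)
qed

lemma hess_mact: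
  assumes "\<bar>mdet (\<alpha>, \<beta>, \<gamma>, \<delta>)\<bar> = 1"
  shows "hess (mact (\<alpha>, \<beta>, \<gamma>, \<delta>) f) = (case hess f of (P, Q, R) \<Rightarrow>
     (P * \<alpha> ^ 2 + Q * \<alpha> * \<beta> + R * \<beta> ^ 2,
      2 * P * \<alpha> * \<gamma> + Q * (\<alpha> * \<delta> + \<beta> * \<gamma>) + 2 * R * \<beta> * \<delta>,
      P * \<gamma> ^ 2 + Q * \<gamma> * \<delta> + R * \<delta> ^ 2))"
proof -
  have "(\<alpha> * \<delta> - \<beta> * \<gamma>) ^ 2 = 1" using mdet_sq[OF assms] by (simp add: power2_eq_square)
  then show ?thesis by (simp add: mact_def hess_scale hess_subst Let_def split: prod.splits)
qed

lemma hess_disc: "hess f = (P, Q, R) \<Longrightarrow> 3 * form_disc f = 4 * P * R - Q ^ 2"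
proof -
  assume H: "hess f = (P, Q, R)"
  obtain a b c d where f: "f = (a, b, c, d)" by (cases f)
  have PQR: "P = b ^ 2 - 3 * a * c" "Q = b * c - 9 * a * d" "R = c ^ 2 - 3 * b * d" using H f by auto
  show ?thesis unfolding PQR f by (simp add: algebra_simps power2_eq_square power3_eq_cube)
qed

text \<open>Up to the factor -3 the discriminant is that of the Hessian, which transforms as a
  quadratic form; this avoids expanding the discriminant of a substituted cubic.\<close>

lemma form_disc_mact:
  assumes "M \<in> carrier GL2" shows "form_disc (mact M f) = form_disc f"
proof -
  obtain \<alpha> \<beta> \<gamma> \<delta> where M: "M = (\<alpha>, \<beta>, \<gamma>, \<delta>)" by (cases M)
  obtain P Q R where H: "hess f = (P, Q, R)" by (cases "hess f")
  have d: "\<bar>mdet (\<alpha>, \<beta>, \<gamma>, \<delta>)\<bar> = 1" using assms by (simp add: mem_GL2 M)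
  then have e: "(\<alpha> * \<delta> - \<beta> * \<gamma>) ^ 2 = 1" using mdet_sq[OF d] by (simp add: power2_eq_square)
  have "3 * form_disc (mact M f) = (\<alpha> * \<delta> - \<beta> * \<gamma>) ^ 2 * (4 * P * R - Q ^ 2)"
    unfolding M by (subst hess_disc[OF hess_mact[OF d, of f, unfolded H prod.case]])
      (simp add: algebra_simps power2_eq_square)
  then show ?thesis using hess_disc[OF H] e by simp
qed

lemma form_disc_scale: "form_disc (scale k f) = k ^ 4 * form_disc f"
  by (cases f) (simp add: algebra_simps power2_eq_square power3_eq_cube power4_eq_xxxx)

lemma mact_scale: "mact M (scale k f) = scale k (mact M f)"
  by (rule form_eqI, cases M) (simp add: form_val_mact form_val_scale)

fun content_dvd :: "int \<Rightarrow> form \<Rightarrow> bool" where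
  "content_dvd k (a, b, c, d) \<longleftrightarrow> k dvd a \<and> k dvd b \<and> k dvd c \<and> k dvd d"

fun zmat_form :: "form \<Rightarrow> bool" where
  "zmat_form (a, b, c, d) \<longleftrightarrow> 3 dvd b \<and> 3 dvd c"

lemma content_dvd_iff: "content_dvd k f \<longleftrightarrow> (\<exists>g. f = scale k g)"
proof (cases f)
  case (fields a b c d)
  show ?thesis
  proof
    assume "content_dvd k f"
    then obtain a' b' c' d' where "f = scale k (a', b', c', d')" unfolding fields by (auto elim!: dvdE)
    then show "\<exists>g. f = scale k g" by blast
  qed (auto simp: fields)
qed

lemma content_dvd_mact: "content_dvd k f \<Longrightarrow> content_dvd k (mact M f)"
  unfolding content_dvd_iff using mact_scale by metis

lemma zmat_form_mact: "zmat_form f \<Longrightarrow> zmat_form (mact M f)"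
  by (cases f; cases M) (auto simp: mact_def elim!: dvdE)

section \<open>Finiteness of the class number\<close>


lemma finite_orbits_box:
  assumes "\<And>f. f \<in> X \<Longrightarrow> \<exists>g \<in> carrier GL2. \<exists>a b c d. mact g f = (a, b, c, d) \<and>
    \<bar>a\<bar> \<le> K \<and> \<bar>b\<bar> \<le> K \<and> \<bar>c\<bar> \<le> K \<and> \<bar>d\<bar> \<le> K"
  shows "finite (forms.orb (carrier GL2) ` X)"
proof (rule finite_subset)
  let ?B = "{-K..K} \<times> {-K..K} \<times> {-K..K} \<times> {-K..K}"
  show "forms.orb (carrier GL2) ` X \<subseteq> forms.orb (carrier GL2) ` ?B"
  proof
    fix Q assume "Q \<in> forms.orb (carrier GL2) ` X"
    then obtain f where f: "f \<in> X" "Q = forms.orb (carrier GL2) f" by blast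
    obtain g a b c d where g: "g \<in> carrier GL2" "mact g f = (a, b, c, d)"
      and K: "\<bar>a\<bar> \<le> K" "\<bar>b\<bar> \<le> K" "\<bar>c\<bar> \<le> K" "\<bar>d\<bar> \<le> K"
      using assms[OF f(1)] by blast
    have orbg: "mact g f \<in> forms.orb (carrier GL2) f" unfolding forms.orb_def using g(1) by (rule imageI)
    show "Q \<in> forms.orb (carrier GL2) ` ?B"
    proof (rule image_eqI)
      show "Q = forms.orb (carrier GL2) (mact g f)"
        using forms.orb_eq[OF forms.carrier_subgroup orbg] f(2) by simp
      show "mact g f \<in> ?B" using g(2) K by (simp add: abs_le_iff)
    qed
  qed
  show "finite (forms.orb (carrier GL2) ` ?B)" by (intro finite_imageI finite_cartesian_product) auto
qed

section \<open>Positive discriminant: reduction of the Hessian\<close>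

lemma hess_pos:
  assumes D: "form_disc f > 0" and H: "hess f = (P, Q, R)"
  shows "P > 0" "R > 0"
proof -
  obtain a b c d where f: "f = (a, b, c, d)" by (cases f)
  have PQR: "P = b ^ 2 - 3 * a * c" "Q = b * c - 9 * a * d" "R = c ^ 2 - 3 * b * d" using H f by auto
  have disc: "4 * P * R - Q ^ 2 > 0" using hess_disc[OF H] D by simp
  then have "4 * (P * R) > 0" using zero_le_power2[of Q] unfolding mult.assoc by linarith
  then have PR: "P * R > 0" by simp
  \<comment> \<open>The leading coefficients of the classical syzygy G^2 + 27 disc f^2 = 4 H^3,
    where H is the Hessian and G the cubic covariant of f. It excludes a negative definite
    Hessian.\<close>
  have "(2 * P * b - 3 * Q * a) ^ 2 + 9 * (4 * P * R - Q ^ 2) * a ^ 2 = 4 * P ^ 3"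
    unfolding PQR by (simp add: algebra_simps power2_eq_square power3_eq_cube)
  then have "4 * P ^ 3 \<ge> 0" using disc by (metis add_nonneg_nonneg less_imp_le mult_nonneg_nonneg zero_le_numeral zero_le_power2)
  moreover have "P \<noteq> 0" using PR by auto
  ultimately show "P > 0" by (simp add: zero_le_power_eq)
  then show "R > 0" using PR by (simp add: zero_less_mult_iff)
qed

lemma abs_le_square: "\<bar>x::int\<bar> \<le> x ^ 2"
  by (metis abs_mult_self_eq linorder_not_le mult_le_cancel_left1 abs_ge_zero abs_le_zero_iff power2_eq_square zabs_less_one_iff zero_less_abs_iff nless_le mult_zero_left)

text \<open>Reducedness gives Q^2 \<le> P R, hence P R \<le> E and P \<le> E. The syzygy then bounds
  \<open>a\<close>, and with P \<ge> 1 also \<open>b\<close>; the other two coefficients are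
  obtained from the reversed form. The bound is crude, since only its dependence on E alone
  matters.\<close>

lemma hess_bound:
  assumes D: "form_disc (a, b, c, d) > 0" and H: "hess (a, b, c, d) = (P, Q, R)"
    and Q: "\<bar>Q\<bar> \<le> P" "\<bar>Q\<bar> \<le> R"
  defines "E \<equiv> form_disc (a, b, c, d)"
  shows "\<bar>a\<bar> \<le> 4 * E ^ 3 + 3 * E ^ 3 \<and> \<bar>b\<bar> \<le> 4 * E ^ 3 + 3 * E ^ 3"
proof -
  have PQR: "P = b ^ 2 - 3 * a * c" "Q = b * c - 9 * a * d" "R = c ^ 2 - 3 * b * d" using H by auto
  note pos = hess_pos[OF D H]
  have E1: "E \<ge> 1" using D by (simp add: E_def)
  have disc: "4 * P * R - Q ^ 2 = 3 * E" using hess_disc[OF H] by (simp add: E_def)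
  have "Q ^ 2 \<le> P * R"
    using mult_mono[OF Q] pos by (simp add: power2_eq_square abs_mult[symmetric])
  then have PR: "P * R \<le> E" using disc by linarith
  have "P * 1 \<le> P * R" using pos by (intro mult_left_mono) auto
  then have PE: "P \<le> E" using PR by simp
  have P3: "P ^ 3 \<le> E ^ 3" using PE pos by (intro power_mono) auto
  have eq: "(2 * P * b - 3 * Q * a) ^ 2 + 27 * E * a ^ 2 = 4 * P ^ 3"
  proof -
    have "(2 * P * b - 3 * Q * a) ^ 2 + 9 * (4 * P * R - Q ^ 2) * a ^ 2 = 4 * P ^ 3"
      unfolding PQR by (simp add: algebra_simps power2_eq_square power3_eq_cube)
    then show ?thesis by (simp add: disc)
  qed
  have a2: "27 * E * a ^ 2 \<le> 4 * E ^ 3" using eq P3 zero_le_power2[of "2 * P * b - 3 * Q * a"] by linarith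
  then have "E * (27 * a ^ 2) \<le> E * (4 * E ^ 2)" by (simp add: power2_eq_square power3_eq_cube mult_ac)
  then have "27 * a ^ 2 \<le> 4 * E ^ 2" using E1 by (simp add: mult_le_cancel_left)
  then have "\<bar>a\<bar> ^ 2 \<le> E ^ 2" using zero_le_power2[of E] zero_le_power2[of a] unfolding power2_abs by linarith
  then have aE: "\<bar>a\<bar> \<le> E" by (rule power2_le_imp_le) (use E1 in simp)
  have EE: "E \<le> E ^ 3" "E ^ 2 \<le> E ^ 3" using E1 by (simp_all add: self_le_power power_increasing)
  have "\<bar>2 * P * b - 3 * Q * a\<bar> \<le> 4 * E ^ 3"
    using abs_le_square[of "2 * P * b - 3 * Q * a"] eq P3 E1 by (smt (verit) mult_nonneg_nonneg zero_le_power2)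
  moreover have "\<bar>Q * a\<bar> \<le> E * E" unfolding abs_mult using Q PE aE E1 by (intro mult_mono) auto
  ultimately have "\<bar>2 * P * b\<bar> \<le> 4 * E ^ 3 + 3 * E ^ 2" by (simp add: power2_eq_square abs_le_iff mult.assoc)
  moreover have "\<bar>b\<bar> \<le> \<bar>2 * P * b\<bar>" using pos by (simp add: abs_mult mult_le_cancel_right1)
  ultimately show ?thesis using aE EE E1 by auto
qed

text \<open>Minimality of the sum of the outer coefficients of the Hessian under the two elementary shears
  already makes it reduced.\<close>

lemma pos_disc_reduced:
  assumes D: "form_disc f = E" "E > 0"
  shows "\<exists>g \<in> carrier GL2. \<exists>a b c d. mact g f = (a, b, c, d) \<and>
    \<bar>a\<bar> \<le> 7 * E ^ 3 \<and> \<bar>b\<bar> \<le> 7 * E ^ 3 \<and> \<bar>c\<bar> \<le> 7 * E ^ 3 \<and> \<bar>d\<bar> \<le> 7 * E ^ 3"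
proof -
  \<comment> \<open>Truncation by \<open>nat\<close> loses nothing, because P and R are positive for
    every form in the orbit.\<close>
  define t where "t = (\<lambda>g. case hess (mact g f) of (P, Q, R) \<Rightarrow> nat (P + R))"
  obtain g where g: "g \<in> carrier GL2" "\<And>k. k \<in> carrier GL2 \<Longrightarrow> t g \<le> t k"
    using ex_has_least_nat[of "\<lambda>g. g \<in> carrier GL2" "(1, 0, 0, 1)" t] by (auto simp: mem_GL2)
  obtain a b c d where f': "mact g f = (a, b, c, d)" by (cases "mact g f")
  obtain P Q R where H: "hess (mact g f) = (P, Q, R)" by (cases "hess (mact g f)")
  have disc: "form_disc (mact k f) > 0" if "k \<in> carrier GL2" for k using form_disc_mact[OF that] D by simp
  note pos = hess_pos[OF disc[OF g(1)] H]
  have step: "P + R \<le> P' + R'" if k: "k \<in> carrier GL2" and H': "hess (mact k (mact g f)) = (P', Q', R')" for k P' Q' R'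
  proof -
    have kg: "k \<otimes>\<^bsub>GL2\<^esub> g \<in> carrier GL2" using k g by simp
    have eq: "mact k (mact g f) = mact (k \<otimes>\<^bsub>GL2\<^esub> g) f" using forms.act_mult k g by simp
    have "t g \<le> t (k \<otimes>\<^bsub>GL2\<^esub> g)" by (rule g(2)[OF kg])
    moreover have "P' + R' > 0" using hess_pos[OF disc[OF kg]] H' eq by fastforce
    ultimately show ?thesis using H H' eq by (simp add: t_def)
  qed
  have "P + R \<le> P + s * Q + R + R" "P + R \<le> P + (P + s * Q + R)" if s: "s = 1 \<or> s = - 1" for s
  proof -
    have k: "(1, s, 0, 1) \<in> carrier GL2" "(1, 0, s, 1) \<in> carrier GL2" by (simp_all add: mem_GL2)
    have "hess (mact (1, s, 0, 1) (mact g f)) = (P + Q * s + R * s ^ 2, Q + 2 * R * s, R)"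
      "hess (mact (1, 0, s, 1) (mact g f)) = (P, 2 * P * s + Q, P * s ^ 2 + Q * s + R)"
      using hess_mact[of 1 s 0 1 "mact g f"] hess_mact[of 1 0 s 1 "mact g f"] H by simp_all
    from step[OF k(1) this(1)] step[OF k(2) this(2)] show
      "P + R \<le> P + s * Q + R + R" "P + R \<le> P + (P + s * Q + R)" using s by auto
  qed
  from this[of 1] this[of "- 1"] have Q: "\<bar>Q\<bar> \<le> P" "\<bar>Q\<bar> \<le> R" by auto
  have Ef: "form_disc (a, b, c, d) = E" using form_disc_mact[OF g(1), of f] D f' by simp
  then have Ef': "form_disc (d, c, b, a) = E" by (simp add: mult_ac)
  have "\<bar>a\<bar> \<le> 4 * E ^ 3 + 3 * E ^ 3 \<and> \<bar>b\<bar> \<le> 4 * E ^ 3 + 3 * E ^ 3"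
    using hess_bound[of a b c d P Q R] H Q Ef D f' by simp
  moreover have "\<bar>d\<bar> \<le> 4 * E ^ 3 + 3 * E ^ 3 \<and> \<bar>c\<bar> \<le> 4 * E ^ 3 + 3 * E ^ 3"
    using hess_bound[of d c b a R Q P] H Q Ef' D f' by (simp add: mult_ac)
  ultimately show ?thesis using g(1) f' by (intro bexI[of _ g]) auto
qed

section \<open>Negative discriminant: a real linear factor times a definite quadratic one\<close>

definition splits :: "form \<Rightarrow> real \<Rightarrow> real \<Rightarrow> real \<Rightarrow> real \<Rightarrow> real \<Rightarrow> bool" where
  "splits f L M A B C \<longleftrightarrow> (\<forall>x y. real_of_int (form_val f x y) =
     (L * of_int x + M * of_int y) *
     (A * of_int x ^ 2 + B * of_int x * of_int y + C * of_int y ^ 2))"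

lemma splits_coeffs:
  assumes "splits (a, b, c, d) L M A B C"
  shows "a = L * A" "b = L * B + M * A" "c = L * C + M * B" "d = M * C"
proof -
  have e: "real_of_int (form_val (a, b, c, d) x y) = (L * of_int x + M * of_int y) *
     (A * of_int x ^ 2 + B * of_int x * of_int y + C * of_int y ^ 2)" for x y
    using assms by (simp only: splits_def)
  show 1: "a = L * A" using e[of 1 0] by simp
  show 2: "d = M * C" using e[of 0 1] by simp
  have "a + b + c + d = (L + M) * (A + B + C)" using e[of 1 1] by simp
  moreover have "a - b + c - d = (L - M) * (A - B + C)" using e[of 1 "- 1"] by simp
  ultimately show "b = L * B + M * A" "c = L * C + M * B" using 1 2 by (simp_all add: algebra_simps)
qed

lemma splitsI:
  assumes "real_of_int a = L * A" "real_of_int b = L * B + M * A" "real_of_int c = L * C + M * B"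
    "real_of_int d = M * C"
  shows "splits (a, b, c, d) L M A B C"
  unfolding splits_def form_val.simps
  by (simp add: assms algebra_simps power2_eq_square power3_eq_cube)

text \<open>The discriminant of a product is the product of the discriminants times the squared
  resultant. The resultant here is the quadratic factor evaluated at the zero (M : -L) of the linear
  one. Hence a negative discriminant makes the quadratic factor definite.\<close>

lemma splits_disc:
  assumes "splits f L M A B C"
  shows "- real_of_int (form_disc f) = (4 * A * C - B ^ 2) * (A * M ^ 2 - B * L * M + C * L ^ 2) ^ 2"
proof -
  obtain a b c d where f: "f = (a, b, c, d)" by (cases f)
  note * = splits_coeffs[OF assms[unfolded f]]
  show ?thesis unfolding f form_disc.simps
    by (simp add: * algebra_simps power2_eq_square power3_eq_cube)
qed

lemma subst_linear_times_quadratic: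
  fixes L M A B C \<alpha> \<beta> \<gamma> \<delta> x y :: real
  shows "(L * (x * \<alpha> + y * \<gamma>) + M * (x * \<beta> + y * \<delta>)) *
      (A * (x * \<alpha> + y * \<gamma>) ^ 2 + B * (x * \<alpha> + y * \<gamma>) * (x * \<beta> + y * \<delta>) + C * (x * \<beta> + y * \<delta>) ^ 2)
    = ((L * \<alpha> + M * \<beta>) * x + (L * \<gamma> + M * \<delta>) * y) *
      ((A * \<alpha> ^ 2 + B * \<alpha> * \<beta> + C * \<beta> ^ 2) * x ^ 2 +
       (2 * A * \<alpha> * \<gamma> + B * (\<alpha> * \<delta> + \<beta> * \<gamma>) + 2 * C * \<beta> * \<delta>) * x * y +
       (A * \<gamma> ^ 2 + B * \<gamma> * \<delta> + C * \<delta> ^ 2) * y ^ 2)"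
  by (rule arg_cong2[where f = "(*)"]) (simp_all add: algebra_simps power2_eq_square)

lemma splits_mact:
  assumes "splits f L M A B C"
  shows "splits (mact (\<alpha>, \<beta>, \<gamma>, \<delta>) f)
    (of_int (\<alpha> * \<delta> - \<beta> * \<gamma>) * (L * of_int \<alpha> + M * of_int \<beta>)) (of_int (\<alpha> * \<delta> - \<beta> * \<gamma>) * (L * of_int \<gamma> + M * of_int \<delta>))
    (A * of_int \<alpha> ^ 2 + B * of_int \<alpha> * of_int \<beta> + C * of_int \<beta> ^ 2)
    (2 * A * of_int \<alpha> * of_int \<gamma> + B * (of_int \<alpha> * of_int \<delta> + of_int \<beta> * of_int \<gamma>) + 2 * C * of_int \<beta> * of_int \<delta>)
    (A * of_int \<gamma> ^ 2 + B * of_int \<gamma> * of_int \<delta> + C * of_int \<delta> ^ 2)"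
  unfolding splits_def
proof (intro allI)
  fix x y :: int
  have eq: "(e * l * X + e * m * Y) * q = e * ((l * X + m * Y) * q)" for e l m X Y q :: real
    by (simp add: algebra_simps)
  show "real_of_int (form_val (mact (\<alpha>, \<beta>, \<gamma>, \<delta>) f) x y) =
     (of_int (\<alpha> * \<delta> - \<beta> * \<gamma>) * (L * of_int \<alpha> + M * of_int \<beta>) * of_int x
       + of_int (\<alpha> * \<delta> - \<beta> * \<gamma>) * (L * of_int \<gamma> + M * of_int \<delta>) * of_int y) *
     ((A * of_int \<alpha> ^ 2 + B * of_int \<alpha> * of_int \<beta> + C * of_int \<beta> ^ 2) * of_int x ^ 2 +
      (2 * A * of_int \<alpha> * of_int \<gamma> + B * (of_int \<alpha> * of_int \<delta> + of_int \<beta> * of_int \<gamma>)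
        + 2 * C * of_int \<beta> * of_int \<delta>) * of_int x * of_int y +
      (A * of_int \<gamma> ^ 2 + B * of_int \<gamma> * of_int \<delta> + C * of_int \<delta> ^ 2) * of_int y ^ 2)"
    unfolding eq subst_linear_times_quadratic[symmetric]
    using assms[unfolded splits_def, rule_format, of "x * \<alpha> + y * \<gamma>" "x * \<beta> + y * \<delta>"]
    unfolding form_val_mact by simp
qed

lemma cubic_real_root:
  fixes a b c d :: int
  assumes "a \<noteq> 0"
  shows "\<exists>\<theta>::real. a * \<theta> ^ 3 + b * \<theta> ^ 2 + c * \<theta> + d = 0"
proof -
  have pos: "\<exists>\<theta>::real. a * \<theta> ^ 3 + b * \<theta> ^ 2 + c * \<theta> + d = 0" if a: "a > 0" for a b c d :: int
  proof -
    \<comment> \<open>At \<open>N\<close> and \<open>- N\<close> the leading term outweighs the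
      other three, as a \<ge> 1, so the cubic changes sign in between.\<close>
    define N :: real where "N = 1 + \<bar>b\<bar> + \<bar>c\<bar> + \<bar>d\<bar>"
    have N: "N \<ge> 1" by (simp add: N_def)
    have N2: "N \<le> N ^ 2" "1 \<le> N ^ 2" using N by (simp_all add: self_le_power)
    have bd: "\<bar>b * N ^ 2\<bar> + \<bar>c * N\<bar> + \<bar>d\<bar> \<le> N ^ 3"
    proof -
      have "\<bar>b * N ^ 2\<bar> + \<bar>c * N\<bar> + \<bar>d\<bar> = \<bar>b\<bar> * N ^ 2 + \<bar>c\<bar> * N + \<bar>d\<bar> * (1::real)"
        using N by (simp add: abs_mult)
      also have "\<dots> \<le> \<bar>b\<bar> * N ^ 2 + \<bar>c\<bar> * N ^ 2 + \<bar>d\<bar> * N ^ 2"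
        using N2 by (intro add_mono mult_left_mono) auto
      also have "\<dots> = (N - 1) * N ^ 2" by (simp add: N_def algebra_simps)
      also have "\<dots> \<le> N * N ^ 2" by (intro mult_right_mono) auto
      finally show ?thesis by (simp add: power3_eq_cube power2_eq_square)
    qed
    have aN: "N ^ 3 \<le> a * N ^ 3" using a N by (simp add: mult_le_cancel_right1)
    have m3: "(- N) ^ 3 = - (N ^ 3)" by (simp add: power3_eq_cube)
    let ?f = "\<lambda>t::real. a * t ^ 3 + b * t ^ 2 + c * t + d"
    have "?f (- N) \<le> 0" "0 \<le> ?f N" using bd aN by (auto simp: m3)
    moreover have "continuous_on {- N..N} ?f" by (intro continuous_intros)
    ultimately show ?thesis using IVT'[of ?f "- N" 0 N] N by auto
  qed
  show ?thesis
  proof (cases "a > 0")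
    case False
    then have "- a > 0" using assms by simp
    from pos[OF this, of "- b" "- c" "- d"] obtain \<theta> :: real
      where "- a * \<theta> ^ 3 + - b * \<theta> ^ 2 + - c * \<theta> + - d = 0" by auto
    then have "a * \<theta> ^ 3 + b * \<theta> ^ 2 + c * \<theta> + d = 0" by simp
    then show ?thesis by blast
  qed (rule pos)
qed

lemma ex_splits: "\<exists>L M A B C. splits f L M A B C"
proof -
  obtain a b c d where f: "f = (a, b, c, d)" by (cases f)
  show ?thesis
  proof (cases "a = 0")
    case True
    have "splits f 0 1 b c d" unfolding f by (rule splitsI) (use True in auto)
    then show ?thesis by blast
  next
    case False
    then obtain \<theta> :: real where \<theta>: "a * \<theta> ^ 3 + b * \<theta> ^ 2 + c * \<theta> + d = 0" using cubic_real_root by blast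
    have "splits f 1 (- \<theta>) a (b + a * \<theta>) (c + b * \<theta> + a * \<theta> ^ 2)"
      unfolding f by (rule splitsI) (use \<theta> in \<open>auto simp: algebra_simps power2_eq_square power3_eq_cube\<close>)
    then show ?thesis by blast
  qed
qed


lemma posdef_bounds:
  fixes A B C x y :: real
  assumes "4 * A * C - B ^ 2 > 0"
  shows "(4 * A * C - B ^ 2) * y ^ 2 \<le> 4 * A * (A * x ^ 2 + B * x * y + C * y ^ 2)"
    "(4 * A * C - B ^ 2) * x ^ 2 \<le> 4 * C * (A * x ^ 2 + B * x * y + C * y ^ 2)"
proof -
  have "4 * A * (A * x ^ 2 + B * x * y + C * y ^ 2) = (2 * A * x + B * y) ^ 2 + (4 * A * C - B ^ 2) * y ^ 2"
    "4 * C * (A * x ^ 2 + B * x * y + C * y ^ 2) = (B * x + 2 * C * y) ^ 2 + (4 * A * C - B ^ 2) * x ^ 2"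
    by (simp_all add: algebra_simps power2_eq_square)
  then show "(4 * A * C - B ^ 2) * y ^ 2 \<le> 4 * A * (A * x ^ 2 + B * x * y + C * y ^ 2)"
    "(4 * A * C - B ^ 2) * x ^ 2 \<le> 4 * C * (A * x ^ 2 + B * x * y + C * y ^ 2)"
    using zero_le_power2[of "2 * A * x + B * y"] zero_le_power2[of "B * x + 2 * C * y"] by linarith+
qed

lemma posdef_pos:
  fixes A B C x y :: real
  assumes D: "4 * A * C - B ^ 2 > 0" and A: "A > 0" and xy: "x \<noteq> 0 \<or> y \<noteq> 0"
  shows "A * x ^ 2 + B * x * y + C * y ^ 2 > 0"
proof -
  have "A * C > 0" using D zero_le_power2[of B] by linarith
  then have C: "C > 0" using A by (simp add: zero_less_mult_iff)
  show ?thesis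
  proof (cases "y = 0")
    case True
    then show ?thesis using xy A by simp
  next
    case False
    then have "(4 * A * C - B ^ 2) * y ^ 2 > 0" using D by simp
    then have "4 * A * (A * x ^ 2 + B * x * y + C * y ^ 2) > 0" using posdef_bounds(1)[OF D, of y x] by linarith
    then show ?thesis using A by (simp add: zero_less_mult_iff)
  qed
qed

lemma int_le_ceiling_of_square: "real_of_int x ^ 2 \<le> K \<Longrightarrow> \<bar>x\<bar> \<le> \<lceil>K\<rceil>"
proof -
  assume K: "real_of_int x ^ 2 \<le> K"
  have "\<bar>x\<bar> \<le> x ^ 2" by (rule abs_le_square)
  then have "real_of_int \<bar>x\<bar> \<le> real_of_int x ^ 2" by (metis of_int_le_iff of_int_power)
  then have "real_of_int \<bar>x\<bar> \<le> K" using K by linarith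
  then show ?thesis by linarith
qed

text \<open>The sum of the outer coefficients is minimised as for the Hessian. Its values are now
  real, so a minimum exists only because definiteness leaves finitely many matrices with a value not
  above that of the identity.\<close>

lemma reduced_splitting:
  assumes s: "splits f L M A B C" and D: "4 * A * C - B ^ 2 > 0" and A: "A > 0"
  shows "\<exists>g \<in> carrier GL2. \<exists>L' M' A' B' C'. splits (mact g f) L' M' A' B' C' \<and>
    A' > 0 \<and> C' > 0 \<and> \<bar>B'\<bar> \<le> A' \<and> \<bar>B'\<bar> \<le> C'"
proof -
  define q where "q = (\<lambda>x y. A * of_int x ^ 2 + B * of_int x * of_int y + C * of_int y ^ 2)"
  define t where "t = (\<lambda>(\<alpha>, \<beta>, \<gamma>, \<delta>). q \<alpha> \<beta> + q \<gamma> \<delta>)"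
  have "A * C > 0" using D zero_le_power2[of B] by linarith
  then have C: "C > 0" using A by (simp add: zero_less_mult_iff)
  let ?d = "4 * A * C - B ^ 2"
  have q0: "q x y \<ge> 0" for x y
    using posdef_pos[OF D A, of x y] unfolding q_def by (cases "x = 0 \<and> y = 0") auto
  define S where "S = {g \<in> carrier GL2. t g \<le> t (1, 0, 0, 1)}"
  have "finite S"
  proof -
    let ?T = "t (1, 0, 0, 1)"
    let ?K = "\<lceil>4 * A * ?T / ?d\<rceil> + \<lceil>4 * C * ?T / ?d\<rceil>"
    have T0: "?T \<ge> 0" using q0 by (simp add: t_def)
    have bnd: "\<bar>x\<bar> \<le> ?K \<and> \<bar>y\<bar> \<le> ?K" if "q x y \<le> ?T" for x y
    proof -
      have T: "4 * A * q x y \<le> 4 * A * ?T" "4 * C * q x y \<le> 4 * C * ?T"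
        using A C that by (simp_all add: mult_left_mono)
      note b = posdef_bounds[OF D, where x = "real_of_int x" and y = "real_of_int y"]
      have "?d * of_int y ^ 2 \<le> 4 * A * ?T" by (rule order_trans[OF b(1) T(1)[unfolded q_def]])
      moreover have "?d * of_int x ^ 2 \<le> 4 * C * ?T" by (rule order_trans[OF b(2) T(2)[unfolded q_def]])
      ultimately have "real_of_int y ^ 2 \<le> 4 * A * ?T / ?d" "real_of_int x ^ 2 \<le> 4 * C * ?T / ?d"
        using D by (simp_all add: pos_le_divide_eq mult.commute)
      then have "\<bar>y\<bar> \<le> \<lceil>4 * A * ?T / ?d\<rceil>" "\<bar>x\<bar> \<le> \<lceil>4 * C * ?T / ?d\<rceil>" by (auto intro: int_le_ceiling_of_square)
      moreover have "\<lceil>4 * A * ?T / ?d\<rceil> \<ge> 0" "\<lceil>4 * C * ?T / ?d\<rceil> \<ge> 0"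
        using A C T0 D by (simp_all add: zero_le_ceiling order.strict_trans2[of "-1" 0])
      ultimately show ?thesis by linarith
    qed
    have "S \<subseteq> {-?K..?K} \<times> {-?K..?K} \<times> {-?K..?K} \<times> {-?K..?K}"
    proof
      fix g assume g: "g \<in> S"
      obtain \<alpha> \<beta> \<gamma> \<delta> where gd: "g = (\<alpha>, \<beta>, \<gamma>, \<delta>)" by (cases g)
      have "q \<alpha> \<beta> + q \<gamma> \<delta> \<le> ?T" using g by (simp add: S_def gd t_def)
      then have "q \<alpha> \<beta> \<le> ?T" "q \<gamma> \<delta> \<le> ?T" using q0[of \<alpha> \<beta>] q0[of \<gamma> \<delta>] by linarith+
      from bnd[OF this(1)] bnd[OF this(2)] show "g \<in> {-?K..?K} \<times> {-?K..?K} \<times> {-?K..?K} \<times> {-?K..?K}"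
        by (simp add: gd abs_le_iff)
    qed
    then show ?thesis by (rule finite_subset) (intro finite_cartesian_product finite_atLeastAtMost_int)
  qed
  moreover have one: "(1, 0, 0, 1) \<in> S" by (simp add: S_def mem_GL2)
  ultimately obtain g where g: "g \<in> S" "\<And>k. k \<in> S \<Longrightarrow> t g \<le> t k"
    using arg_min_if_finite(1)[of S t] arg_min_least[of S _ t] by blast
  have gG: "g \<in> carrier GL2" using g(1) by (simp add: S_def)
  have min: "t g \<le> t k" if "k \<in> carrier GL2" for k
    using g(2)[of k] g(2)[OF one] that by (cases "t k \<le> t (1, 0, 0, 1)") (auto simp: S_def)
  obtain \<alpha> \<beta> \<gamma> \<delta> where gd: "g = (\<alpha>, \<beta>, \<gamma>, \<delta>)" by (cases g)
  have det: "\<bar>\<alpha> * \<delta> - \<beta> * \<gamma>\<bar> = 1" using gG by (simp add: gd mem_GL2)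
  let ?A = "q \<alpha> \<beta>" and ?C = "q \<gamma> \<delta>" and ?B = "2 * A * of_int \<alpha> * of_int \<gamma> +
    B * (of_int \<alpha> * of_int \<delta> + of_int \<beta> * of_int \<gamma>) + 2 * C * of_int \<beta> * of_int \<delta>"
  have add: "q (\<alpha> + s * \<gamma>) (\<beta> + s * \<delta>) = ?A + s * ?B + s ^ 2 * ?C"
    "q (\<gamma> + s * \<alpha>) (\<delta> + s * \<beta>) = ?C + s * ?B + s ^ 2 * ?A" for s
    by (simp_all add: q_def algebra_simps power2_eq_square)
  have step: "?A + ?C \<le> (?A + s * ?B + ?C) + ?C" "?A + ?C \<le> ?A + (?C + s * ?B + ?A)" if s: "s = 1 \<or> s = - 1" for s :: int
  proof -
    have s2: "s ^ 2 = 1" using s by auto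
    have "(\<alpha> + s * \<gamma>, \<beta> + s * \<delta>, \<gamma>, \<delta>) \<in> carrier GL2" "(\<alpha>, \<beta>, \<gamma> + s * \<alpha>, \<delta> + s * \<beta>) \<in> carrier GL2"
      using det by (simp_all add: mem_GL2 algebra_simps)
    from min[OF this(1)] min[OF this(2)]
    show "?A + ?C \<le> (?A + s * ?B + ?C) + ?C" "?A + ?C \<le> ?A + (?C + s * ?B + ?A)"
      using s2 s by (auto simp: t_def gd add)
  qed
  from step[of 1] step[of "- 1"] have "\<bar>?B\<bar> \<le> ?A" "\<bar>?B\<bar> \<le> ?C" by (auto simp: abs_le_iff)
  moreover have "?A > 0" "?C > 0"
    unfolding q_def by (rule posdef_pos[OF D A]; use det in auto)+
  ultimately show ?thesis
    using splits_mact[OF s, of \<alpha> \<beta> \<gamma> \<delta>] gG unfolding gd q_def by blast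
qed

lemma le_one_plus_square: "\<bar>x::real\<bar> \<le> 1 + x ^ 2"
proof -
  have "0 \<le> (\<bar>x\<bar> - 1) ^ 2" by simp
  then have "2 * \<bar>x\<bar> \<le> 1 + x ^ 2" by (simp add: power2_diff)
  then show ?thesis by linarith
qed

lemma le_one_plus_fourth: "\<bar>x::real\<bar> \<le> 2 + x ^ 4"
  using le_one_plus_square[of x] le_one_plus_square[of "x ^ 2"] by simp

text \<open>Reducedness makes the resultant at least (X + Y) / 2 and 4 A C - B^2 at least 3 A C,
  whence A C (X + Y)^2 \<le> 2 e. The two factors are determined only up to reciprocal scalars, so
  the quantities bounded are those unaffected by rescaling: A C X^2, A C Y^2 and A C X Y.\<close>

lemma reduced_bound:
  assumes s: "splits (a, b, c, d) L M A B C" and AC: "0 < A" "A \<le> C" "\<bar>B\<bar> \<le> A"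
    and E: "form_disc (a, b, c, d) = - E" "E > 0"
  shows "\<bar>a\<bar> \<le> 10 * E ^ 2 \<and> \<bar>b\<bar> \<le> 10 * E ^ 2 \<and> \<bar>c\<bar> \<le> 10 * E ^ 2 \<and> \<bar>d\<bar> \<le> 10 * E ^ 2"
proof -
  note co = splits_coeffs[OF s]
  define X where "X = A * M ^ 2"
  define Y where "Y = C * L ^ 2"
  define e :: real where "e = of_int E"
  have e1: "e \<ge> 1" using E by (simp add: e_def)
  have C0: "C > 0" using AC by linarith
  have X0: "X \<ge> 0" "Y \<ge> 0" using AC C0 by (simp_all add: X_def Y_def)
  have BB: "B ^ 2 \<le> A * C"
    using mult_mono[of "\<bar>B\<bar>" A "\<bar>B\<bar>" C] AC by (simp add: power2_eq_square abs_mult[symmetric])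
  let ?N = "A * M ^ 2 - B * L * M + C * L ^ 2"
  have e: "e = (4 * A * C - B ^ 2) * ?N ^ 2" using splits_disc[OF s] unfolding E(1) e_def by simp
  have BLM: "\<bar>B * L * M\<bar> \<le> (X + Y) / 2"
  proof -
    have "4 * (B * L * M) ^ 2 \<le> 4 * (A * C) * (L * M) ^ 2"
      using mult_right_mono[OF BB, of "4 * (L * M) ^ 2"] by (simp add: power_mult_distrib mult_ac)
    also have "\<dots> = 4 * X * Y" by (simp add: X_def Y_def power2_eq_square mult_ac)
    also have "\<dots> \<le> (X + Y) ^ 2" using zero_le_power2[of "X - Y"] by (simp add: power2_eq_square algebra_simps)
    finally have "\<bar>2 * (B * L * M)\<bar> ^ 2 \<le> (X + Y) ^ 2" by (simp add: power_mult_distrib)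
    then have "\<bar>2 * (B * L * M)\<bar> \<le> X + Y" by (rule power2_le_imp_le) (use X0 in simp)
    then show ?thesis by simp
  qed
  have N: "?N \<ge> (X + Y) / 2" using BLM by (simp add: X_def[symmetric] Y_def[symmetric] abs_le_iff)
  have N2: "?N ^ 2 \<ge> ((X + Y) / 2) ^ 2" using N X0 by (intro power_mono) auto
  have "3 * (A * C) * ((X + Y) / 2) ^ 2 \<le> (4 * A * C - B ^ 2) * ?N ^ 2"
  proof (rule mult_mono)
    have "B ^ 2 \<le> A * C" "0 \<le> A * C" using BB AC C0 by auto
    then show "3 * (A * C) \<le> 4 * A * C - B ^ 2" "0 \<le> 4 * A * C - B ^ 2" unfolding mult.assoc by linarith+
  qed (use N2 in auto)
  then have key: "(A * C) * (X + Y) ^ 2 \<le> 2 * e" using e e1 by (simp add: power_divide)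
  have XY: "X ^ 2 \<le> (X + Y) ^ 2" "Y ^ 2 \<le> (X + Y) ^ 2" "X * Y \<le> (X + Y) ^ 2"
    using X0 by (auto simp: power2_eq_square algebra_simps)
  have AC0: "A * C \<ge> 0" using AC C0 by simp
  have kX: "A * C * X ^ 2 \<le> 2 * e" using mult_left_mono[OF XY(1) AC0] key by linarith
  have kY: "A * C * Y ^ 2 \<le> 2 * e" using mult_left_mono[OF XY(2) AC0] key by linarith
  have kXY: "A * C * (X * Y) \<le> 2 * e" using mult_left_mono[OF XY(3) AC0] key by linarith
  have AAC: "A * A \<le> A * C" using AC by simp
  have a4: "real_of_int a ^ 4 \<le> 2 * e"
  proof -
    have "real_of_int a ^ 4 = (A * A) * (A * L ^ 2) ^ 2" by (simp add: co eval_nat_numeral)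
    also have "\<dots> \<le> (A * C) * (C * L ^ 2) ^ 2"
      by (intro mult_mono power_mono mult_right_mono AAC) (use AC C0 in auto)
    finally show ?thesis using kY by (simp add: Y_def)
  qed
  have MA4: "(M * A) ^ 4 \<le> 2 * e"
  proof -
    have "(M * A) ^ 4 = (A * A) * X ^ 2" by (simp add: X_def eval_nat_numeral)
    also have "\<dots> \<le> (A * C) * X ^ 2" by (intro mult_right_mono AAC) simp
    finally show ?thesis using kX by simp
  qed
  have ad: "real_of_int (a * d) ^ 2 \<le> 2 * e"
    using kXY by (simp add: co X_def Y_def power2_eq_square mult_ac)
  have aLC: "(real_of_int a * (L * C)) ^ 2 \<le> 2 * e"
  proof -
    have "(real_of_int a * (L * C)) ^ 2 = (A * A) * Y ^ 2" by (simp add: co Y_def power2_eq_square mult_ac)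
    also have "\<dots> \<le> (A * C) * Y ^ 2" by (intro mult_right_mono AAC) simp
    finally show ?thesis using kY by simp
  qed
  have ba: "\<bar>real_of_int a\<bar> \<le> 2 + 2 * e" using le_one_plus_fourth[of a] a4 by linarith
  have bMA: "\<bar>M * A\<bar> \<le> 2 + 2 * e" using le_one_plus_fourth[of "M * A"] MA4 by linarith
  have LB: "\<bar>L * B\<bar> \<le> \<bar>real_of_int a\<bar>" unfolding co abs_mult using AC by (intro mult_left_mono) auto
  have MB: "\<bar>M * B\<bar> \<le> \<bar>M * A\<bar>" unfolding abs_mult using AC by (intro mult_left_mono) auto
  have bb: "\<bar>real_of_int b\<bar> \<le> 4 + 4 * e" unfolding co(2) using LB ba bMA by linarith
  \<comment> \<open>Integrality enters here: if a is nonzero, multiplication by a does not decrease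
    |L C| and |d|, and the products are under control. If a = 0, then L = 0 and b takes over this
    role.\<close>
  have "\<bar>real_of_int c\<bar> \<le> 4 + 4 * e \<and> \<bar>real_of_int d\<bar> \<le> 2 + 4 * e ^ 2"
  proof (cases "a = 0")
    case False
    then have a1: "1 \<le> \<bar>real_of_int a\<bar>" by linarith
    have "\<bar>L * C\<bar> \<le> \<bar>real_of_int a\<bar> * \<bar>L * C\<bar>" using mult_right_mono[OF a1, of "\<bar>L * C\<bar>"] by simp
    also have "\<dots> \<le> 1 + 2 * e" using le_one_plus_square[of "a * (L * C)"] aLC by (simp add: abs_mult)
    finally have "\<bar>real_of_int c\<bar> \<le> 4 + 4 * e" unfolding co(3) using MB bMA by linarith
    moreover have "\<bar>real_of_int d\<bar> \<le> \<bar>real_of_int a\<bar> * \<bar>real_of_int d\<bar>"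
      using mult_right_mono[OF a1, of "\<bar>real_of_int d\<bar>"] by simp
    then have "\<bar>real_of_int d\<bar> \<le> 1 + 2 * e" using le_one_plus_square[of "a * d"] ad by (simp add: abs_mult)
    moreover have "e \<le> e ^ 2" using e1 by (simp add: self_le_power)
    ultimately show ?thesis using e1 by linarith
  next
    case True
    then have L: "L = 0" using co(1) AC by simp
    have "b \<noteq> 0"
    proof
      assume "b = 0"
      then have "e = 0" using co(2) e L AC by simp
      then show False using e1 by simp
    qed
    then have b1: "1 \<le> \<bar>real_of_int b\<bar>" by linarith
    have bMA': "real_of_int b = M * A" using co L by simp
    have "\<bar>real_of_int c\<bar> \<le> 2 + 2 * e" unfolding co(3) using L MB bMA by simp
    have MA2: "1 \<le> (M * A) ^ 2" using power_mono[OF b1, of 2] by (simp add: bMA')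
    \<comment> \<open>A C X^2 equals (C / A) b^4 with |b| \<ge> 1, which bounds the ratio C / A; the
      square of b d = (M A) (M C) is A C X^2 times this ratio.\<close>
    have "C / A \<le> A * C * X ^ 2"
    proof -
      have "A * C * X ^ 2 = (C / A) * (((M * A) ^ 2) ^ 2)"
        using AC by (simp add: X_def power2_eq_square field_simps)
      moreover have "1 \<le> ((M * A) ^ 2) ^ 2" using MA2 one_le_power by blast
      moreover have "C / A \<ge> 0" using AC C0 by simp
      ultimately show ?thesis using mult_left_mono[of 1 "((M * A) ^ 2) ^ 2" "C / A"] by simp
    qed
    then have CA: "C / A \<le> 2 * e" using kX by linarith
    have "(real_of_int b * real_of_int d) ^ 2 = (A * C * X ^ 2) * (C / A)"
      using AC by (simp add: bMA' co(4) X_def power2_eq_square field_simps)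
    also have "\<dots> \<le> (2 * e) * (2 * e)" by (rule mult_mono[OF kX CA]) (use AC C0 e1 in auto)
    finally have bd: "(real_of_int b * real_of_int d) ^ 2 \<le> 4 * e ^ 2" by (simp add: power2_eq_square)
    have "\<bar>real_of_int d\<bar> \<le> \<bar>real_of_int b\<bar> * \<bar>real_of_int d\<bar>"
      using mult_right_mono[OF b1, of "\<bar>real_of_int d\<bar>"] by simp
    then have "\<bar>real_of_int d\<bar> \<le> 1 + 4 * e ^ 2"
      using le_one_plus_square[of "b * d"] bd by (simp add: abs_mult)
    then show ?thesis using \<open>\<bar>real_of_int c\<bar> \<le> 2 + 2 * e\<close> e1 by linarith
  qed
  moreover have ee: "e \<le> e ^ 2" "1 \<le> e ^ 2" using e1 by (simp_all add: self_le_power)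
  ultimately have "\<bar>real_of_int a\<bar> \<le> 10 * e ^ 2" "\<bar>real_of_int b\<bar> \<le> 10 * e ^ 2"
    "\<bar>real_of_int c\<bar> \<le> 10 * e ^ 2" "\<bar>real_of_int d\<bar> \<le> 10 * e ^ 2"
    using ba bb by linarith+
  moreover have "10 * e ^ 2 = real_of_int (10 * E ^ 2)" by (simp add: e_def)
  ultimately show ?thesis by (simp only: of_int_abs[symmetric] of_int_le_iff)
qed

lemma neg_disc_reduced:
  assumes D: "form_disc f = - E" "E > 0"
  shows "\<exists>g \<in> carrier GL2. \<exists>a b c d. mact g f = (a, b, c, d) \<and>
    \<bar>a\<bar> \<le> 10 * E ^ 2 \<and> \<bar>b\<bar> \<le> 10 * E ^ 2 \<and> \<bar>c\<bar> \<le> 10 * E ^ 2 \<and> \<bar>d\<bar> \<le> 10 * E ^ 2"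
proof -
  obtain L M A B C where s: "splits f L M A B C" using ex_splits by blast
  let ?N = "A * M ^ 2 - B * L * M + C * L ^ 2"
  have "real_of_int E = (4 * A * C - B ^ 2) * ?N ^ 2" using splits_disc[OF s] unfolding D(1) by simp
  then have "(4 * A * C - B ^ 2) * ?N ^ 2 > 0" using D by (metis of_int_0_less_iff)
  then have pd: "4 * A * C - B ^ 2 > 0" by (simp add: zero_less_mult_iff)
  have "\<exists>L M A B C. splits f L M A B C \<and> 4 * A * C - B ^ 2 > 0 \<and> A > 0"
  proof (cases "A > 0")
    case False
    have "A \<noteq> 0" using pd by auto
    moreover have "splits f (- L) (- M) (- A) (- B) (- C)"
      using s by (simp add: splits_def algebra_simps)
    ultimately show ?thesis using pd False by (intro exI[of _ "- L"] exI[of _ "- M"] exI[of _ "- A"] exI[of _ "- B"] exI[of _ "- C"]) auto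
  qed (use s pd in blast)
  then obtain g L' M' A' B' C' where g: "g \<in> carrier GL2" and s': "splits (mact g f) L' M' A' B' C'"
    and r: "A' > 0" "C' > 0" "\<bar>B'\<bar> \<le> A'" "\<bar>B'\<bar> \<le> C'" using reduced_splitting by meson
  obtain a b c d where f': "mact g f = (a, b, c, d)" by (cases "mact g f")
  have disc: "form_disc (a, b, c, d) = - E" using form_disc_mact[OF g, of f] D f' by simp
  have "\<bar>a\<bar> \<le> 10 * E ^ 2 \<and> \<bar>b\<bar> \<le> 10 * E ^ 2 \<and> \<bar>c\<bar> \<le> 10 * E ^ 2 \<and> \<bar>d\<bar> \<le> 10 * E ^ 2"
  proof (cases "A' \<le> C'")
    case True
    then show ?thesis using reduced_bound[OF s'[unfolded f'] r(1) _ r(3) disc D(2)] by simp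
  next
    case False
    note co = splits_coeffs[OF s'[unfolded f']]
    have "splits (d, c, b, a) M' L' C' B' A'" by (rule splitsI) (use co in \<open>auto simp: algebra_simps\<close>)
    moreover have "form_disc (d, c, b, a) = - E" using disc by (simp add: mult_ac)
    ultimately show ?thesis using reduced_bound[of d c b a M' L' C' B' A' E] r False D by simp
  qed
  then show ?thesis using g f' by blast
qed

theorem finite_orbits_disc:
  assumes "E \<noteq> 0" shows "finite (forms.orb (carrier GL2) ` {f. form_disc f = E})"
proof (cases "E > 0")
  case True
  show ?thesis by (rule finite_orbits_box[of _ "7 * E ^ 3"]) (use pos_disc_reduced True in blast)
next
  case False
  then have "- E > 0" using assms by simp
  then show ?thesis
    using neg_disc_reduced[of _ "- E"] by (intro finite_orbits_box[of _ "10 * (- E) ^ 2"]) auto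
qed

section \<open>The congruence subgroup and its transversal\<close>


text \<open>Forms are evaluated at row vectors times the matrix, so p | \<beta> says that the matrix
  fixes the point (1 : 0) modulo p. The first rows (0, 1) and (1, j) of \<open>transv\<close>
  accordingly run through the p + 1 points of the projective line.\<close>

definition Gam0 :: "int \<Rightarrow> mat2 set" where
  "Gam0 p = {M \<in> carrier GL2. case M of (\<alpha>, \<beta>, \<gamma>, \<delta>) \<Rightarrow> p dvd \<beta>}"

definition transv :: "int \<Rightarrow> mat2 set" where
  "transv p = insert (0, 1, 1, 0) ((\<lambda>j. (1, j, 0, 1)) ` {0..<p})"

lemma finite_transv: "finite (transv p)"
  by (simp add: transv_def)

lemma card_transv: "p \<ge> 0 \<Longrightarrow> card (transv p) = nat p + 1"
proof -
  assume "p \<ge> 0"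
  have "card ((\<lambda>j::int. (1::int, j, 0::int, 1::int)) ` {0..<p}) = nat p"
    by (subst card_image) (simp_all add: inj_on_def)
  moreover have "(0, 1, 1, 0) \<notin> (\<lambda>j::int. (1::int, j, 0::int, 1::int)) ` {0..<p}"
    by (simp add: image_iff)
  ultimately show ?thesis by (simp add: transv_def)
qed

lemma transv_GL2: "transv p \<subseteq> carrier GL2"
  by (auto simp: transv_def mem_GL2)

lemma inv_GL2:
  assumes "(\<alpha>, \<beta>, \<gamma>, \<delta>) \<in> carrier GL2"
  shows "inv\<^bsub>GL2\<^esub> (\<alpha>, \<beta>, \<gamma>, \<delta>) =
    (let e = \<alpha> * \<delta> - \<beta> * \<gamma> in (e * \<delta>, - e * \<beta>, - e * \<gamma>, e * \<alpha>))"
proof -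
  let ?e = "\<alpha> * \<delta> - \<beta> * \<gamma>"
  let ?N = "(?e * \<delta>, - ?e * \<beta>, - ?e * \<gamma>, ?e * \<alpha>)"
  have M: "\<bar>mdet (\<alpha>, \<beta>, \<gamma>, \<delta>)\<bar> = 1" using assms by (simp add: mem_GL2)
  have e: "?e * ?e = 1" using mdet_sq[OF M] by simp
  have "mdet ?N = ?e * (?e * ?e)" by (simp add: algebra_simps)
  then have N: "?N \<in> carrier GL2" using e M by (simp add: GL2_def)
  have "mmul ?N (\<alpha>, \<beta>, \<gamma>, \<delta>) = (?e * ?e, 0, 0, ?e * ?e)" by (simp add: algebra_simps)
  then have "?N \<otimes>\<^bsub>GL2\<^esub> (\<alpha>, \<beta>, \<gamma>, \<delta>) = \<one>\<^bsub>GL2\<^esub>" unfolding e by (simp add: GL2_def)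
  then show ?thesis using forms.inv_equality[OF _ assms N] by (simp add: Let_def algebra_simps)
qed

lemma subgroup_Gam0: "subgroup (Gam0 p) GL2"
proof -
  show ?thesis
  proof (rule forms.subgroupI)
    have "(1, 0, 0, 1) \<in> Gam0 p" by (simp add: Gam0_def GL2_def)
    then show "Gam0 p \<noteq> {}" by blast
    show "Gam0 p \<subseteq> carrier GL2" by (auto simp: Gam0_def)
  next
    fix M assume M: "M \<in> Gam0 p"
    obtain \<alpha> \<beta> \<gamma> \<delta> where [simp]: "M = (\<alpha>, \<beta>, \<gamma>, \<delta>)" by (cases M)
    have MG: "M \<in> carrier GL2" and p: "p dvd \<beta>" using M by (auto simp: Gam0_def)
    show "inv\<^bsub>GL2\<^esub> M \<in> Gam0 p"
      using forms.inv_closed[OF MG] inv_GL2[of \<alpha> \<beta> \<gamma> \<delta>] MG p by (auto simp: Gam0_def Let_def)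
  next
    fix M N assume "M \<in> Gam0 p" "N \<in> Gam0 p"
    then show "M \<otimes>\<^bsub>GL2\<^esub> N \<in> Gam0 p"
      by (cases M; cases N) (auto simp: Gam0_def GL2_def mdet_mmul[of "(_,_,_,_)" "(_,_,_,_)", simplified] abs_mult)
  qed
qed

lemma ex1_residue:
  fixes p \<alpha> \<beta> :: int
  assumes p: "prime p" and a: "\<not> p dvd \<alpha>"
  shows "\<exists>!j. j \<in> {0..<p} \<and> p dvd \<beta> - \<alpha> * j"
proof -
  have p0: "p > 0" using p prime_gt_0_int by auto
  have "coprime \<alpha> p" using p a prime_imp_coprime coprime_commute by metis
  then obtain u where u: "[\<alpha> * u = 1] (mod p)" using cong_solve_coprime_int by blast
  let ?j = "(u * \<beta>) mod p"
  have "[\<alpha> * ?j = (\<alpha> * u) * \<beta>] (mod p)" by (simp add: cong_def mod_mult_right_eq mult.assoc)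
  moreover have "[(\<alpha> * u) * \<beta> = 1 * \<beta>] (mod p)" by (rule cong_mult[OF u cong_refl])
  ultimately have "[\<beta> = \<alpha> * ?j] (mod p)" by (metis cong_sym cong_trans mult_1)
  then have "p dvd \<beta> - \<alpha> * ?j" by (simp add: cong_iff_dvd_diff)
  moreover have "?j \<in> {0..<p}" using p0 by simp
  moreover have "i = j" if "i \<in> {0..<p}" "p dvd \<beta> - \<alpha> * i" "j \<in> {0..<p}" "p dvd \<beta> - \<alpha> * j" for i j
  proof -
    have "p dvd (\<beta> - \<alpha> * j) - (\<beta> - \<alpha> * i)" using that dvd_diff by blast
    then have "p dvd \<alpha> * (i - j)" by (simp add: algebra_simps)
    then have "p dvd i - j" using p a prime_dvd_multD by blast
    then show ?thesis using that by (metis atLeastLessThan_iff mod_pos_pos_trivial mod_eq_dvd_iff)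
  qed
  ultimately show ?thesis by blast
qed

text \<open>The coset of \<open>g\<close> is the point (\<alpha> : \<beta>) modulo p given by its
  first row, which is nonzero because the determinant is a unit; the condition on \<open>t\<close>
  says that its first row is proportional to that of \<open>g\<close>.\<close>

lemma transv_unique:
  assumes p: "prime p" and g: "g \<in> carrier GL2"
  shows "\<exists>!t. t \<in> transv p \<and> g \<otimes>\<^bsub>GL2\<^esub> inv\<^bsub>GL2\<^esub> t \<in> Gam0 p"
proof -
  obtain \<alpha> \<beta> \<gamma> \<delta> where gd: "g = (\<alpha>, \<beta>, \<gamma>, \<delta>)" by (cases g)
  have mem: "g \<otimes>\<^bsub>GL2\<^esub> inv\<^bsub>GL2\<^esub> t \<in> Gam0 p \<longleftrightarrow> (case mmul g (inv\<^bsub>GL2\<^esub> t) of (\<alpha>, \<beta>, \<gamma>, \<delta>) \<Rightarrow> p dvd \<beta>)"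
    if "t \<in> transv p" for t
  proof -
    have "g \<otimes>\<^bsub>GL2\<^esub> inv\<^bsub>GL2\<^esub> t \<in> carrier GL2" using g that transv_GL2 by blast
    then show ?thesis by (simp add: Gam0_def) (simp add: GL2_def)
  qed
  have j: "g \<otimes>\<^bsub>GL2\<^esub> inv\<^bsub>GL2\<^esub> (1, j, 0, 1) \<in> Gam0 p \<longleftrightarrow> p dvd \<beta> - \<alpha> * j" if "j \<in> {0..<p}" for j
    using mem[of "(1, j, 0, 1)"] that inv_GL2[of 1 j 0 1] by (simp add: gd transv_def mem_GL2 algebra_simps)
  have w: "g \<otimes>\<^bsub>GL2\<^esub> inv\<^bsub>GL2\<^esub> (0, 1, 1, 0) \<in> Gam0 p \<longleftrightarrow> p dvd \<alpha>"
    using mem[of "(0, 1, 1, 0)"] inv_GL2[of 0 1 1 0] by (simp add: gd transv_def mem_GL2 algebra_simps)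
  show ?thesis
  proof (cases "p dvd \<alpha>")
    case True
    have "\<not> p dvd \<beta> - \<alpha> * j" for j
    proof
      assume "p dvd \<beta> - \<alpha> * j"
      then have "p dvd (\<beta> - \<alpha> * j) + \<alpha> * j" using True by (intro dvd_add) auto
      then have "p dvd \<beta>" by simp
      then have "p dvd mdet g" using True by (simp add: gd)
      then show False using g p by (metis abs_dvd_iff dvd_abs_iff mem_GL2 not_prime_unit)
    qed
    then show ?thesis using True j w by (intro ex1I[of _ "(0, 1, 1, 0)"]) (auto simp: transv_def)
  next
    case False
    from ex1_residue[OF p this, of \<beta>] obtain j0 where j0: "j0 \<in> {0..<p} \<and> p dvd \<beta> - \<alpha> * j0"
      "\<forall>j. j \<in> {0..<p} \<and> p dvd \<beta> - \<alpha> * j \<longrightarrow> j = j0" by (rule ex1E)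
    show ?thesis
    proof (rule ex1I[of _ "(1, j0, 0, 1)"])
      show "(1, j0, 0, 1) \<in> transv p \<and> g \<otimes>\<^bsub>GL2\<^esub> inv\<^bsub>GL2\<^esub> (1, j0, 0, 1) \<in> Gam0 p"
        using j j0(1) by (simp add: transv_def)
      fix t assume t: "t \<in> transv p \<and> g \<otimes>\<^bsub>GL2\<^esub> inv\<^bsub>GL2\<^esub> t \<in> Gam0 p"
      then have "t \<noteq> (0, 1, 1, 0)" using w False by blast
      then obtain i where "t = (1, i, 0, 1)" "i \<in> {0..<p}" using t by (auto simp: transv_def)
      then show "t = (1, j0, 0, 1)" using j t j0(2) by simp
    qed
  qed
qed

text \<open>Transversal elements stand for points of the projective line over \<open>\<int>/p\<int>\<close>: moving a form by
  the element of a point puts that point at \<open>(1 : 0)\<close>. Hence \<open>hits p P f\<close> is the number of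
  points at which \<open>f\<close> has the local property \<open>P\<close>.\<close>

definition hits :: "int \<Rightarrow> (form \<Rightarrow> bool) \<Rightarrow> form \<Rightarrow> nat" where
  "hits p P f = card {t \<in> transv p. P (mact t f)}"

definition Gam0_stable :: "int \<Rightarrow> (form \<Rightarrow> bool) \<Rightarrow> bool" where
  "Gam0_stable p P \<longleftrightarrow> (\<forall>M \<in> Gam0 p. \<forall>f. P f \<longrightarrow> P (mact M f))"

lemma hits_mact:
  assumes "prime p" "Gam0_stable p P" "g \<in> carrier GL2"
  shows "hits p P (mact g f) = hits p P f"
  using forms.card_transversal_act[OF subgroup_Gam0 transv_GL2 finite_transv transv_unique[OF assms(1)],
      of "Collect P" g f] assms
  by (auto simp: hits_def forms.invariant_def Gam0_stable_def)

lemma mass_Gam0: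
  assumes p: "prime p" and P: "Gam0_stable p P"
    and X: "forms.invariant (carrier GL2) X" and fin: "finite (forms.orb (carrier GL2) ` X)"
  shows "forms.mass (Gam0 p) {f \<in> X. P f} = forms.wsum X (\<lambda>f. of_nat (hits p P f))"
proof -
  have inv: "forms.invariant (Gam0 p) {f \<in> X. P f}"
    using P X by (auto simp: forms.invariant_def Gam0_stable_def Gam0_def)
  have "forms.mass (Gam0 p) {f \<in> X. P f}
     = forms.wsum X (\<lambda>f. of_nat (card {t \<in> transv p. mact t f \<in> {f \<in> X. P f}}))"
    by (rule forms.mass_subgroup[OF subgroup_Gam0 transv_GL2 finite_transv _ X fin inv])
      (use transv_unique[OF p] in auto)
  also have "\<dots> = forms.wsum X (\<lambda>f. of_nat (hits p P f))"
  proof (rule forms.wsum_cong[OF X])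
    fix f assume "f \<in> X"
    then have "{t \<in> transv p. mact t f \<in> {f \<in> X. P f}} = {t \<in> transv p. P (mact t f)}"
      using X transv_GL2 by (auto simp: forms.invariant_def)
    then show "rat_of_nat (card {t \<in> transv p. mact t f \<in> {f \<in> X. P f}}) = of_nat (hits p P f)"
      by (simp add: hits_def)
  qed
  finally show ?thesis .
qed

section \<open>Local conditions at the point (1 : 0)\<close>

fun root_at :: "int \<Rightarrow> form \<Rightarrow> bool" where
  "root_at p (a, b, c, d) \<longleftrightarrow> p dvd a"

fun simple_at :: "int \<Rightarrow> form \<Rightarrow> bool" where
  "simple_at p (a, b, c, d) \<longleftrightarrow> p dvd a \<and> \<not> p dvd b"

text \<open>Triple roots and forms divisible by p are included; \<open>double_at\<close> excludes
  both.\<close>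

fun multiple_at :: "int \<Rightarrow> form \<Rightarrow> bool" where
  "multiple_at p (a, b, c, d) \<longleftrightarrow> p dvd a \<and> p dvd b"

fun double_at :: "int \<Rightarrow> form \<Rightarrow> bool" where
  "double_at p (a, b, c, d) \<longleftrightarrow> p dvd a \<and> p dvd b \<and> \<not> p dvd c"

lemma Gam0_cases:
  assumes "M \<in> Gam0 p"
  obtains \<alpha> \<beta> \<gamma> \<delta> where "M = (\<alpha>, p * \<beta>, \<gamma>, \<delta>)" "\<bar>\<alpha> * \<delta> - p * \<beta> * \<gamma>\<bar> = 1"
  using assms by (cases M) (auto simp: Gam0_def mem_GL2 elim!: dvdE)

lemma Gam0_stable_root: "Gam0_stable p (root_at p)"
  unfolding Gam0_stable_def
proof (intro ballI allI impI)
  fix M f assume M: "M \<in> Gam0 p" and f: "root_at p f"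
  obtain a b c d where fd: "f = (a, b, c, d)" by (cases f)
  from M obtain \<alpha> \<beta> \<gamma> \<delta> where "M = (\<alpha>, p * \<beta>, \<gamma>, \<delta>)" by (rule Gam0_cases)
  then show "root_at p (mact M f)" using f
    by (auto simp: fd mact_def power2_eq_square power3_eq_cube intro!: dvd_mult dvd_add)
qed


lemma Gam0_inv: "M \<in> Gam0 p \<Longrightarrow> \<exists>N \<in> Gam0 p. mact N (mact M f) = f"
  using subgroup.m_inv_closed[OF subgroup_Gam0] forms.act_inv subgroup.mem_carrier[OF subgroup_Gam0]
  by metis

text \<open>A move in a group can be undone, so the negation of a stable condition is stable. In
  this way \<open>simple_at\<close> and \<open>double_at\<close> reduce to pure divisibility
  conditions.\<close>

lemma Gam0_stable_diff:
  assumes "Gam0_stable p P" "Gam0_stable p Q"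
  shows "Gam0_stable p (\<lambda>f. P f \<and> \<not> Q f)"
  using assms Gam0_inv unfolding Gam0_stable_def by metis

lemma Gam0_stable_multiple: "Gam0_stable p (multiple_at p)"
  unfolding Gam0_stable_def
proof (intro ballI allI impI)
  fix M f assume M: "M \<in> Gam0 p" and f: "multiple_at p f"
  obtain a b c d where fd: "f = (a, b, c, d)" by (cases f)
  from M obtain \<alpha> \<beta> \<gamma> \<delta> where "M = (\<alpha>, p * \<beta>, \<gamma>, \<delta>)" by (rule Gam0_cases)
  then show "multiple_at p (mact M f)" using f
    by (auto simp: fd mact_def power2_eq_square power3_eq_cube intro!: dvd_mult dvd_add)
qed

fun triple_at :: "int \<Rightarrow> form \<Rightarrow> bool" where
  "triple_at p (a, b, c, d) \<longleftrightarrow> p dvd a \<and> p dvd b \<and> p dvd c"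

lemma Gam0_stable_triple: "Gam0_stable p (triple_at p)"
  unfolding Gam0_stable_def
proof (intro ballI allI impI)
  fix M f assume M: "M \<in> Gam0 p" and f: "triple_at p f"
  obtain a b c d where fd: "f = (a, b, c, d)" by (cases f)
  from M obtain \<alpha> \<beta> \<gamma> \<delta> where "M = (\<alpha>, p * \<beta>, \<gamma>, \<delta>)" by (rule Gam0_cases)
  then show "triple_at p (mact M f)" using f
    by (auto simp: fd mact_def power2_eq_square power3_eq_cube intro!: dvd_mult dvd_add)
qed

lemma Gam0_stable_simple: "Gam0_stable p (simple_at p)"
proof -
  have "simple_at p = (\<lambda>f. root_at p f \<and> \<not> multiple_at p f)" by (rule ext) auto
  then show ?thesis using Gam0_stable_diff[OF Gam0_stable_root Gam0_stable_multiple] by simp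
qed

lemma Gam0_stable_double: "Gam0_stable p (double_at p)"
proof -
  have "double_at p = (\<lambda>f. multiple_at p f \<and> \<not> triple_at p f)" by (rule ext) auto
  then show ?thesis using Gam0_stable_diff[OF Gam0_stable_multiple Gam0_stable_triple] by simp
qed

text \<open>For \<open>m = 1\<close> this says that the ring of the form has an overring of index \<open>p\<close> in the
  direction \<open>(1 : 0)\<close>; \<open>m = p = 3\<close> asks in addition that both rings be \<open>\<int>\<close>-mat.\<close>

fun over_cond :: "int \<Rightarrow> int \<Rightarrow> form \<Rightarrow> bool" where
  "over_cond p m (a, b, c, d) \<longleftrightarrow> p ^ 2 dvd a \<and> p * m dvd b \<and> m dvd c"

lemma Gam0_stable_over:
  assumes m: "m dvd 3" shows "Gam0_stable p (over_cond p m)"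
  unfolding Gam0_stable_def
proof (intro ballI allI impI)
  fix M f assume M: "M \<in> Gam0 p" and f: "over_cond p m f"
  obtain a b c d where fd: "f = (a, b, c, d)" by (cases f)
  \<comment> \<open>The coefficients 3 of the substituted form are rewritten as
    \<open>m * n\<close>; they supply the factor m in the terms with d, where divisibility of a, b,
    c is of no help.\<close>
  from m obtain n where n: "3 = m * n" by (rule dvdE)
  from f obtain a' b' c' where abc: "a = p ^ 2 * a'" "b = p * m * b'" "c = m * c'"
    by (auto simp: fd elim!: dvdE)
  from M obtain \<alpha> \<beta> \<gamma> \<delta> where Md: "M = (\<alpha>, p * \<beta>, \<gamma>, \<delta>)" by (rule Gam0_cases)
  have 1: "a * \<alpha> ^ 3 + b * \<alpha> ^ 2 * (p * \<beta>) + c * \<alpha> * (p * \<beta>) ^ 2 + d * (p * \<beta>) ^ 3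
     = p ^ 2 * (a' * \<alpha> ^ 3 + m * b' * \<alpha> ^ 2 * \<beta> + c * \<alpha> * \<beta> ^ 2 + d * p * \<beta> ^ 3)"
    by (simp add: abc algebra_simps power2_eq_square power3_eq_cube)
  have 2: "m * n * a * \<alpha> ^ 2 * \<gamma> + b * (\<alpha> ^ 2 * \<delta> + 2 * \<alpha> * (p * \<beta>) * \<gamma>)
      + c * (2 * \<alpha> * (p * \<beta>) * \<delta> + (p * \<beta>) ^ 2 * \<gamma>) + m * n * d * (p * \<beta>) ^ 2 * \<delta>
     = p * m * (n * p * a' * \<alpha> ^ 2 * \<gamma> + b' * (\<alpha> ^ 2 * \<delta> + 2 * \<alpha> * (p * \<beta>) * \<gamma>)
      + c' * (2 * \<alpha> * \<beta> * \<delta> + p * \<beta> ^ 2 * \<gamma>) + n * d * p * \<beta> ^ 2 * \<delta>)"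
    by (simp add: abc algebra_simps power2_eq_square power3_eq_cube)
  have 3: "m * n * a * \<alpha> * \<gamma> ^ 2 + b * (\<gamma> ^ 2 * (p * \<beta>) + 2 * \<alpha> * \<gamma> * \<delta>)
      + c * (\<alpha> * \<delta> ^ 2 + 2 * (p * \<beta>) * \<gamma> * \<delta>) + m * n * d * (p * \<beta>) * \<delta> ^ 2
     = m * (n * a * \<alpha> * \<gamma> ^ 2 + p * b' * (\<gamma> ^ 2 * (p * \<beta>) + 2 * \<alpha> * \<gamma> * \<delta>)
      + c' * (\<alpha> * \<delta> ^ 2 + 2 * (p * \<beta>) * \<gamma> * \<delta>) + n * d * (p * \<beta>) * \<delta> ^ 2)"
    by (simp add: abc algebra_simps power2_eq_square power3_eq_cube)
  show "over_cond p m (mact M f)"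
    unfolding fd Md mact_def subst_form.simps scale.simps over_cond.simps n 1 2 3
    by (intro conjI dvd_mult dvd_triv_left)
qed

text \<open>\<open>phi p f (x, y) = f (y, p x) / p\<close>: passing to the subring of index \<open>p\<close> belonging to the root
  \<open>(1 : 0)\<close>, followed by a swap of the variables so that source and target are acted on by the
  same group.\<close>

fun phi :: "int \<Rightarrow> form \<Rightarrow> form" where
  "phi p (a, b, c, d) = (p ^ 2 * d, p * c, b, a div p)"

fun psi :: "int \<Rightarrow> form \<Rightarrow> form" where
  "psi p (a, b, c, d) = (p * d, c, b div p, a div p ^ 2)"

text \<open>Conjugation by the Atkin-Lehner matrix (0, p, 1, 0), an involution of
  \<open>Gam0 p\<close>. The map \<open>phi\<close> is the substitution by this same matrix, divided
  by p.\<close>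

fun sig :: "int \<Rightarrow> mat2 \<Rightarrow> mat2" where
  "sig p (\<alpha>, \<beta>, \<gamma>, \<delta>) = (\<delta>, p * \<gamma>, \<beta> div p, \<alpha>)"

lemma sig_bij: "p > 0 \<Longrightarrow> bij_betw (sig p) (Gam0 p) (Gam0 p)"
  by (rule bij_betw_byWitness[where f' = "sig p"])
    (auto simp: Gam0_def mem_GL2 algebra_simps elim!: dvdE)

lemma phi_mact:
  assumes p: "p > 0" and M: "M \<in> Gam0 p" and f: "root_at p f"
  shows "phi p (mact M f) = mact (sig p M) (phi p f)"
proof -
  have val: "p * form_val (phi p f) x y = form_val f y (p * x)" if "root_at p f" for f x y
    using that by (cases f) (auto simp: algebra_simps power2_eq_square power3_eq_cube elim!: dvdE)
  have r: "root_at p (mact M f)" using Gam0_stable_root M f unfolding Gam0_stable_def by blast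
  from M obtain \<alpha> \<beta> \<gamma> \<delta> where Md: "M = (\<alpha>, p * \<beta>, \<gamma>, \<delta>)" by (rule Gam0_cases)
  have sig: "sig p M = (\<delta>, p * \<gamma>, \<beta>, \<alpha>)" using p by (simp add: Md)
  show ?thesis
  proof (rule form_eqI)
    fix x y
    have "p * form_val (phi p (mact M f)) x y = (\<alpha> * \<delta> - p * \<beta> * \<gamma>) * form_val f (y * \<alpha> + p * x * \<gamma>) (y * (p * \<beta>) + p * x * \<delta>)"
      unfolding val[OF r] unfolding Md form_val_mact by (simp add: mult.assoc)
    also have "\<dots> = (\<delta> * \<alpha> - p * \<gamma> * \<beta>) * form_val f (x * (p * \<gamma>) + y * \<alpha>) (p * (x * \<delta> + y * \<beta>))"
      by (simp add: algebra_simps)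
    also have "\<dots> = p * form_val (mact (sig p M) (phi p f)) x y"
      unfolding val[OF f, symmetric] sig form_val_mact by (simp add: mult.assoc)
    finally show "form_val (phi p (mact M f)) x y = form_val (mact (sig p M) (phi p f)) x y"
      using p by simp
  qed
qed

lemma form_disc_phi: "p > 0 \<Longrightarrow> root_at p f \<Longrightarrow> form_disc (phi p f) = p ^ 2 * form_disc f"
  by (cases f) (auto simp: algebra_simps power2_eq_square power3_eq_cube elim!: dvdE)

lemma phi_psi: "p > 0 \<Longrightarrow> over_cond p 1 f \<Longrightarrow> phi p (psi p f) = f \<and> root_at p (psi p f)"
  by (cases f) (auto elim!: dvdE)

lemma psi_phi: "p > 0 \<Longrightarrow> root_at p f \<Longrightarrow> psi p (phi p f) = f"
  by (cases f) (auto elim!: dvdE)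

lemma mass_phi:
  assumes p: "p > 0" and X: "forms.invariant (Gam0 p) X" and r: "\<And>f. f \<in> X \<Longrightarrow> root_at p f"
    and o: "\<And>f. f \<in> Y \<Longrightarrow> over_cond p 1 f"
    and XY: "\<And>f. f \<in> X \<Longrightarrow> phi p f \<in> Y" and YX: "\<And>f. f \<in> Y \<Longrightarrow> psi p f \<in> X"
  shows "forms.mass (Gam0 p) X = forms.mass (Gam0 p) Y"
proof (rule forms.mass_transport[OF subgroup_Gam0 X sig_bij[OF p]])
  show "bij_betw (phi p) X Y"
    by (rule bij_betw_byWitness[where f' = "psi p"]) (use assms phi_psi psi_phi in auto)
qed (use phi_mact p r in auto)


section \<open>Roots of a form that is y^2 (c x + d y) modulo p\<close>

lemma mact_shift: "mact (1, j, 0, 1) (a, b, c, d) =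
    (a + b * j + c * j ^ 2 + d * j ^ 3, b + 2 * c * j + 3 * d * j ^ 2, c + 3 * d * j, d)"
  by (simp add: mact_def algebra_simps)

lemma mact_swap: "mact (0, 1, 1, 0) (a, b, c, d) = (- d, - c, - b, - a)"
  by (simp add: mact_def)

lemma transv_cases:
  assumes "t \<in> transv p"
  obtains "t = (0, 1, 1, 0)" | j where "t = (1, j, 0, 1)" "0 \<le> j" "j < p"
  using assms by (auto simp: transv_def)

lemma not_dvd_residue: "0 \<le> j \<Longrightarrow> j < p \<Longrightarrow> p dvd j \<Longrightarrow> j = (0::int)"
  using zdvd_imp_le[of p j] by linarith

text \<open>Modulo p the left side is y^2 (c x + d y) at the point (1 : j).\<close>

lemma root_shift_iff:
  assumes p: "prime p" and ab: "p dvd a" "p dvd b"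
  shows "p dvd a + b * j + c * j ^ 2 + d * j ^ 3 \<longleftrightarrow> p dvd j \<or> p dvd c + d * (j::int)"
proof -
  have eq: "a + b * j + c * j ^ 2 + d * j ^ 3 = (a + b * j) + j * (j * (c + d * j))"
    by (simp add: algebra_simps power2_eq_square power3_eq_cube)
  have "p dvd a + b * j" using ab by simp
  then show ?thesis unfolding eq using p by (simp add: dvd_add_right_iff prime_dvd_mult_iff)
qed

lemma multiple_transv:
  assumes p: "prime p" and ab: "p dvd a" "p dvd b" and cd: "\<not> (p dvd c \<and> p dvd d)"
  shows "{t \<in> transv p. multiple_at p (mact t (a, b, c, d))} = {(1, 0, 0, 1)}"
proof (intro equalityI subsetI)
  fix t assume "t \<in> {t \<in> transv p. multiple_at p (mact t (a, b, c, d))}"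
  then have t: "t \<in> transv p" "multiple_at p (mact t (a, b, c, d))" by auto
  from t(1) show "t \<in> {(1, 0, 0, 1)}"
  proof (cases rule: transv_cases)
    case 1
    then show ?thesis using t cd by (simp add: mact_swap)
  next
    case (2 j)
    have "p dvd j"
    proof (rule ccontr)
      assume j: "\<not> p dvd j"
      have 1: "p dvd c + d * j" and 2: "p dvd b + 2 * c * j + 3 * d * j ^ 2"
        using t 2 root_shift_iff[OF p ab] j by (auto simp: mact_shift)
      \<comment> \<open>At a zero of the cofactor c x + d y the derivative reduces to - j c, so a
        second multiple root would force p | c and then p | d.\<close>
      have "b + 2 * c * j + 3 * d * j ^ 2 = b + 3 * j * (c + d * j) - j * c"
        by (simp add: algebra_simps power2_eq_square)
      then have "p dvd b + 3 * j * (c + d * j) - j * c" using 2 by metis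
      moreover have "p dvd b + 3 * j * (c + d * j)" using 1 ab by simp
      ultimately have "p dvd j * c" using dvd_diff_right_iff by blast
      then have c: "p dvd c" using j p prime_dvd_mult_iff by blast
      then have "p dvd d * j" using 1 by (simp add: dvd_add_right_iff)
      then show False using j c cd p prime_dvd_mult_iff by blast
    qed
    then show ?thesis using 2 not_dvd_residue by simp
  qed
next
  have p0: "p > 0" using p prime_gt_0_int by auto
  fix t assume "t \<in> {(1::int, 0::int, 0::int, 1::int)}"
  then show "t \<in> {t \<in> transv p. multiple_at p (mact t (a, b, c, d))}"
    using p0 ab by (simp add: transv_def mact_shift image_iff)
qed

text \<open>A local property that implies a multiple root can hold only at the single multiple root,
  which is already the marked point.\<close>

lemma hits_subset_multiple:
  assumes p: "prime p" and ab: "p dvd a" "p dvd b" and cd: "\<not> (p dvd c \<and> p dvd d)"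
    and P: "\<And>f. P f \<Longrightarrow> multiple_at p f"
  shows "hits p P (a, b, c, d) = (if P (a, b, c, d) then 1 else 0)"
proof -
  have "{t \<in> transv p. P (mact t (a, b, c, d))}
      = {t \<in> transv p. multiple_at p (mact t (a, b, c, d))} \<inter> {t. P (mact t (a, b, c, d))}"
    using P by blast
  also have "\<dots> = (if P (a, b, c, d) then {(1, 0, 0, 1)} else {})"
    unfolding multiple_transv[OF p ab cd] by (auto simp: mact_one)
  finally show ?thesis by (simp add: hits_def)
qed

text \<open>The cofactor c x + d y has exactly one zero modulo p: (0 : 1) if p | d, and (1 : -c/d)
  otherwise. It is a simple root unless it coincides with (1 : 0), which means p | c.\<close>

lemma hits_simple:
  assumes p: "prime p" and ab: "p dvd a" "p dvd b" and cd: "\<not> (p dvd c \<and> p dvd d)"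
  shows "hits p (simple_at p) (a, b, c, d) = (if p dvd c then 0 else 1)"
proof -
  let ?S = "{t \<in> transv p. simple_at p (mact t (a, b, c, d))}"
  have shift: "simple_at p (mact (1, j, 0, 1) (a, b, c, d)) \<longleftrightarrow> \<not> p dvd c \<and> p dvd c + d * j" for j
  proof
    assume "simple_at p (mact (1, j, 0, 1) (a, b, c, d))"
    then have 1: "p dvd j \<or> p dvd c + d * j" and 2: "\<not> p dvd b + 2 * c * j + 3 * d * j ^ 2"
      using root_shift_iff[OF p ab] by (auto simp: mact_shift)
    have j: "\<not> p dvd j"
    proof
      assume "p dvd j"
      then have "p dvd b + 2 * c * j + 3 * d * j ^ 2" using ab by (intro dvd_add) (auto simp: power2_eq_square)
      then show False using 2 by simp
    qed
    moreover have "\<not> p dvd c"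
    proof
      assume c: "p dvd c"
      then have "p dvd d * j" using 1 j by (simp add: dvd_add_right_iff)
      then show False using cd c j p prime_dvd_mult_iff by blast
    qed
    ultimately show "\<not> p dvd c \<and> p dvd c + d * j" using 1 by simp
  next
    assume c: "\<not> p dvd c \<and> p dvd c + d * j"
    have j: "\<not> p dvd j"
    proof
      assume "p dvd j"
      then have "p dvd c" using c by (metis dvd_add_left_iff dvd_mult)
      then show False using c by simp
    qed
    have "\<not> p dvd b + 2 * c * j + 3 * d * j ^ 2"
    proof
      assume "p dvd b + 2 * c * j + 3 * d * j ^ 2"
      moreover have "b + 2 * c * j + 3 * d * j ^ 2 = b + 3 * j * (c + d * j) - j * c"
        by (simp add: algebra_simps power2_eq_square)
      ultimately have "p dvd b + 3 * j * (c + d * j) - j * c" by metis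
      moreover have "p dvd b + 3 * j * (c + d * j)" using c ab by simp
      ultimately have "p dvd j * c" using dvd_diff_right_iff by blast
      then show False using j c p prime_dvd_mult_iff by blast
    qed
    then show "simple_at p (mact (1, j, 0, 1) (a, b, c, d))"
      using root_shift_iff[OF p ab] c by (simp add: mact_shift)
  qed
  have swap: "simple_at p (mact (0, 1, 1, 0) (a, b, c, d)) \<longleftrightarrow> p dvd d \<and> \<not> p dvd c"
    by (simp add: mact_swap)
  show ?thesis
  proof (cases "p dvd c")
    case True
    have "?S = {}" using True shift swap by (auto simp: transv_def)
    then show ?thesis using True by (simp only: hits_def card.empty if_True)
  next
    case c: False
    show ?thesis
    proof (cases "p dvd d")
      case True
      have "\<not> p dvd c + d * j" for j using c True by (simp add: dvd_add_left_iff)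
      then have "?S = {(0, 1, 1, 0)}" using True c shift swap by (auto simp: transv_def)
      then show ?thesis using c by (simp add: hits_def)
    next
      case False
      have nd: "\<not> p dvd - d" using False by simp
      from ex1_residue[OF p nd, of c] obtain j0 where
        j0: "j0 \<in> {0..<p} \<and> p dvd c - - d * j0" "\<forall>j. j \<in> {0..<p} \<and> p dvd c - - d * j \<longrightarrow> j = j0"
        by (rule ex1E)
      have "?S = {(1, j0, 0, 1)}"
      proof (intro equalityI subsetI)
        fix t assume "t \<in> ?S"
        then have t: "t \<in> transv p" "simple_at p (mact t (a, b, c, d))" by auto
        from t(1) show "t \<in> {(1, j0, 0, 1)}"
          by (cases rule: transv_cases) (use t swap False shift j0(2) in auto)
      next
        fix t :: mat2 assume "t \<in> {(1, j0, 0, 1)}"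
        then show "t \<in> ?S" using j0(1) c shift[of j0] by (simp add: transv_def)
      qed
      then show ?thesis using c by (simp add: hits_def)
    qed
  qed
qed

lemma hits_content:
  assumes p: "prime p" and f: "content_dvd p f"
  shows "hits p (root_at p) f = nat p + 1" "hits p (multiple_at p) f = nat p + 1"
    "hits p (simple_at p) f = 0" "hits p (double_at p) f = 0"
proof -
  have p0: "p \<ge> 0" using p prime_gt_0_int by (simp add: less_imp_le)
  have c: "content_dvd p (mact t f)" for t by (rule content_dvd_mact[OF f])
  have *: "root_at p g" "multiple_at p g" "\<not> simple_at p g" "\<not> double_at p g" if "content_dvd p g" for g
    using that by (cases g; simp)+
  show "hits p (root_at p) f = nat p + 1" "hits p (multiple_at p) f = nat p + 1"
    "hits p (simple_at p) f = 0" "hits p (double_at p) f = 0"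
    using c * card_transv[OF p0] by (simp_all add: hits_def)
qed

lemma hits_root_split:
  "hits p (root_at p) f = hits p (simple_at p) f + hits p (multiple_at p) f"
proof -
  have "{t \<in> transv p. root_at p (mact t f)} =
    {t \<in> transv p. simple_at p (mact t f)} \<union> {t \<in> transv p. multiple_at p (mact t f)}"
    by (auto elim!: simple_at.elims multiple_at.elims root_at.elims)
  moreover have "{t \<in> transv p. simple_at p (mact t f)} \<inter> {t \<in> transv p. multiple_at p (mact t f)} = {}"
    by (auto elim!: simple_at.elims multiple_at.elims)
  ultimately show ?thesis by (simp add: hits_def card_Un_disjoint finite_transv)
qed

section \<open>Multiple roots modulo a prime\<close>


lemma two_three_prime_int: "prime (2::int)" "prime (3::int)"
  by simp_all

text \<open>A point (u : v) where the form and both partial derivatives vanish modulo p is moved to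
  (1 : 0), by the swap if p | u and by the shift with j = v/u otherwise. The form is listed besides
  its derivatives because Euler's relation expresses only three times its value, which says nothing
  for p = 3.\<close>

lemma multiple_root_witness:
  assumes p: "prime p" and uv: "\<not> (p dvd u \<and> p dvd v)"
    and f: "p dvd a * u ^ 3 + b * u ^ 2 * v + c * u * v ^ 2 + d * v ^ 3"
    and fx: "p dvd 3 * a * u ^ 2 + 2 * b * u * v + c * v ^ 2"
    and fy: "p dvd b * u ^ 2 + 2 * c * u * v + 3 * d * (v::int) ^ 2"
  shows "\<exists>g \<in> carrier GL2. multiple_at p (mact g (a, b, c, d))"
proof (cases "p dvd u")
  case True
  then have v: "\<not> p dvd v" using uv by simp
  have "p dvd a * u ^ 3 + b * u ^ 2 * v + c * u * v ^ 2" "p dvd 3 * a * u ^ 2 + 2 * b * u * v"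
    using True by (auto simp: power2_eq_square power3_eq_cube intro!: dvd_add)
  then have "p dvd d * v ^ 3" "p dvd c * v ^ 2" using f fx by (simp_all add: dvd_add_right_iff)
  then have "p dvd d" "p dvd c" using v p by (auto simp: prime_dvd_mult_iff dest: prime_dvd_power)
  then show ?thesis by (intro bexI[of _ "(0, 1, 1, 0)"]) (auto simp: mact_swap mem_GL2)
next
  case False
  from ex1_residue[OF p this, of v] obtain j where j: "p dvd v - u * j" by auto
  define w where "w = v - u * j"
  have v: "v = u * j + w" and w: "p dvd w" using j by (auto simp: w_def)
  have "a * u ^ 3 + b * u ^ 2 * v + c * u * v ^ 2 + d * v ^ 3 =
    u ^ 3 * (a + b * j + c * j ^ 2 + d * j ^ 3) +
    w * (b * u ^ 2 + c * u * (2 * u * j + w) + d * (3 * (u * j) ^ 2 + 3 * u * j * w + w ^ 2))"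
    by (simp add: v algebra_simps power2_eq_square power3_eq_cube)
  then have 1: "p dvd u ^ 3 * (a + b * j + c * j ^ 2 + d * j ^ 3)"
    using f w by (metis dvd_add_left_iff dvd_mult2)
  have "b * u ^ 2 + 2 * c * u * v + 3 * d * v ^ 2 = u ^ 2 * (b + 2 * c * j + 3 * d * j ^ 2)
      + w * (2 * c * u + 3 * d * (2 * u * j + w))"
    by (simp add: v algebra_simps power2_eq_square power3_eq_cube)
  then have 2: "p dvd u ^ 2 * (b + 2 * c * j + 3 * d * j ^ 2)"
    using fy w by (metis dvd_add_left_iff dvd_mult2)
  have "p dvd a + b * j + c * j ^ 2 + d * j ^ 3" "p dvd b + 2 * c * j + 3 * d * j ^ 2"
    using 1 2 False p by (auto simp: prime_dvd_mult_iff dest: prime_dvd_power)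
  then show ?thesis by (intro bexI[of _ "(1, j, 0, 1)"]) (auto simp: mact_shift mem_GL2)
qed

text \<open>If the Hessian does not vanish modulo \<open>p\<close>, it is a multiple of the square of the linear form
  defining the double root, which can therefore be read off its coefficients.\<close>

lemma multiple_root_odd_hess:
  assumes p: "prime p" "odd p" and D: "p dvd form_disc (a, b, c, d)"
    and PQ: "\<not> (p dvd b ^ 2 - 3 * a * c \<and> p dvd b * c - 9 * a * (d::int))"
  shows "\<exists>g \<in> carrier GL2. multiple_at p (mact g (a, b, c, d))"
proof (rule multiple_root_witness[OF p(1), of "- (b * c - 9 * a * d)" "2 * (b ^ 2 - 3 * a * c)"])
  have "\<not> p dvd 2" using p by (metis dvd_refl prime_def primes_dvd_imp_eq two_three_prime_int(1))
  then show "\<not> (p dvd - (b * c - 9 * a * d) \<and> p dvd 2 * (b ^ 2 - 3 * a * c))"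
    unfolding dvd_minus_iff prime_dvd_mult_iff[OF p(1)] using PQ by blast
  let ?u = "- (b * c - 9 * a * d)" and ?v = "2 * (b ^ 2 - 3 * a * c)"
  have "a * ?u ^ 3 + b * ?u ^ 2 * ?v + c * ?u * ?v ^ 2 + d * ?v ^ 3
      = form_disc (a, b, c, d) * - (2 * b ^ 3 - 9 * a * b * c + 27 * a ^ 2 * d)"
    by (simp add: algebra_simps power2_eq_square power3_eq_cube)
  then show "p dvd a * ?u ^ 3 + b * ?u ^ 2 * ?v + c * ?u * ?v ^ 2 + d * ?v ^ 3" using D by (metis dvd_mult2)
  have "3 * a * ?u ^ 2 + 2 * b * ?u * ?v + c * ?v ^ 2 = form_disc (a, b, c, d) * (- 9 * a)"
    by (simp add: algebra_simps power2_eq_square power3_eq_cube)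
  then show "p dvd 3 * a * ?u ^ 2 + 2 * b * ?u * ?v + c * ?v ^ 2" using D by (metis dvd_mult2)
  have "b * ?u ^ 2 + 2 * c * ?u * ?v + 3 * d * ?v ^ 2 = form_disc (a, b, c, d) * (- 3 * b)"
    by (simp add: algebra_simps power2_eq_square power3_eq_cube)
  then show "p dvd b * ?u ^ 2 + 2 * c * ?u * ?v + 3 * d * ?v ^ 2" using D by (metis dvd_mult2)
qed

text \<open>Modulo 2 the discriminant is (b c - a d)^2, and one of the three points (1 : 0), (0 :
  1), (1 : 1) is a multiple root.\<close>

lemma multiple_root_two:
  assumes D: "2 dvd form_disc (a, b, c, d)"
  shows "\<exists>g \<in> carrier GL2. multiple_at 2 (mact g (a, b, c, d))"
proof -
  have bc: "even (b * c) = even (a * d)" using D by auto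
  have "\<exists>u v. \<not> (2 dvd u \<and> 2 dvd v) \<and> 2 dvd a * u ^ 3 + b * u ^ 2 * v + c * u * v ^ 2 + d * v ^ 3
    \<and> 2 dvd 3 * a * u ^ 2 + 2 * b * u * v + c * v ^ 2 \<and> 2 dvd b * u ^ 2 + 2 * c * u * v + 3 * d * (v::int) ^ 2"
  proof (cases "even a \<and> even b")
    case True
    then show ?thesis by (intro exI[of _ 1] exI[of _ 0]) simp
  next
    case ab: False
    show ?thesis
    proof (cases "even c \<and> even d")
      case True
      then show ?thesis by (intro exI[of _ 0] exI[of _ 1]) simp
    next
      case False
      then show ?thesis using ab bc by (intro exI[of _ 1]) auto
    qed
  qed
  then show ?thesis using multiple_root_witness[of 2] by (metis two_three_prime_int(1))
qed

text \<open>For odd p a nonvanishing Hessian exhibits the double root, after a swap if only its last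
  coefficient is nonzero. A vanishing Hessian means a triple root, which has to be located
  differently in characteristic 3.\<close>

lemma ex_multiple_root:
  assumes p: "prime (p::int)" and D: "p dvd form_disc f" and nc: "\<not> content_dvd p f"
  shows "\<exists>g \<in> carrier GL2. multiple_at p (mact g f)"
proof -
  obtain a b c d where f: "f = (a, b, c, d)" by (cases f)
  let ?P = "b ^ 2 - 3 * a * c" and ?Q = "b * c - 9 * a * d" and ?R = "c ^ 2 - 3 * b * d"
  consider "p = 2" | "odd p" "\<not> (p dvd ?P \<and> p dvd ?Q)" | "odd p" "p dvd ?P" "p dvd ?Q" "\<not> p dvd ?R"
    | "p dvd a" "p dvd b"
    | "p = 3" "p dvd ?P" "p dvd ?Q" "p dvd ?R"
    | "odd p" "p \<noteq> 3" "p dvd ?P" "p dvd ?Q" "\<not> (p dvd a \<and> p dvd b)"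
    using p primes_dvd_imp_eq two_three_prime_int(1) by metis
  then show ?thesis
  proof cases
    case 1
    then show ?thesis using multiple_root_two D by (simp add: f)
  next
    case 2
    then show ?thesis using multiple_root_odd_hess p D by (simp add: f)
  next
    case 3
    have sw: "(0, 1, 1, 0) \<in> carrier GL2" by (simp add: mem_GL2)
    have "p dvd form_disc (mact (0, 1, 1, 0) f)" using D form_disc_mact[OF sw] by simp
    then have "\<exists>g \<in> carrier GL2. multiple_at p (mact g (- d, - c, - b, - a))"
      unfolding f mact_swap
      by (intro multiple_root_odd_hess p) (use 3 in \<open>auto simp: algebra_simps\<close>)
    then obtain g where "g \<in> carrier GL2" "multiple_at p (mact g (mact (0, 1, 1, 0) f))"
      by (auto simp: f mact_swap)
    then show ?thesis using sw forms.act_mult[of g "(0, 1, 1, 0)" f] forms.m_closed by metis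
  next
    case 4
    then show ?thesis by (intro bexI[of _ "(1, 0, 0, 1)"]) (auto simp: f mact_one mem_GL2)
  next
    case 5
    have b: "3 dvd b" and c: "3 dvd c"
    proof -
      have "3 dvd ?P + 3 * (a * c)" "3 dvd ?R + 3 * (b * d)" using 5 by (metis dvd_add dvd_triv_left)+
      then have "3 dvd b ^ 2" "3 dvd c ^ 2" by (simp_all add: mult.assoc)
      then show "3 dvd b" "3 dvd c" using p 5 prime_dvd_power by metis+
    qed
    \<comment> \<open>With b and c divisible by 3, Fermat gives a x^3 + d y^3 = (a x + d y)^3 modulo
      3, so the triple root is (-d : a).\<close>
    have cube: "3 dvd x ^ 3 - x" for x :: int
    proof -
      have "x mod 3 = 0 \<or> x mod 3 = 1 \<or> x mod 3 = 2" by presburger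
      then have "(x ^ 3 - x) mod 3 = 0"
        by (elim disjE; subst mod_diff_eq[symmetric], subst power_mod[symmetric], simp)
      then show ?thesis by presburger
    qed
    show ?thesis unfolding f
    proof (rule multiple_root_witness[OF p, of "- d" a])
      show "\<not> (p dvd - d \<and> p dvd a)" using nc 5 b c by (auto simp: f)
      have "a * (- d) ^ 3 + d * a ^ 3 = d * (a ^ 3 - a) - a * (d ^ 3 - d)"
        by (simp add: algebra_simps power3_eq_cube)
      then have "3 dvd a * (- d) ^ 3 + d * a ^ 3" using cube by simp
      moreover have "3 dvd b * (- d) ^ 2 * a + c * (- d) * a ^ 2" using b c by simp
      ultimately have "3 dvd (a * (- d) ^ 3 + d * a ^ 3) + (b * (- d) ^ 2 * a + c * (- d) * a ^ 2)"
        by (rule dvd_add)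
      then show "p dvd a * (- d) ^ 3 + b * (- d) ^ 2 * a + c * (- d) * a ^ 2 + d * a ^ 3"
        using 5 by (simp add: algebra_simps)
      show "p dvd 3 * a * (- d) ^ 2 + 2 * b * (- d) * a + c * a ^ 2"
        "p dvd b * (- d) ^ 2 + 2 * c * (- d) * a + 3 * d * a ^ 2"
        using 5 b c by (auto intro!: dvd_add dvd_diff)
    qed
  next
    case 6
    have n3: "\<not> p dvd 3" using 6 p by (metis primes_dvd_imp_eq two_three_prime_int(2))
    have na: "\<not> p dvd a"
    proof
      assume a: "p dvd a"
      then have "p dvd ?P + 3 * a * c" using 6 by (intro dvd_add) auto
      then have "p dvd b ^ 2" by simp
      then show False using a 6 p prime_dvd_power by blast
    qed
    \<comment> \<open>Since the first two Hessian coefficients vanish modulo p, 27 a^2 f is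
      congruent to (3 a x + b y)^3, whose root is (-b : 3 a).\<close>
    show ?thesis unfolding f
    proof (rule multiple_root_witness[OF p, of "- b" "3 * a"])
      show "\<not> (p dvd - b \<and> p dvd 3 * a)" using na n3 p prime_dvd_mult_iff by blast
      have "a * (- b) ^ 3 + b * (- b) ^ 2 * (3 * a) + c * (- b) * (3 * a) ^ 2 + d * (3 * a) ^ 3
         = a * (2 * b * ?P - 3 * a * ?Q)"
        by (simp add: algebra_simps power2_eq_square power3_eq_cube)
      then show "p dvd a * (- b) ^ 3 + b * (- b) ^ 2 * (3 * a) + c * (- b) * (3 * a) ^ 2 + d * (3 * a) ^ 3"
        using 6 by (metis dvd_diff dvd_mult)
      have "3 * a * (- b) ^ 2 + 2 * b * (- b) * (3 * a) + c * (3 * a) ^ 2 = (- 3 * a) * ?P"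
        by (simp add: algebra_simps power2_eq_square)
      then show "p dvd 3 * a * (- b) ^ 2 + 2 * b * (- b) * (3 * a) + c * (3 * a) ^ 2" using 6 by (metis dvd_mult)
      have "b * (- b) ^ 2 + 2 * c * (- b) * (3 * a) + 3 * d * (3 * a) ^ 2 = b * ?P - 3 * a * ?Q"
        by (simp add: algebra_simps power2_eq_square)
      then show "p dvd b * (- b) ^ 2 + 2 * c * (- b) * (3 * a) + 3 * d * (3 * a) ^ 2"
        using 6 by (metis dvd_diff dvd_mult)
    qed
  qed
qed

text \<open>With the multiple root moved to (1 : 0), the remaining root is simple exactly if the
  multiple one is not triple. This turns the count of simple roots into one of double roots; a form
  divisible by p has neither.\<close>

lemma hits_disc:
  assumes p: "prime p" and D: "p dvd form_disc f"
  shows "hits p (simple_at p) f = hits p (double_at p) f"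
    and "\<not> content_dvd p f \<Longrightarrow> hits p (multiple_at p) f = 1"
proof -
  have *: "hits p (simple_at p) f = hits p (double_at p) f \<and> hits p (multiple_at p) f = 1"
    if nc: "\<not> content_dvd p f"
  proof -
    obtain g where g: "g \<in> carrier GL2" "multiple_at p (mact g f)" using ex_multiple_root[OF p D nc] by auto
    obtain a b c d where f': "mact g f = (a, b, c, d)" by (cases "mact g f")
    have "\<not> content_dvd p (mact g f)" using nc content_dvd_mact forms.act_inv[OF g(1)] by metis
    then have ab: "p dvd a" "p dvd b" and cd: "\<not> (p dvd c \<and> p dvd d)" using g(2) by (auto simp: f')
    have s: "hits p (simple_at p) (mact g f) = (if p dvd c then 0 else 1)"
      unfolding f' by (rule hits_simple[OF p ab cd])
    have d: "hits p (double_at p) (mact g f) = (if p dvd c then 0 else 1)"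
      unfolding f' by (subst hits_subset_multiple[OF p ab cd]) (use ab in \<open>auto elim!: double_at.elims\<close>)
    have m: "hits p (multiple_at p) (mact g f) = 1"
      unfolding f' by (subst hits_subset_multiple[OF p ab cd]) (use ab in auto)
    show ?thesis
      using s d m hits_mact[OF p Gam0_stable_simple g(1)] hits_mact[OF p Gam0_stable_double g(1)]
        hits_mact[OF p Gam0_stable_multiple g(1)] by simp
  qed
  then show "\<not> content_dvd p f \<Longrightarrow> hits p (multiple_at p) f = 1" by simp
  show "hits p (simple_at p) f = hits p (double_at p) f"
    using * hits_content[OF p] by (cases "content_dvd p f") auto
qed


section \<open>Multiple roots that give an overring\<close>

lemma three_dvd_aux:
  fixes e x y :: int
  shows "e = 3 * (3 * x - 4 * y) \<Longrightarrow> 81 dvd e \<Longrightarrow> 3 dvd y"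
    "e = 9 * (3 * x - 4 * y) \<Longrightarrow> 81 dvd e \<Longrightarrow> 3 dvd y"
    "e = 27 * (3 * x - y) \<Longrightarrow> 81 dvd e \<Longrightarrow> 3 dvd y"
    "e = 3 * x + 4 * y \<Longrightarrow> 27 dvd e \<Longrightarrow> 3 dvd y"
    "e = 3 * (3 * x + 4 * y) \<Longrightarrow> 27 dvd e \<Longrightarrow> 3 dvd y"
    "e = 9 * (3 * x + y) \<Longrightarrow> 27 dvd e \<Longrightarrow> 3 dvd y"
proof -
  show "3 dvd y" if e: "e = 3 * (3 * x - 4 * y)" and z: "81 dvd e"
  proof -
    obtain k where "e = 81 * k" using z by (rule dvdE)
    then have "y = 3 * (x - 9 * k - y)" using e by presburger
    then show ?thesis by (rule dvdI)
  qed
  show "3 dvd y" if e: "e = 9 * (3 * x - 4 * y)" and z: "81 dvd e"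
  proof -
    obtain k where "e = 81 * k" using z by (rule dvdE)
    then have "y = 3 * (x - 3 * k - y)" using e by presburger
    then show ?thesis by (rule dvdI)
  qed
  show "3 dvd y" if e: "e = 27 * (3 * x - y)" and z: "81 dvd e"
  proof -
    obtain k where "e = 81 * k" using z by (rule dvdE)
    then have "y = 3 * (x - k)" using e by presburger
    then show ?thesis by (rule dvdI)
  qed
  show "3 dvd y" if e: "e = 3 * x + 4 * y" and z: "27 dvd e"
  proof -
    obtain k where "e = 27 * k" using z by (rule dvdE)
    then have "y = 3 * (9 * k - x - y)" using e by presburger
    then show ?thesis by (rule dvdI)
  qed
  show "3 dvd y" if e: "e = 3 * (3 * x + 4 * y)" and z: "27 dvd e"
  proof -
    obtain k where "e = 27 * k" using z by (rule dvdE)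
    then have "y = 3 * (3 * k - x - y)" using e by presburger
    then show ?thesis by (rule dvdI)
  qed
  show "3 dvd y" if e: "e = 9 * (3 * x + y)" and z: "27 dvd e"
  proof -
    obtain k where "e = 27 * k" using z by (rule dvdE)
    then have "y = 3 * (k - x)" using e by presburger
    then show ?thesis by (rule dvdI)
  qed
qed

lemma dvd_subtrahend: "(e::int) = k * x - y \<Longrightarrow> k dvd e \<Longrightarrow> k dvd y"
  by (metis dvd_diff_right_iff dvd_triv_left)

text \<open>With p | a and p | b the discriminant is - 4 a c^3 modulo p^2, so p^2 | a for odd p. For
  p = 2 the factor 4 hides this information, and 16 is required instead.\<close>

lemma double_over:
  assumes p: "prime p" and f: "double_at p f" and D: "p ^ 2 dvd form_disc f"
    and D2: "p = 2 \<Longrightarrow> 16 dvd form_disc f"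
  shows "over_cond p 1 f"
proof -
  obtain a b c d where fd: "f = (a, b, c, d)" by (cases f)
  from f obtain a' b' where ab: "a = p * a'" "b = p * b'" and c: "\<not> p dvd c" by (auto simp: fd elim!: dvdE)
  have p0: "p \<noteq> 0" using p by auto
  have "p dvd a'"
  proof (cases "p = 2")
    case True
    \<comment> \<open>If a' c is odd, A is a square minus twice an odd number, hence 2 or 3 modulo
      4.\<close>
    define A where "A = (b' * c + a' * d) ^ 2 - 2 * (a' * c ^ 3)"
    define B where "B = 4 * a' * b' * c * d - 7 * a' ^ 2 * d ^ 2 - 2 * b' ^ 3 * d"
    have "form_disc f = 4 * (A + 4 * B)"
      by (simp add: fd ab True A_def B_def algebra_simps power2_eq_square power3_eq_cube)
    then have "4 dvd A + 4 * B" using D2[OF True] by presburger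
    then have A: "4 dvd A" by presburger
    show ?thesis
    proof (rule ccontr)
      assume "\<not> p dvd a'"
      then have "odd (a' * c ^ 3)" using c True by simp
      then obtain m where m: "a' * c ^ 3 = 2 * m + 1" by (rule oddE)
      show False
      proof (cases "even (b' * c + a' * d)")
        case True
        then obtain n where "b' * c + a' * d = 2 * n" by (rule evenE)
        then have "A = 4 * (n ^ 2 - m) - 2" by (simp add: A_def m power2_eq_square)
        then show False using A by presburger
      next
        case False
        then obtain n where "b' * c + a' * d = 2 * n + 1" by (rule oddE)
        then have "A = 4 * (n ^ 2 + n - m) - 1" by (simp add: A_def m power2_eq_square algebra_simps)
        then show False using A by presburger
      qed
    qed
  next
    case False
    have n2: "\<not> p dvd 2" using False p by (metis primes_dvd_imp_eq two_three_prime_int(1))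
    have n4: "\<not> p dvd 4" using n2 p prime_dvd_mult_iff[of p 2 2] by simp
    have eq: "form_disc f = p ^ 2 * (b' ^ 2 * c ^ 2 - 4 * p * b' ^ 3 * d - 27 * a' ^ 2 * d ^ 2 + 18 * a' * b' * c * d)
        - p * (4 * (a' * c ^ 3))"
      by (simp add: fd ab algebra_simps power2_eq_square power3_eq_cube)
    have "p ^ 2 dvd p * (4 * (a' * c ^ 3))" by (rule dvd_subtrahend[OF eq D])
    then have "p dvd 4 * (a' * c ^ 3)" using p0 by (simp add: power2_eq_square)
    then show ?thesis using n4 c p by (auto simp: prime_dvd_mult_iff dest: prime_dvd_power)
  qed
  then show ?thesis using ab by (auto simp: fd power2_eq_square)
qed

lemma three_dvd_power: "3 dvd (x::int) ^ n \<Longrightarrow> 3 dvd x"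
  using prime_dvd_power two_three_prime_int(2) by blast

text \<open>A double root is covered by \<open>double_over\<close>. Otherwise p divides a, b, c but
  not d, and disc / p^2 is - 27 a'^2 d^2 modulo p, which settles p \<noteq> 3. For p = 3 the
  coefficient 27 is in the way: supposing that 3 does not divide a', a factor 3 is removed from b'
  and then from c', until the quotient is 27 (3 x - a'^2 d^2). This uses up the whole remaining
  3^4.\<close>

lemma multiple_over:
  assumes p: "prime p" and f: "multiple_at p f" and nc: "\<not> content_dvd p f"
    and D: "p ^ 6 dvd form_disc f"
  shows "over_cond p 1 f"
proof (cases "double_at p f")
  case True
  have "p ^ 2 dvd p ^ 6" by (rule le_imp_power_dvd) simp
  then have "p ^ 2 dvd form_disc f" using D by (rule dvd_trans)
  moreover have "p = 2 \<Longrightarrow> 16 dvd form_disc f" using D dvd_trans[of 16 "2 ^ 6" "form_disc f"] by simp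
  ultimately show ?thesis using double_over[OF p True] by blast
next
  case False
  obtain a b c d where fd: "f = (a, b, c, d)" by (cases f)
  from f False obtain a' b' c' where abc: "a = p * a'" "b = p * b'" "c = p * c'"
    by (auto simp: fd elim!: dvdE)
  have d: "\<not> p dvd d" using nc by (auto simp: fd abc)
  have p0: "p \<noteq> 0" using p by auto
  have disc: "form_disc f = p ^ 2 * (p ^ 2 * (b' ^ 2 * c' ^ 2 - 4 * a' * c' ^ 3)
      - 4 * p * b' ^ 3 * d - 27 * a' ^ 2 * d ^ 2 + 18 * p * a' * b' * c' * d)"
    (is "_ = p ^ 2 * ?E")
    by (simp add: fd abc algebra_simps power2_eq_square power3_eq_cube)
  have "p ^ 2 * p ^ 4 dvd p ^ 2 * ?E" using D disc by (simp add: power_add[symmetric])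
  have p2: "p ^ 2 \<noteq> 0" using p0 by simp
  have E: "p ^ 4 dvd ?E" by (rule dvd_times_left_cancel_iff[OF p2, THEN iffD1]) fact
  have "p dvd a'"
  proof (cases "p = 3")
    case False
    have "\<not> p dvd 3" using False p by (metis primes_dvd_imp_eq two_three_prime_int(2))
    then have n27: "\<not> p dvd 27" using p prime_dvd_power[of p 3 3] by auto
    have eq: "?E = p * (p * (b' ^ 2 * c' ^ 2 - 4 * a' * c' ^ 3) - 4 * b' ^ 3 * d + 18 * a' * b' * c' * d)
       - 27 * (a' ^ 2 * d ^ 2)"
      by (simp add: algebra_simps power2_eq_square)
    have "p dvd p ^ 4" by (rule dvd_power) simp
    then have "p dvd ?E" using E by (rule dvd_trans)
    then have "p dvd 27 * (a' ^ 2 * d ^ 2)" by (rule dvd_subtrahend[OF eq])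
    then show ?thesis using n27 d p by (auto simp: prime_dvd_mult_iff dest: prime_dvd_power)
  next
    case True
    have E3: "81 dvd ?E" using E True by simp
    have "?E = 3 * (3 * (b' ^ 2 * c' ^ 2 - 4 * a' * c' ^ 3 - 3 * a' ^ 2 * d ^ 2 + 6 * a' * b' * c' * d) - 4 * (b' ^ 3 * d))"
      by (simp add: True algebra_simps)
    then have "3 dvd b' ^ 3 * d" by (rule three_dvd_aux(1)[OF _ E3])
    then have "3 dvd b'" using d True by (auto simp: prime_dvd_mult_iff dest!: three_dvd_power)
    then obtain b'' where b: "b' = 3 * b''" by (rule dvdE)
    have "?E = 9 * (3 * (3 * (b'' ^ 2 * c' ^ 2) - 12 * b'' ^ 3 * d - a' ^ 2 * d ^ 2 + 6 * a' * b'' * c' * d) - 4 * (a' * c' ^ 3))"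
      by (simp add: True b algebra_simps power2_eq_square power3_eq_cube)
    then have ac: "3 dvd a' * c' ^ 3" by (rule three_dvd_aux(2)[OF _ E3])
    show ?thesis
    proof (rule ccontr)
      assume na: "\<not> p dvd a'"
      then have "3 dvd c'" using ac True by (auto simp: prime_dvd_mult_iff dest!: three_dvd_power)
      then obtain c'' where c: "c' = 3 * c''" by (rule dvdE)
      have "?E = 27 * (3 * (9 * (b'' ^ 2 * c'' ^ 2) - 4 * b'' ^ 3 * d + 6 * a' * b'' * c'' * d - 12 * a' * c'' ^ 3)
          - a' ^ 2 * d ^ 2)"
        by (simp add: True b c algebra_simps power2_eq_square power3_eq_cube)
      then have "3 dvd a' ^ 2 * d ^ 2" by (rule three_dvd_aux(3)[OF _ E3])
      then show False using na d True by (auto simp: prime_dvd_mult_iff dest!: three_dvd_power)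
    qed
  qed
  then show ?thesis using abc by (auto simp: fd power2_eq_square)
qed

text \<open>The discriminant of a Z-mat form contains 27, so 3^6 leaves another 27 for the same
  successive removal of factors 3. The factor found in \<open>b\<close> on the way belongs to the
  claim, since \<open>over_cond 3 3\<close> asks for 9 | B.\<close>

lemma multiple_over_zmat:
  assumes f: "multiple_at 3 f" and z: "zmat_form f" and nc: "\<not> content_dvd 3 f" and D: "3 ^ 6 dvd form_disc f"
  shows "over_cond 3 3 f"
proof -
  obtain a B C d where fd: "f = (a, B, C, d)" by (cases f)
  from f z obtain a' b c where abc: "a = 3 * a'" "B = 3 * b" "C = 3 * c"
    by (auto simp: fd elim!: dvdE)
  have d: "\<not> 3 dvd d" using nc by (auto simp: fd abc)
  let ?E = "9 * a' ^ 2 * d ^ 2 - 3 * (b ^ 2 * c ^ 2) + 12 * a' * c ^ 3 + 4 * (b ^ 3 * d) - 18 * a' * b * c * d"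
  have "form_disc f = 27 * - ?E"
    by (simp add: fd abc algebra_simps power2_eq_square power3_eq_cube)
  then have "3 ^ 6 dvd 27 * - ?E" using D by metis
  moreover have "27 dvd x" if z: "729 dvd 27 * - x" for x :: int
  proof -
    obtain k where "27 * - x = 729 * k" using z by (rule dvdE)
    then have "x = 27 * - k" by presburger
    then show ?thesis by (rule dvdI)
  qed
  moreover have "(3::int) ^ 6 = 729" by simp
  ultimately have E: "27 dvd ?E" by metis
  have "?E = 3 * (3 * a' ^ 2 * d ^ 2 - b ^ 2 * c ^ 2 + 4 * a' * c ^ 3 - 6 * a' * b * c * d) + 4 * (b ^ 3 * d)"
    by simp
  then have "3 dvd b ^ 3 * d" by (rule three_dvd_aux(4)[OF _ E])
  then have "3 dvd b" using d by (auto simp: prime_dvd_mult_iff dest!: three_dvd_power)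
  then obtain b' where b: "b = 3 * b'" by (rule dvdE)
  have "?E = 3 * (3 * (a' ^ 2 * d ^ 2 - 3 * (b' ^ 2 * c ^ 2) + 12 * b' ^ 3 * d - 6 * a' * b' * c * d) + 4 * (a' * c ^ 3))"
    by (simp add: b algebra_simps power2_eq_square power3_eq_cube)
  then have ac: "3 dvd a' * c ^ 3" by (rule three_dvd_aux(5)[OF _ E])
  have "3 dvd a'"
  proof (rule ccontr)
    assume na: "\<not> 3 dvd a'"
    then have "3 dvd c" using ac by (auto simp: prime_dvd_mult_iff dest!: three_dvd_power)
    then obtain c' where c: "c = 3 * c'" by (rule dvdE)
    have "?E = 9 * (3 * (12 * a' * c' ^ 3 - 9 * (b' ^ 2 * c' ^ 2) + 4 * b' ^ 3 * d - 6 * a' * b' * c' * d) + a' ^ 2 * d ^ 2)"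
      by (simp add: b c algebra_simps power2_eq_square power3_eq_cube)
    then have "3 dvd a' ^ 2 * d ^ 2" by (rule three_dvd_aux(6)[OF _ E])
    then show False using na d by (auto simp: prime_dvd_mult_iff dest!: three_dvd_power)
  qed
  then show ?thesis using abc b by (auto simp: fd)
qed

section \<open>Mass identities for forms\<close>


abbreviation form_mass :: "form set \<Rightarrow> rat" where
  "form_mass \<equiv> forms.mass (carrier GL2)"

abbreviation finite_orbits :: "form set \<Rightarrow> bool" where
  "finite_orbits X \<equiv> finite (forms.orb (carrier GL2) ` X)"

abbreviation GL2_invariant :: "form set \<Rightarrow> bool" where
  "GL2_invariant \<equiv> forms.invariant (carrier GL2)"

lemma scale_eq_iff: "k \<noteq> 0 \<Longrightarrow> scale k f = scale k g \<longleftrightarrow> f = g"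
  by (cases f; cases g) auto

lemma GL2_subgroup: "subgroup (carrier GL2) GL2"
  by (rule forms.carrier_subgroup)

lemma mass_scale:
  assumes K: "subgroup K GL2" and X: "forms.invariant K X" and p: "p \<noteq> 0"
  shows "forms.mass K (scale p ` X) = forms.mass K X"
proof (rule forms.mass_transport[OF K X, symmetric, where \<sigma> = id])
  show "bij_betw id K K" by (rule bij_betw_id)
  show "bij_betw (scale p) X (scale p ` X)" using scale_eq_iff[OF p] by (auto simp: bij_betw_def inj_on_def)
qed (simp add: mact_scale)

lemma finite_orbits_subset: "finite_orbits X \<Longrightarrow> Y \<subseteq> X \<Longrightarrow> finite_orbits Y"
  by (meson finite_subset image_mono)

lemma GL2_invariant_restrict:
  assumes "GL2_invariant X" "\<And>f g. f \<in> X \<Longrightarrow> g \<in> carrier GL2 \<Longrightarrow> P f \<Longrightarrow> P (mact g f)"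
  shows "GL2_invariant {f \<in> X. P f}"
  using assms by (simp add: forms.invariant_def)

lemma content_iff_mact: "g \<in> carrier GL2 \<Longrightarrow> content_dvd k (mact g f) \<longleftrightarrow> content_dvd k f"
  using content_dvd_mact forms.act_inv by metis

lemma wsum_indicator:
  assumes fin: "finite_orbits X" and X: "GL2_invariant X"
    and P: "\<And>f g. f \<in> X \<Longrightarrow> g \<in> carrier GL2 \<Longrightarrow> P f \<Longrightarrow> P (mact g f)"
  shows "forms.wsum X (\<lambda>f. if P f then 1 else 0) = form_mass {f \<in> X. P f}"
  using forms.wsum_restrict[OF fin X, of P "\<lambda>_. 1"] GL2_invariant_restrict[OF X, of P] P
  by (simp add: forms.wsum_one)

lemma mass_simple_eq_double:
  assumes p: "prime p" and X: "GL2_invariant X" and fin: "finite_orbits X"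
    and D: "\<And>f. f \<in> X \<Longrightarrow> p dvd form_disc f"
  shows "forms.mass (Gam0 p) {f \<in> X. simple_at p f} = forms.mass (Gam0 p) {f \<in> X. double_at p f}"
  unfolding mass_Gam0[OF p Gam0_stable_simple X fin] mass_Gam0[OF p Gam0_stable_double X fin]
  by (rule forms.wsum_cong[OF X]) (simp add: hits_disc(1)[OF p D])

lemma mass_multiple:
  assumes p: "prime p" and X: "GL2_invariant X" and fin: "finite_orbits X"
    and D: "\<And>f. f \<in> X \<Longrightarrow> p dvd form_disc f"
  shows "forms.mass (Gam0 p) {f \<in> X. multiple_at p f} =
    form_mass X + of_int p * form_mass {f \<in> X. content_dvd p f}"
proof -
  have p0: "p \<ge> 0" using p prime_gt_0_int by (simp add: less_imp_le)
  have "forms.wsum X (\<lambda>f. of_nat (hits p (multiple_at p) f)) =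
     forms.wsum X (\<lambda>f. 1 + of_int p * (if content_dvd p f then 1 else 0))"
    by (rule forms.wsum_cong[OF X])
      (use hits_disc(2)[OF p D] hits_content(2)[OF p] p0 in \<open>auto simp: of_nat_nat\<close>)
  then show ?thesis
    unfolding mass_Gam0[OF p Gam0_stable_multiple X fin] forms.wsum_add forms.wsum_mult
    by (subst (asm) wsum_indicator[OF fin X]) (auto simp: content_dvd_mact forms.wsum_one)
qed

lemma mass_root:
  assumes p: "prime p" and X: "GL2_invariant X" and fin: "finite_orbits X"
    and D: "\<And>f. f \<in> X \<Longrightarrow> p dvd form_disc f"
  shows "forms.mass (Gam0 p) {f \<in> X. root_at p f} = forms.mass (Gam0 p) {f \<in> X. simple_at p f} +
    form_mass X + of_int p * form_mass {f \<in> X. content_dvd p f}"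
proof -
  have "forms.mass (Gam0 p) {f \<in> X. root_at p f} =
      forms.mass (Gam0 p) {f \<in> X. simple_at p f} + forms.mass (Gam0 p) {f \<in> X. multiple_at p f}"
    unfolding mass_Gam0[OF p Gam0_stable_root X fin] mass_Gam0[OF p Gam0_stable_simple X fin]
      mass_Gam0[OF p Gam0_stable_multiple X fin] forms.wsum_add[symmetric]
    by (rule forms.wsum_cong[OF X]) (simp add: hits_root_split)
  then show ?thesis using mass_multiple[OF assms] by simp
qed

text \<open>The forms divisible by p stay behind as a \<open>Gam0 p\<close> mass: their overring
  points are governed by the roots of the quotient form, whose discriminant is smaller by
  p^4.\<close>

lemma mass_over:
  assumes p: "prime p" and X: "GL2_invariant X" and fin: "finite_orbits X" and m: "m dvd 3"
    and one: "\<And>f. f \<in> X \<Longrightarrow> \<not> content_dvd p f \<Longrightarrow> hits p (over_cond p m) f = 1"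
  shows "forms.mass (Gam0 p) {f \<in> X. over_cond p m f} = form_mass X - form_mass {f \<in> X. content_dvd p f}
     + forms.mass (Gam0 p) {f \<in> X. content_dvd p f \<and> over_cond p m f}"
proof -
  let ?C = "{f \<in> X. content_dvd p f}" and ?h = "\<lambda>f. rat_of_nat (hits p (over_cond p m) f)"
  have C: "GL2_invariant ?C" by (rule GL2_invariant_restrict[OF X]) (simp add: content_dvd_mact)
  have finC: "finite_orbits ?C" by (rule finite_orbits_subset[OF fin]) auto
  have "forms.wsum X ?h = forms.wsum X (\<lambda>f. (if \<not> content_dvd p f then 1 else 0) + (if content_dvd p f then ?h f else 0))"
    by (rule forms.wsum_cong[OF X]) (use one in auto)
  also have "\<dots> = form_mass {f \<in> X. \<not> content_dvd p f} + forms.wsum ?C ?h"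
    unfolding forms.wsum_add forms.wsum_restrict[OF fin X C]
    by (subst wsum_indicator[OF fin X]) (auto simp: content_iff_mact)
  finally show ?thesis
    unfolding mass_Gam0[OF p Gam0_stable_over[OF m] X fin]
    using forms.mass_split[OF fin X C] mass_Gam0[OF p Gam0_stable_over[OF m] C finC]
    by (simp add: conj_assoc)
qed

lemma over_multiple: "over_cond p m f \<Longrightarrow> multiple_at p f"
  by (cases f) (auto simp: power2_eq_square dest: dvd_mult_left)

text \<open>\<open>phi\<close> moves b to the third place, so a coefficient b prime to p turns into
  a double root. Conversely every double root at p^2 E comes from a form of discriminant E by
  \<open>double_over\<close>, whose demand at 2 is the last assumption.\<close>

lemma mass_Gam0_phi_simple:
  assumes p: "prime p" and W: "\<And>f. root_at p f \<Longrightarrow> W (phi p f) \<longleftrightarrow> W f" and inv: "\<And>f g. g \<in> carrier GL2 \<Longrightarrow> W f \<Longrightarrow> W (mact g f)"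
    and E: "p = 2 \<Longrightarrow> 16 dvd p ^ 2 * E"
  shows "forms.mass (Gam0 p) {f. W f \<and> form_disc f = E \<and> simple_at p f}
       = forms.mass (Gam0 p) {f. W f \<and> form_disc f = p ^ 2 * E \<and> double_at p f}"
proof (rule mass_phi)
  show p0: "p > 0" using p prime_gt_0_int by simp
  have p2: "p ^ 2 \<noteq> 0" using p0 by simp
  show "forms.invariant (Gam0 p) {f. W f \<and> form_disc f = E \<and> simple_at p f}"
    using inv Gam0_stable_simple form_disc_mact
    by (auto simp: forms.invariant_def Gam0_stable_def Gam0_def)
  show over: "over_cond p 1 f" if "f \<in> {f. W f \<and> form_disc f = p ^ 2 * E \<and> double_at p f}" for f
    using that double_over[OF p, of f] E by simp
  show "root_at p f" if "f \<in> {f. W f \<and> form_disc f = E \<and> simple_at p f}" for f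
    using that by (cases f) auto
  then show "phi p f \<in> {f. W f \<and> form_disc f = p ^ 2 * E \<and> double_at p f}"
    if "f \<in> {f. W f \<and> form_disc f = E \<and> simple_at p f}" for f
    using that W form_disc_phi[OF p0] by (cases f) (auto simp: power2_eq_square)
  show "psi p f \<in> {f. W f \<and> form_disc f = E \<and> simple_at p f}"
    if f: "f \<in> {f. W f \<and> form_disc f = p ^ 2 * E \<and> double_at p f}" for f
  proof -
    from phi_psi[OF p0 over[OF f]] have eq: "phi p (psi p f) = f" and r: "root_at p (psi p f)" by auto
    have "W (psi p f)" using W[OF r] eq f by simp
    moreover have "form_disc (psi p f) = E" using form_disc_phi[OF p0 r] eq f p2 by simp
    moreover have "simple_at p (psi p f)" using f r by (cases f) auto
    ultimately show ?thesis by simp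
  qed
qed

text \<open>The parameter m serves the Z-mat case at p = 3: \<open>phi 3 f\<close> is Z-mat as soon
  as 3 | b, and only \<open>over_cond 3 3\<close> on the target forces 3 | c as well.\<close>

lemma mass_Gam0_phi_root:
  assumes p: "prime p" and W: "\<And>f. root_at p f \<Longrightarrow> over_cond p m (phi p f) \<and> W (phi p f) \<longleftrightarrow> W f"
    and inv: "\<And>f g. g \<in> carrier GL2 \<Longrightarrow> W f \<Longrightarrow> W (mact g f)"
  shows "forms.mass (Gam0 p) {f. W f \<and> form_disc f = E \<and> root_at p f}
       = forms.mass (Gam0 p) {f. W f \<and> form_disc f = p ^ 2 * E \<and> over_cond p m f}"
proof (rule mass_phi)
  show p0: "p > 0" using p prime_gt_0_int by simp
  have p2: "p ^ 2 \<noteq> 0" using p0 by simp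
  show "forms.invariant (Gam0 p) {f. W f \<and> form_disc f = E \<and> root_at p f}"
    using inv Gam0_stable_root form_disc_mact
    by (auto simp: forms.invariant_def Gam0_stable_def Gam0_def simp del: root_at.simps)
  show over: "over_cond p 1 f" if "f \<in> {f. W f \<and> form_disc f = p ^ 2 * E \<and> over_cond p m f}" for f
    using that by (cases f) (auto dest: dvd_mult_left)
  show "root_at p f" if "f \<in> {f. W f \<and> form_disc f = E \<and> root_at p f}" for f
    using that by simp
  then show "phi p f \<in> {f. W f \<and> form_disc f = p ^ 2 * E \<and> over_cond p m f}"
    if f: "f \<in> {f. W f \<and> form_disc f = E \<and> root_at p f}" for f
  proof -
    from f have "W f" "form_disc f = E" "root_at p f" by simp_all
    then show ?thesis using W[of f] form_disc_phi[OF p0, of f] by simp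
  qed
  show "psi p f \<in> {f. W f \<and> form_disc f = E \<and> root_at p f}"
    if f: "f \<in> {f. W f \<and> form_disc f = p ^ 2 * E \<and> over_cond p m f}" for f
  proof -
    from phi_psi[OF p0 over[OF f]] have eq: "phi p (psi p f) = f" and r: "root_at p (psi p f)" by auto
    have "W (psi p f)" using W[OF r] eq f by simp
    moreover have "form_disc (psi p f) = E" using form_disc_phi[OF p0 r] eq f p2 by simp
    ultimately show ?thesis using r by simp
  qed
qed


lemma content_image: "{f. content_dvd k f \<and> P f} = scale k ` {g. P (scale k g)}"
  unfolding content_dvd_iff by (intro equalityI subsetI) blast+

text \<open>Used with \<open>W\<close> trivial and E = D, and for p \<noteq> 3 with \<open>W\<close>
  the Z-mat condition and E = -27 D. Roots at p^4 E are overring points at p^6 E; the overring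
  points of the forms divisible by p are in turn roots at p^2 E, and the simple roots at these two
  levels cancel.\<close>

lemma mass_identity:
  assumes p: "prime p" and E: "E \<noteq> 0"
    and inv: "\<And>f g. g \<in> carrier GL2 \<Longrightarrow> W f \<Longrightarrow> W (mact g f)"
    and W: "\<And>f. root_at p f \<Longrightarrow> W (phi p f) \<longleftrightarrow> W f"
    and Ws: "\<And>f. W (scale p f) \<longleftrightarrow> W f"
  shows "form_mass {f. W f \<and> form_disc f = p ^ 6 * E} = form_mass {f. W f \<and> form_disc f = p ^ 4 * E}
    + of_int p * (form_mass {f. W f \<and> form_disc f = E} - form_mass {f. W f \<and> p ^ 2 * form_disc f = E})"
proof -
  define X where "X = (\<lambda>k. {f. W f \<and> form_disc f = p ^ k * E})"
  have p0: "p \<noteq> 0" using p by auto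
  have inv': "GL2_invariant {f. W f \<and> Q (form_disc f)}" for Q
    using inv form_disc_mact by (simp add: forms.invariant_def)
  have inv_X: "GL2_invariant (X k)" for k unfolding X_def by (rule inv')
  have fin_X: "finite_orbits (X k)" for k
    by (rule finite_orbits_subset[OF finite_orbits_disc[of "p ^ k * E"]]) (use E p0 in \<open>auto simp: X_def\<close>)
  have dvd: "p dvd form_disc f" if "f \<in> X k" "k > 0" for f k
    using that dvd_power[of k p] by (simp add: X_def)
  have content: "{f \<in> X (k + 4). content_dvd p f \<and> Q f} = scale p ` {f \<in> X k. Q (scale p f)}" for k Q
  proof -
    have "{f \<in> X (k + 4). content_dvd p f \<and> Q f}
        = {f. content_dvd p f \<and> (W f \<and> form_disc f = p ^ (k + 4) * E \<and> Q f)}"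
      by (rule Collect_cong) (unfold X_def mem_Collect_eq, blast)
    also have "\<dots> = scale p ` {g. W g \<and> form_disc g = p ^ k * E \<and> Q (scale p g)}"
      unfolding content_image Ws form_disc_scale using p0 by (simp add: power_add mult_ac)
    finally show ?thesis unfolding X_def mem_Collect_eq conj_assoc .
  qed
  \<comment> \<open>Here the quotient form would have discriminant E / p^2, so the condition is kept
    as a multiple; it has no solution unless p^2 | E.\<close>
  have content2: "{f \<in> X 2. content_dvd p f} = scale p ` {f. W f \<and> p ^ 2 * form_disc f = E}"
  proof -
    have "p ^ 4 * x = p ^ 2 * E \<longleftrightarrow> p ^ 2 * x = E" for x
    proof -
      have "p ^ 4 * x = p ^ 2 * (p ^ 2 * x)" by (simp add: mult.assoc[symmetric] power_add[symmetric])
      then show ?thesis using p0 by (simp only: mult_cancel_left) simp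
    qed
    moreover have "{f \<in> X 2. content_dvd p f} = {f. content_dvd p f \<and> (W f \<and> form_disc f = p ^ 2 * E)}"
      by (rule Collect_cong) (unfold X_def mem_Collect_eq, blast)
    ultimately show ?thesis unfolding content_image Ws form_disc_scale by simp
  qed
  have mc: "form_mass {f \<in> X (k + 4). content_dvd p f} = form_mass (X k)" for k
    using content[of k "\<lambda>_. True"] mass_scale[OF GL2_subgroup inv_X p0] by simp
  have mc2: "form_mass {f \<in> X 2. content_dvd p f} = form_mass {f. W f \<and> p ^ 2 * form_disc f = E}"
    unfolding content2 by (rule mass_scale[OF GL2_subgroup inv' p0])
  let ?S = "\<lambda>k. forms.mass (Gam0 p) {f \<in> X k. simple_at p f}"
  let ?R = "\<lambda>k. forms.mass (Gam0 p) {f \<in> X k. root_at p f}"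
  have root: "?R k = ?S k + form_mass (X k) + of_int p * form_mass {f \<in> X k. content_dvd p f}" if "k > 0" for k
    by (rule mass_root[OF p inv_X fin_X]) (use dvd that in auto)
  have S: "?S 2 = ?S 4"
  proof -
    have "?S 2 = forms.mass (Gam0 p) {f \<in> X 4. double_at p f}"
      using mass_Gam0_phi_simple[of p W "p ^ 2 * E", OF p W inv]
      by (simp add: X_def conj_assoc mult.assoc[symmetric] power_add[symmetric])
    also have "\<dots> = ?S 4" by (rule mass_simple_eq_double[OF p inv_X fin_X, symmetric]) (use dvd in auto)
    finally show ?thesis .
  qed
  have one: "hits p (over_cond p 1) f = 1" if f: "f \<in> X 6" and nc: "\<not> content_dvd p f" for f
  proof -
    have D: "p ^ 6 dvd form_disc f" using f by (simp add: X_def)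
    obtain g where g: "g \<in> carrier GL2" "multiple_at p (mact g f)"
      using ex_multiple_root[OF p dvd[OF f] nc] by auto
    have nc': "\<not> content_dvd p (mact g f)" using nc content_iff_mact[OF g(1)] by simp
    have o: "over_cond p 1 (mact g f)"
      by (rule multiple_over[OF p g(2) nc']) (use D form_disc_mact[OF g(1)] in simp)
    obtain a b c d where f': "mact g f = (a, b, c, d)" by (cases "mact g f")
    have "hits p (over_cond p 1) (mact g f) = 1"
      unfolding f' by (subst hits_subset_multiple[OF p _ _ _ over_multiple]) (use g(2) nc' o in \<open>auto simp: f'\<close>)
    then show ?thesis using hits_mact[OF p Gam0_stable_over g(1)] by simp
  qed
  have ov: "over_cond p 1 (phi p f)" for f by (cases f) simp
  have "?R 4 = forms.mass (Gam0 p) {f \<in> X 6. over_cond p 1 f}"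
    using mass_Gam0_phi_root[of p 1 W "p ^ 4 * E", OF p _ inv] W ov
    by (simp add: X_def conj_assoc mult.assoc[symmetric] power_add[symmetric] del: root_at.simps phi.simps) 
  also have "\<dots> = form_mass (X 6) - form_mass {f \<in> X 6. content_dvd p f}
     + forms.mass (Gam0 p) {f \<in> X 6. content_dvd p f \<and> over_cond p 1 f}"
    by (rule mass_over[OF p inv_X fin_X]) (use one in auto)
  also have "forms.mass (Gam0 p) {f \<in> X 6. content_dvd p f \<and> over_cond p 1 f} = ?R 2"
  proof -
    have "over_cond p 1 (scale p f) \<longleftrightarrow> root_at p f" for f
      using p0 by (cases f) (simp add: power2_eq_square)
    then have "{f \<in> X 6. content_dvd p f \<and> over_cond p 1 f} = scale p ` {f \<in> X 2. root_at p f}"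
      using content[of 2 "over_cond p 1"] by simp
    moreover have "forms.invariant (Gam0 p) {f \<in> X 2. root_at p f}"
      using inv_X[of 2] Gam0_stable_root[of p]
      by (auto simp: forms.invariant_def Gam0_stable_def Gam0_def simp del: root_at.simps)
    ultimately show ?thesis using mass_scale[OF subgroup_Gam0 _ p0] by simp
  qed
  finally show ?thesis
    using root[of 4] root[of 2] S mc[of 0] mc[of 2] mc2 by (simp add: X_def algebra_simps)
qed

text \<open>Once the multiple root modulo 3 is at (1 : 0), b is divisible by 3, so failing to be
  Z-mat means that 3 does not divide c: the root is double and there is exactly one simple root. A
  mass of forms thus becomes a mass of simple roots, which \<open>phi\<close> can move.\<close>

lemma mass_non_zmat:
  assumes E: "3 dvd E" "E \<noteq> 0"
  shows "form_mass {f. form_disc f = E \<and> \<not> zmat_form f}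
       = forms.mass (Gam0 3) {f. form_disc f = E \<and> simple_at 3 f}"
proof -
  let ?X = "{f. form_disc f = E}"
  note fin = finite_orbits_disc[OF E(2)]
  have X: "GL2_invariant ?X" using form_disc_mact by (simp add: forms.invariant_def)
  have z: "zmat_form (mact g f) \<longleftrightarrow> zmat_form f" if "g \<in> carrier GL2" for g f
    using zmat_form_mact forms.act_inv[OF that] by metis
  have "hits 3 (simple_at 3) f = (if \<not> zmat_form f then 1 else 0)" if f: "f \<in> ?X" for f
  proof (cases "zmat_form f")
    case True
    have "\<not> simple_at 3 g" if "zmat_form g" for g using that by (cases g) auto
    then show ?thesis using True zmat_form_mact by (simp add: hits_def)
  next
    case False
    have "\<not> content_dvd 3 f" using False by (cases f) auto
    then obtain g where g: "g \<in> carrier GL2" "multiple_at 3 (mact g f)"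
      using ex_multiple_root[OF two_three_prime_int(2), of f] f E by auto
    obtain a b c d where f': "mact g f = (a, b, c, d)" by (cases "mact g f")
    have "\<not> zmat_form (mact g f)" using False z g by simp
    then have "hits 3 (simple_at 3) (mact g f) = 1"
      unfolding f' by (subst hits_simple) (use g(2) in \<open>auto simp: f'\<close>)
    then show ?thesis using False hits_mact[OF _ Gam0_stable_simple g(1)] by simp
  qed
  then have "forms.wsum ?X (\<lambda>f. of_nat (hits 3 (simple_at 3) f)) = forms.wsum ?X (\<lambda>f. if \<not> zmat_form f then 1 else 0)"
    by (intro forms.wsum_cong[OF X]) simp
  then show ?thesis
    using mass_Gam0[OF two_three_prime_int(2) Gam0_stable_simple X fin] wsum_indicator[OF fin X, of "\<lambda>f. \<not> zmat_form f"] z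
    by simp
qed

text \<open>The general identity fails here because every multiple of 3 is Z-mat, so division by 3
  leaves the Z-mat forms. All forms of discriminants -27 D, -243 D and -3 D appear, and the Z-mat
  ones are separated again at the end.\<close>

lemma mass_identity_zmat_3:
  assumes D: "D \<noteq> 0"
  shows "form_mass {f. zmat_form f \<and> form_disc f = - 27 * (3 ^ 6 * D)} =
      form_mass {f. zmat_form f \<and> form_disc f = - 27 * (3 ^ 4 * D)}
    + 3 * (form_mass {f. zmat_form f \<and> form_disc f = - 27 * D} - form_mass {f. zmat_form f \<and> form_disc f = - 3 * D})"
proof -
  let ?M = "\<lambda>E. {f. form_disc f = E}"
  let ?Z = "\<lambda>E. {f. zmat_form f \<and> form_disc f = E}"
  note p = two_three_prime_int(2)
  have z: "zmat_form (mact g f) \<longleftrightarrow> zmat_form f" if "g \<in> carrier GL2" for g f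
    using zmat_form_mact forms.act_inv[OF that] by metis
  have inv: "GL2_invariant (?M E)" "GL2_invariant (?Z E)" for E
    using form_disc_mact zmat_form_mact by (simp_all add: forms.invariant_def)
  have finZ: "finite_orbits (?Z E)" if "E \<noteq> 0" for E
    by (rule finite_orbits_subset[OF finite_orbits_disc[OF that]]) auto
  have zs: "zmat_form (scale 3 f)" for f by (cases f) simp
  have content: "{f \<in> ?Z (81 * E). content_dvd 3 f \<and> Q f} = scale 3 ` {f \<in> ?M E. Q (scale 3 f)}" for E Q
  proof -
    have "{f \<in> ?Z (81 * E). content_dvd 3 f \<and> Q f}
        = {f. content_dvd 3 f \<and> (zmat_form f \<and> form_disc f = 81 * E \<and> Q f)}"
      by (rule Collect_cong) blast
    also have "\<dots> = scale 3 ` {g. form_disc g = E \<and> Q (scale 3 g)}"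
      unfolding content_image form_disc_scale by (simp add: zs)
    finally show ?thesis unfolding mem_Collect_eq .
  qed
  have contentM: "{f \<in> ?M (81 * E). content_dvd 3 f} = scale 3 ` ?M E" for E
  proof -
    have "{f \<in> ?M (81 * E). content_dvd 3 f} = {f. content_dvd 3 f \<and> form_disc f = 81 * E}"
      by (rule Collect_cong) blast
    then show ?thesis unfolding content_image form_disc_scale by simp
  qed
  have mc: "form_mass {f \<in> ?Z (81 * E). content_dvd 3 f} = form_mass (?M E)" for E
    using content[of E "\<lambda>_. True"] mass_scale[OF GL2_subgroup inv(1), of 3 E] by simp
  have mcM: "form_mass {f \<in> ?M (81 * E). content_dvd 3 f} = form_mass (?M E)" for E
    unfolding contentM by (rule mass_scale[OF GL2_subgroup inv(1)]) simp
  \<comment> \<open>These are the discriminants -27 * 3^4 D and -27 * 3^6 D, written with the factor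
    81 that division of the form by 3 removes.\<close>
  let ?A2 = "?Z (81 * (- 27 * D))" and ?A3 = "?Z (81 * (- 243 * D))"
  have R2: "forms.mass (Gam0 3) {f \<in> ?A2. root_at 3 f} = form_mass ?A2 + 3 * form_mass (?M (- 27 * D))"
  proof -
    have "{f \<in> ?A2. simple_at 3 f} = {}" by (auto elim!: simple_at.elims)
    then have "forms.mass (Gam0 3) {f \<in> ?A2. simple_at 3 f} = 0" by (simp only: forms.mass_def image_empty sum.empty)
    moreover have "forms.mass (Gam0 3) {f \<in> ?A2. root_at 3 f} = forms.mass (Gam0 3) {f \<in> ?A2. simple_at 3 f} +
      form_mass ?A2 + of_int 3 * form_mass {f \<in> ?A2. content_dvd 3 f}"
      by (rule mass_root[OF p inv(2) finZ]) (use D in auto)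
    ultimately show ?thesis using mc[of "- 27 * D"] by simp
  qed
  have R3: "forms.mass (Gam0 3) {f \<in> ?A2. root_at 3 f} = forms.mass (Gam0 3) {f \<in> ?A3. over_cond 3 3 f}"
  proof -
    have "over_cond 3 3 (phi 3 f) \<and> zmat_form (phi 3 f) \<longleftrightarrow> zmat_form f" for f
      by (cases f) auto
    then show ?thesis
      using mass_Gam0_phi_root[of 3 3 zmat_form "81 * (- 27 * D)", OF p _ zmat_form_mact]
      by (simp add: conj_assoc)
  qed
  have one: "hits 3 (over_cond 3 3) f = 1" if f: "f \<in> ?A3" and nc: "\<not> content_dvd 3 f" for f
  proof -
    obtain g where g: "g \<in> carrier GL2" "multiple_at 3 (mact g f)"
      using ex_multiple_root[OF p _ nc] f by auto
    have nc': "\<not> content_dvd 3 (mact g f)" using nc content_iff_mact[OF g(1)] by simp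
    have zg: "zmat_form (mact g f)" using f zmat_form_mact by simp
    have o: "over_cond 3 3 (mact g f)"
      by (rule multiple_over_zmat[OF g(2) zg nc']) (use f form_disc_mact[OF g(1)] in simp)
    obtain a b c d where f': "mact g f = (a, b, c, d)" by (cases "mact g f")
    have "hits 3 (over_cond 3 3) (mact g f) = 1"
      unfolding f' by (subst hits_subset_multiple[OF p _ _ _ over_multiple]) (use g(2) nc' o in \<open>auto simp: f'\<close>)
    then show ?thesis using hits_mact[OF p Gam0_stable_over g(1), of 3] by simp
  qed
  have "forms.mass (Gam0 3) {f \<in> ?A3. over_cond 3 3 f} = form_mass ?A3 - form_mass {f \<in> ?A3. content_dvd 3 f}
     + forms.mass (Gam0 3) {f \<in> ?A3. content_dvd 3 f \<and> over_cond 3 3 f}"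
    by (rule mass_over[OF p inv(2) finZ]) (use one D in auto)
  also have "forms.mass (Gam0 3) {f \<in> ?A3. content_dvd 3 f \<and> over_cond 3 3 f}
     = forms.mass (Gam0 3) {f \<in> ?M (- 243 * D). multiple_at 3 f}"
  proof -
    have "over_cond 3 3 (scale 3 f) \<longleftrightarrow> multiple_at 3 f" for f
    proof -
      have "9 dvd 3 * x \<longleftrightarrow> 3 dvd x" for x :: int by presburger
      then show ?thesis by (cases f) simp
    qed
    then have "{f \<in> ?A3. content_dvd 3 f \<and> over_cond 3 3 f} = scale 3 ` {f \<in> ?M (- 243 * D). multiple_at 3 f}"
      using content[of "- 243 * D" "over_cond 3 3"] by simp
    moreover have "forms.invariant (Gam0 3) {f \<in> ?M (- 243 * D). multiple_at 3 f}"
      using inv(1)[of "- 243 * D"] Gam0_stable_multiple[of 3]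
      by (auto simp: forms.invariant_def Gam0_stable_def Gam0_def simp del: multiple_at.simps)
    ultimately show ?thesis using mass_scale[OF subgroup_Gam0, of 3 _ 3] by simp
  qed
  also have "\<dots> = form_mass (?M (- 243 * D)) + of_int 3 * form_mass {f \<in> ?M (- 243 * D). content_dvd 3 f}"
    by (rule mass_multiple[OF p inv(1) finite_orbits_disc]) (use D in auto)
  finally have main: "form_mass ?A3 = form_mass ?A2 + 3 * (form_mass (?M (- 27 * D)) - form_mass (?M (- 3 * D)))"
    using R2 R3 mc[of "- 243 * D"] mcM[of "- 3 * D"] by (simp add: algebra_simps)
  have split: "form_mass (?M E) = form_mass (?Z E) + form_mass {f. form_disc f = E \<and> \<not> zmat_form f}" if "E \<noteq> 0" for E
  proof -
    have "{f \<in> ?M E. zmat_form f} = ?Z E" by auto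
    then show ?thesis using forms.mass_split[OF finite_orbits_disc[OF that] inv(1), of zmat_form] inv(2)[of E] by simp
  qed
  \<comment> \<open>A simple root at -3 D becomes a double root at -27 D, and there double and
    simple roots are equally many; so the forms that are not Z-mat cancel between the two
    discriminants.\<close>
  have "forms.mass (Gam0 3) {f. form_disc f = - 3 * D \<and> simple_at 3 f}
      = forms.mass (Gam0 3) {f. form_disc f = - 27 * D \<and> double_at 3 f}"
    using mass_Gam0_phi_simple[of 3 "\<lambda>_. True" "- 3 * D"] by simp
  also have "\<dots> = forms.mass (Gam0 3) {f. form_disc f = - 27 * D \<and> simple_at 3 f}"
    using mass_simple_eq_double[OF p inv(1) finite_orbits_disc, of "- 27 * D"] D by simp
  finally have "form_mass {f. form_disc f = - 3 * D \<and> \<not> zmat_form f} = form_mass {f. form_disc f = - 27 * D \<and> \<not> zmat_form f}"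
    using mass_non_zmat[of "- 3 * D"] mass_non_zmat[of "- 27 * D"] D by simp
  then show ?thesis
    using main split[of "- 27 * D"] split[of "- 3 * D"] D by (simp add: algebra_simps)
qed

section \<open>Cubic rings and cubic forms\<close>


type_synonym int3 = "int \<times> int \<times> int"

fun sc :: "int \<Rightarrow> int3 \<Rightarrow> int3" where
  "sc k (x, y, z) = (k * x, k * y, k * z)"

definition zadditive :: "(int3 \<Rightarrow> int3) \<Rightarrow> bool" where
  "zadditive F \<longleftrightarrow> (\<forall>x y. F (x + y) = F x + F y)"

lemma sc_simps: "sc 0 x = 0" "sc 1 x = x" "sc (k + l) x = sc k x + sc l x" "sc (- k) x = - sc k x"
  by (cases x; simp add: zero_prod_def algebra_simps)+

lemma zadditive_comp: "zadditive F \<Longrightarrow> zadditive F' \<Longrightarrow> zadditive (F \<circ> F')"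
  unfolding zadditive_def comp_def by metis

lemma zadditive_sc:
  assumes F: "zadditive F" shows "F (sc k x) = sc k (F x)"
proof -
  have add: "F (x + y) = F x + F y" for x y using F unfolding zadditive_def by blast
  have zero: "F 0 = 0" using add[of 0 0] by simp
  have neg: "F (- x) = - F x" for x using add[of x "- x"] zero by (simp add: add_eq_0_iff)
  have nat: "F (sc (int n) x) = sc (int n) (F x)" for n
    by (induction n) (simp_all add: sc_simps zero add)
  show ?thesis
  proof (cases k)
    case (nonneg n)
    then show ?thesis using nat by simp
  next
    case (neg n)
    then show ?thesis using nat[of "Suc n"] \<open>\<And>x. F (- x) = - F x\<close> by (simp only: sc_simps)
  qed
qed

lemma zadditive_expand:
  assumes F: "zadditive F"
  shows "F (n, u, v) = sc n (F (1, 0, 0)) + sc u (F (0, 1, 0)) + sc v (F (0, 0, 1))"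
proof -
  have "(n, u, v) = sc n (1, 0, 0) + sc u (0, 1, 0) + sc v (0, 0, 1)" by simp
  then show ?thesis using F zadditive_sc[OF F] by (simp only: zadditive_def)
qed

text \<open>The Delone--Faddeev ring of \<open>(a, b, c, d)\<close> has basis \<open>1, \<omega>, \<theta>\<close> with \<open>\<omega>\<theta> = -ad\<close>,
  \<open>\<omega>\<^sup>2 = -ac + b\<omega> - a\<theta>\<close> and \<open>\<theta>\<^sup>2 = -bd + d\<omega> - c\<theta>\<close>.\<close>

fun fmul :: "form \<Rightarrow> int3 \<Rightarrow> int3 \<Rightarrow> int3" where
  "fmul (a, b, c, d) (n, u, v) (n', u', v') =
     (n * n' - a * c * u * u' - a * d * (u * v' + v * u') - b * d * v * v',
      n * u' + u * n' + b * u * u' + d * v * v',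
      n * v' + v * n' - a * u * u' - c * v * v')"

text \<open>A commutative ring structure on the fixed additive group of integer triples, with an
  arbitrary vector as unit; moving that unit to (1, 0, 0) is the first half of the normal
  form.\<close>

definition unital_mul :: "(int3 \<Rightarrow> int3 \<Rightarrow> int3) \<Rightarrow> int3 \<Rightarrow> bool" where
  "unital_mul mul e \<longleftrightarrow> (\<forall>x y z. mul (x + y) z = mul x z + mul y z) \<and> (\<forall>x y. mul x y = mul y x) \<and>
     (\<forall>x y z. mul (mul x y) z = mul x (mul y z)) \<and> (\<forall>x. mul e x = x)"

lemma unital_mulD:
  assumes "unital_mul mul e"
  shows "mul (x + y) z = mul x z + mul y z" "mul x y = mul y x" "mul (mul x y) z = mul x (mul y z)"
    "mul e x = x" "mul x e = x" "zadditive (\<lambda>x. mul x y)" "zadditive (mul x)"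
proof -
  show add: "mul (x + y) z = mul x z + mul y z" and comm: "mul x y = mul y x"
    and "mul (mul x y) z = mul x (mul y z)" and one: "mul e x = x" for x y z
    using assms unfolding unital_mul_def by blast+
  show "mul x e = x" using one comm by metis
  show "zadditive (\<lambda>x. mul x y)" unfolding zadditive_def using add by blast
  show "zadditive (mul x)" unfolding zadditive_def using add comm by metis
qed

lemma unital_mul_fmul: "unital_mul (fmul f) (1, 0, 0)"
proof -
  obtain a b c d where f: "f = (a, b, c, d)" by (cases f)
  have 1: "fmul f (x + y) z = fmul f x z + fmul f y z" for x y z
    by (cases x; cases y; cases z) (simp add: f algebra_simps)
  have 2: "fmul f x y = fmul f y x" for x y
    by (cases x; cases y) (simp add: f algebra_simps)
  have 3: "fmul f (fmul f x y) z = fmul f x (fmul f y z)" for x y z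
    by (cases x; cases y; cases z) (simp add: f algebra_simps)
  have 4: "fmul f (1, 0, 0) x = x" for x by (cases x) (simp add: f)
  show ?thesis unfolding unital_mul_def using 1 2 3 4 by blast
qed

text \<open>If \<omega>\<theta> is an integer, associativity of \<omega>\<omega>\<theta> and of
  \<omega>\<theta>\<theta> determines this integer and the constant terms of the two squares. The
  four remaining structure constants are arbitrary and, up to sign, form the cubic form.\<close>

lemma unital_mul_eq_fmul:
  assumes m: "unital_mul mul (1, 0, 0)" and n: "mul (0, 1, 0) (0, 0, 1) = (n, 0, 0)"
  shows "\<exists>f. mul = fmul f"
proof -
  note comm = unital_mulD(2)[OF m] and assoc = unital_mulD(3)[OF m] and one = unital_mulD(4)[OF m]
  note L = zadditive_expand[OF unital_mulD(6)[OF m]] and R = zadditive_expand[OF unital_mulD(7)[OF m]]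
  obtain m' b a' where ww: "mul (0, 1, 0) (0, 1, 0) = (m', b, a')" by (cases "mul (0, 1, 0) (0, 1, 0)")
  obtain l d c' where tt: "mul (0, 0, 1) (0, 0, 1) = (l, d, c')" by (cases "mul (0, 0, 1) (0, 0, 1)")
  have tw: "mul (0, 0, 1) (0, 1, 0) = (n, 0, 0)" using n comm by metis
  note one' = unital_mulD(5)[OF m]
  have "mul (mul (0, 1, 0) (0, 1, 0)) (0, 0, 1) = mul (0, 1, 0) (mul (0, 1, 0) (0, 0, 1))" by (rule assoc)
  then have e1: "n = a' * d" "m' = - (a' * c')"
    unfolding ww n L[of m' b a'] R[of _ n 0 0] by (auto simp: one one' n tt)
  have "mul (mul (0, 1, 0) (0, 0, 1)) (0, 0, 1) = mul (0, 1, 0) (mul (0, 0, 1) (0, 0, 1))" by (rule assoc)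
  then have e2: "l = - (b * d)"
    unfolding tt n L[of n 0 0] R[of _ l d c'] by (auto simp: one one' n ww mult_ac)
  have "mul x y = fmul (- a', b, - c', d) x y" for x y
  proof (cases x; cases y)
    fix p q r p' q' r' assume x: "x = (p, q, r)" and y: "y = (p', q', r')"
    show ?thesis unfolding x y L[of p q r] R[of _ p' q' r']
      by (simp add: one one' n tw ww tt e1 e2 algebra_simps)
  qed
  then show ?thesis by blast
qed

lemma unital_mul_transport:
  assumes m: "unital_mul mul e" and \<mu>: "bij \<mu>" "zadditive \<mu>" "\<mu> e' = e"
  shows "unital_mul (\<lambda>x y. inv_into UNIV \<mu> (mul (\<mu> x) (\<mu> y))) e'"
proof -
  have \<mu>1: "\<mu> (inv_into UNIV \<mu> x) = x" and \<mu>2: "inv_into UNIV \<mu> (\<mu> x) = x" for x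
    using \<mu>(1) by (simp_all add: bij_is_surj surj_f_inv_f bij_is_inj)
  have inv_add: "inv_into UNIV \<mu> (x + y) = inv_into UNIV \<mu> x + inv_into UNIV \<mu> y" for x y
    using \<mu>(2) \<mu>1 \<mu>2 unfolding zadditive_def by metis
  have add: "\<mu> (x + y) = \<mu> x + \<mu> y" for x y using \<mu>(2) unfolding zadditive_def by blast
  note D = unital_mulD[OF m]
  show ?thesis
    unfolding unital_mul_def
  proof (intro conjI allI)
    show "inv_into UNIV \<mu> (mul (\<mu> x) (\<mu> y)) = inv_into UNIV \<mu> (mul (\<mu> y) (\<mu> x))" for x y
      by (rule arg_cong[OF D(2)])
  qed (simp_all only: \<mu>1 \<mu>2 add inv_add \<mu>(3) D(1,3,4))
qed

lemma unimodular_inverse: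
  fixes p q s t n u :: int
  assumes "s * p + t * q = 1"
  shows "s * (p * n - t * u) + t * (q * n + s * u) = n" "- q * (p * n - t * u) + p * (q * n + s * u) = u"
    "p * (s * n + t * u) - t * (- q * n + p * u) = n" "q * (s * n + t * u) + s * (- q * n + p * u) = u"
proof -
  have "s * (p * n - t * u) + t * (q * n + s * u) = (s * p + t * q) * n"
    "- q * (p * n - t * u) + p * (q * n + s * u) = (s * p + t * q) * u"
    "p * (s * n + t * u) - t * (- q * n + p * u) = (s * p + t * q) * n"
    "q * (s * n + t * u) + s * (- q * n + p * u) = (s * p + t * q) * u"
    by (simp_all add: algebra_simps)
  then show "s * (p * n - t * u) + t * (q * n + s * u) = n" "- q * (p * n - t * u) + p * (q * n + s * u) = u"
    "p * (s * n + t * u) - t * (- q * n + p * u) = n" "q * (s * n + t * u) + s * (- q * n + p * u) = u"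
    by (simp_all only: assms mult_1)
qed

text \<open>A primitive vector is the first member of a basis. Two Bezout matrices suffice: one
  produces (x, y) from its gcd, the other produces this gcd and z from 1.\<close>

lemma ex_unimodular:
  assumes "gcd (gcd x y) z = (1::int)"
  shows "\<exists>\<mu>. bij \<mu> \<and> zadditive \<mu> \<and> \<mu> (1, 0, 0) = (x, y, z)"
proof -
  have first: "\<exists>\<mu>. bij \<mu> \<and> zadditive \<mu> \<and> (\<forall>n v. \<mu> (gcd x y * n, 0, v) = (x * n, y * n, v))"
  proof (cases "gcd x y = 0")
    case True
    then show ?thesis by (intro exI[of _ id]) (auto simp: zadditive_def)
  next
    case False
    define g where "g = gcd x y"
    have g0: "g \<noteq> 0" using False by (simp add: g_def)
    obtain s t where st: "s * x + t * y = g" using bezout_int[of x y] by (auto simp: g_def)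
    obtain x' y' where xy: "x = g * x'" "y = g * y'"
      using gcd_dvd1[of x y] gcd_dvd2[of x y] by (auto simp: g_def[symmetric] elim!: dvdE)
    have "g * (s * x' + t * y') = g * 1" using st by (simp add: xy algebra_simps)
    then have one: "s * x' + t * y' = 1" using g0 by (simp only: mult_cancel_left) simp
    let ?f = "\<lambda>(n, u, v). (x' * n - t * u, y' * n + s * u, v)"
    let ?h = "\<lambda>(n, u, v). (s * n + t * u, - y' * n + x' * u, v)"
    have "bij ?f"
      by (rule bij_betw_byWitness[where f' = ?h])
        (simp_all only: split_paired_All ball_UNIV case_prod_conv subset_UNIV unimodular_inverse[OF one] simp_thms)
    moreover have "zadditive ?f" by (auto simp: zadditive_def algebra_simps)
    moreover have "?f (gcd x y * n, 0, v) = (x * n, y * n, v)" for n v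
      unfolding g_def[symmetric] by (simp add: xy mult_ac)
    ultimately show ?thesis by blast
  qed
  then obtain \<mu> where \<mu>: "bij \<mu>" "zadditive \<mu>" "\<And>n v. \<mu> (gcd x y * n, 0, v) = (x * n, y * n, v)" by blast
  obtain s t where st: "s * gcd x y + t * z = 1" using bezout_int[of "gcd x y" z] assms by auto
  let ?g = "gcd x y"
  let ?f = "\<lambda>(n, u, v). (?g * n - t * v, u, z * n + s * v)"
  let ?h = "\<lambda>(n, u, v). (s * n + t * v, u, - z * n + ?g * v)"
  have "bij ?f"
    by (rule bij_betw_byWitness[where f' = ?h])
      (simp_all only: split_paired_All ball_UNIV case_prod_conv subset_UNIV unimodular_inverse[OF st] simp_thms)
  moreover have "zadditive ?f" by (auto simp: zadditive_def algebra_simps)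
  moreover have "\<mu> (?f (1, 0, 0)) = (x, y, z)" using \<mu>(3)[of 1 z] by simp
  ultimately show ?thesis
    by (intro exI[of _ "\<mu> \<circ> ?f"] conjI bij_comp zadditive_comp \<mu>) simp_all
qed

text \<open>The unit is primitive and hence part of a basis 1, \<omega>, \<theta>; integer
  translations of \<omega> and \<theta> then make their product an integer.\<close>

lemma unital_mul_normal_form:
  assumes m: "unital_mul mul e"
  shows "\<exists>\<mu> f. bij \<mu> \<and> zadditive \<mu> \<and> \<mu> (1, 0, 0) = e \<and> (\<forall>x y. \<mu> (fmul f x y) = mul (\<mu> x) (\<mu> y))"
proof -
  obtain x y z where e: "e = (x, y, z)" by (cases e)
  note addl = unital_mulD(6)[OF m]
  let ?g = "gcd (gcd x y) z"
  have g: "?g dvd x" "?g dvd y" "?g dvd z" by (auto intro: dvd_trans)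
  from g(1) obtain x' where x': "x = ?g * x'" by (rule dvdE)
  from g(2) obtain y' where y': "y = ?g * y'" by (rule dvdE)
  from g(3) obtain z' where z': "z = ?g * z'" by (rule dvdE)
  have "e = sc ?g (x', y', z')" unfolding e using x' y' z' by simp
  \<comment> \<open>If the unit is ?g times some e', then ?g times the product of e' with (1, 0, 0)
    is (1, 0, 0), so ?g is a unit.\<close>
  then have "sc ?g (mul (x', y', z') (1, 0, 0)) = (1, 0, 0)"
    using zadditive_sc[OF addl[of "(1, 0, 0)"], of ?g "(x', y', z')"] unital_mulD(4)[OF m] by simp
  moreover obtain p q r where "mul (x', y', z') (1, 0, 0) = (p, q, r)" by (cases "mul (x', y', z') (1, 0, 0)")
  ultimately have "?g * p = 1" by simp
  then have unit: "?g dvd 1" by (metis dvd_triv_left)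
  have "?g = 1" by (rule zdvd_antisym_nonneg) (use unit in simp_all)
  from ex_unimodular[OF this] obtain \<mu> where \<mu>: "bij \<mu>" "zadditive \<mu>" "\<mu> (1, 0, 0) = e"
    unfolding e by blast
  define mul1 where "mul1 = (\<lambda>x y. inv_into UNIV \<mu> (mul (\<mu> x) (\<mu> y)))"
  have m1: "unital_mul mul1 (1, 0, 0)" unfolding mul1_def by (rule unital_mul_transport[OF m \<mu>])
  obtain n r s where nrs: "mul1 (0, 1, 0) (0, 0, 1) = (n, r, s)" by (cases "mul1 (0, 1, 0) (0, 0, 1)")
  \<comment> \<open>From \<omega>\<theta> = n + r \<omega> + s \<theta> one gets (\<omega> - s)
    (\<theta> - r) = n + r s.\<close>
  define \<sigma> :: "int3 \<Rightarrow> int3" where "\<sigma> = (\<lambda>(n, u, v). (n - s * u - r * v, u, v))"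
  have "bij \<sigma>" unfolding \<sigma>_def
    by (rule bij_betw_byWitness[where f' = "\<lambda>(n, u, v). (n + s * u + r * v, u, v)"]) auto
  moreover have "zadditive \<sigma>" by (auto simp: zadditive_def \<sigma>_def algebra_simps)
  moreover have "\<sigma> (1, 0, 0) = (1, 0, 0)" by (simp add: \<sigma>_def)
  ultimately have \<sigma>: "bij \<sigma>" "zadditive \<sigma>" "\<sigma> (1, 0, 0) = (1, 0, 0)" by auto
  define mul2 where "mul2 = (\<lambda>x y. inv_into UNIV \<sigma> (mul1 (\<sigma> x) (\<sigma> y)))"
  have m2: "unital_mul mul2 (1, 0, 0)" unfolding mul2_def by (rule unital_mul_transport[OF m1 \<sigma>])
  note one = unital_mulD(4,5)[OF m1] and addl1 = unital_mulD(6)[OF m1] and addr1 = unital_mulD(7)[OF m1]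
  have "mul1 (\<sigma> (0, 1, 0)) (\<sigma> (0, 0, 1)) = (n + r * s, 0, 0)"
    by (simp add: \<sigma>_def zadditive_expand[OF addl1, of "- s" 1 0] zadditive_expand[OF addr1, of _ "- r" 0 1] one nrs sc_simps)
  then have "mul2 (0, 1, 0) (0, 0, 1) = inv_into UNIV \<sigma> (n + r * s, 0, 0)" by (simp add: mul2_def)
  also have "\<dots> = (n + r * s, 0, 0)"
    by (rule inv_f_eq[OF bij_is_inj[OF \<sigma>(1)]]) (simp add: \<sigma>_def)
  finally obtain f where f: "mul2 = fmul f" using unital_mul_eq_fmul[OF m2] by blast
  have "\<mu> (\<sigma> (fmul f x y)) = mul (\<mu> (\<sigma> x)) (\<mu> (\<sigma> y))" for x y
    unfolding f[symmetric] mul2_def mul1_def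
    using \<mu>(1) \<sigma>(1) by (simp add: bij_is_surj surj_f_inv_f)
  then have "bij (\<mu> \<circ> \<sigma>) \<and> zadditive (\<mu> \<circ> \<sigma>) \<and> (\<mu> \<circ> \<sigma>) (1, 0, 0) = e \<and>
      (\<forall>x y. (\<mu> \<circ> \<sigma>) (fmul f x y) = mul ((\<mu> \<circ> \<sigma>) x) ((\<mu> \<circ> \<sigma>) y))"
    by (intro conjI bij_comp zadditive_comp \<mu> \<sigma>) (simp_all add: \<mu>(3) \<sigma>(3))
  then show ?thesis by blast
qed


section \<open>The ring of a form and its isomorphisms\<close>

definition form_ring :: "form \<Rightarrow> int3 ring" where
  "form_ring f = \<lparr>carrier = UNIV, monoid.mult = fmul f, one = (1, 0, 0), zero = 0, add = (+)\<rparr>"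

lemma form_ring_simps [simp]:
  "carrier (form_ring f) = UNIV" "x \<otimes>\<^bsub>form_ring f\<^esub> y = fmul f x y" "\<one>\<^bsub>form_ring f\<^esub> = (1, 0, 0)"
  "\<zero>\<^bsub>form_ring f\<^esub> = 0" "x \<oplus>\<^bsub>form_ring f\<^esub> y = x + y"
  by (simp_all add: form_ring_def)

lemma cring_form_ring: "cring (form_ring f)"
proof (rule cringI)
  note D = unital_mulD[OF unital_mul_fmul[of f]]
  show "abelian_group (form_ring f)"
  proof (rule abelian_groupI)
    show "\<exists>y\<in>carrier (form_ring f). y \<oplus>\<^bsub>form_ring f\<^esub> x = \<zero>\<^bsub>form_ring f\<^esub>" for x
      by (rule bexI[of _ "- x"]) (simp_all only: form_ring_simps UNIV_I ab_left_minus)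
  qed (simp_all only: form_ring_simps UNIV_I ac_simps add_0 add_0_right)
  show "Group.comm_monoid (form_ring f)"
    by (rule comm_monoidI) (simp_all only: form_ring_simps UNIV_I D(2)[of _ "(1,0,0)"] D(3,4), rule D(2))
  show "(x \<oplus>\<^bsub>form_ring f\<^esub> y) \<otimes>\<^bsub>form_ring f\<^esub> z =
      x \<otimes>\<^bsub>form_ring f\<^esub> z \<oplus>\<^bsub>form_ring f\<^esub> y \<otimes>\<^bsub>form_ring f\<^esub> z" for x y z
    by (simp only: form_ring_simps D(1))
qed

lemma int3_group: "integer_group \<times>\<times> integer_group \<times>\<times> integer_group =
    \<lparr>carrier = UNIV, monoid.mult = (+), one = (0::int3)\<rparr>"
  unfolding DirProd_def integer_group_def by (simp add: fun_eq_iff zero_prod_def)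

lemma cubic_ring_form_ring: "cubic_ring (form_ring f)"
proof -
  have "id \<in> iso (add_monoid (form_ring f)) (integer_group \<times>\<times> integer_group \<times>\<times> integer_group)"
    unfolding int3_group by (simp add: iso_def hom_def)
  then show ?thesis unfolding cubic_ring_def is_iso_def using cring_form_ring by blast
qed

lemma cubic_ring_iso_form_ring:
  fixes R :: "('a, 'm) ring_scheme" (structure)
  assumes "cubic_ring R"
  shows "\<exists>f \<psi>. \<psi> \<in> ring_iso (form_ring f) R"
proof -
  interpret cring R using assms by (simp add: cubic_ring_def)
  from assms obtain \<eta> where \<eta>: "\<eta> \<in> iso (add_monoid R) (integer_group \<times>\<times> integer_group \<times>\<times> integer_group)"
    unfolding cubic_ring_def is_iso_def by blast
  then have \<eta>b: "bij_betw \<eta> (carrier R) UNIV" and \<eta>a: "\<And>x y. x \<in> carrier R \<Longrightarrow> y \<in> carrier R \<Longrightarrow> \<eta> (x \<oplus> y) = \<eta> x + \<eta> y"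
    unfolding int3_group by (auto simp: iso_def hom_def)
  define \<psi> where "\<psi> = inv_into (carrier R) \<eta>"
  have \<psi>R: "\<psi> x \<in> carrier R" and \<eta>\<psi>: "\<eta> (\<psi> x) = x" for x
    using \<eta>b by (auto simp: \<psi>_def bij_betw_def inv_into_into f_inv_into_f)
  have \<psi>\<eta>: "\<psi> (\<eta> y) = y" if "y \<in> carrier R" for y
    using \<eta>b that by (simp add: \<psi>_def bij_betw_def)
  have \<psi>b: "bij_betw \<psi> UNIV (carrier R)"
    by (rule bij_betw_byWitness[where f' = \<eta>]) (use \<psi>R \<eta>\<psi> \<psi>\<eta> in auto)
  have \<psi>a: "\<psi> (x + y) = \<psi> x \<oplus> \<psi> y" for x y
    using \<eta>a[of "\<psi> x" "\<psi> y"] \<psi>R \<eta>\<psi> \<psi>\<eta> by (metis a_closed)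
  define mul where "mul = (\<lambda>x y. \<eta> (\<psi> x \<otimes> \<psi> y))"
  have "unital_mul mul (\<eta> \<one>)"
    unfolding unital_mul_def mul_def
    by (intro conjI allI) (simp_all only: \<psi>a \<psi>R \<eta>\<psi> \<psi>\<eta> \<eta>a[symmetric] l_distr m_closed m_assoc one_closed l_one, rule arg_cong[OF m_comm[OF \<psi>R \<psi>R]])
  then obtain \<mu> f where \<mu>: "bij \<mu>" "zadditive \<mu>" "\<mu> (1, 0, 0) = \<eta> \<one>" "\<And>x y. \<mu> (fmul f x y) = mul (\<mu> x) (\<mu> y)"
    using unital_mul_normal_form by blast
  have "\<psi> \<circ> \<mu> \<in> ring_hom (form_ring f) R"
  proof (rule ring_hom_memI)
    fix x y
    show "(\<psi> \<circ> \<mu>) x \<in> carrier R" using \<psi>R by simp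
    show "(\<psi> \<circ> \<mu>) (x \<otimes>\<^bsub>form_ring f\<^esub> y) = (\<psi> \<circ> \<mu>) x \<otimes> (\<psi> \<circ> \<mu>) y"
      using \<psi>R by (simp add: \<mu>(4) mul_def \<psi>\<eta>)
    show "(\<psi> \<circ> \<mu>) (x \<oplus>\<^bsub>form_ring f\<^esub> y) = (\<psi> \<circ> \<mu>) x \<oplus> (\<psi> \<circ> \<mu>) y"
      using \<mu>(2) \<psi>a by (simp only: form_ring_simps zadditive_def o_apply)
    show "(\<psi> \<circ> \<mu>) \<one>\<^bsub>form_ring f\<^esub> = \<one>" by (simp add: \<mu>(3) \<psi>\<eta>)
  qed
  moreover have "bij_betw (\<psi> \<circ> \<mu>) (carrier (form_ring f)) (carrier R)"
    unfolding form_ring_simps by (rule bij_betw_trans[OF \<mu>(1) \<psi>b])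
  ultimately have "\<psi> \<circ> \<mu> \<in> ring_iso (form_ring f) R" by (simp add: ring_iso_def)
  then show ?thesis by blast
qed

lemma ring_iso_form_ring_iff:
  "k \<in> ring_iso (form_ring f) (form_ring g) \<longleftrightarrow>
     bij k \<and> zadditive k \<and> k (1, 0, 0) = (1, 0, 0) \<and> (\<forall>x y. k (fmul f x y) = fmul g (k x) (k y))"
  unfolding ring_iso_def ring_hom_def zadditive_def form_ring_simps by blast

text \<open>The matrix of the map on the quotient by the multiples of 1: its rows are the images of
  \<omega> and \<theta>.\<close>

definition iso_mat :: "(int3 \<Rightarrow> int3) \<Rightarrow> mat2" where
  "iso_mat k = (fst (snd (k (0, 1, 0))), snd (snd (k (0, 1, 0))), fst (snd (k (0, 0, 1))), snd (snd (k (0, 0, 1))))"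

definition shear_mat :: "int \<Rightarrow> int \<Rightarrow> mat2 \<Rightarrow> int3 \<Rightarrow> int3" where
  "shear_mat n1 n2 M x = (case M of (\<alpha>, \<beta>, \<gamma>, \<delta>) \<Rightarrow> case x of (n, u, v) \<Rightarrow>
     (n + u * n1 + v * n2, u * \<alpha> + v * \<gamma>, u * \<beta> + v * \<delta>))"

lemma zadditive_shear_mat:
  assumes "zadditive k" "k (1, 0, 0) = (1, 0, 0)"
  shows "\<exists>n1 n2. k = shear_mat n1 n2 (iso_mat k)"
proof -
  obtain n1 \<alpha> \<beta> where w: "k (0, 1, 0) = (n1, \<alpha>, \<beta>)" by (cases "k (0, 1, 0)")
  obtain n2 \<gamma> \<delta> where t: "k (0, 0, 1) = (n2, \<gamma>, \<delta>)" by (cases "k (0, 0, 1)")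
  have "k x = shear_mat n1 n2 (iso_mat k) x" for x
  proof (cases x)
    case (fields n u v)
    then show ?thesis
      using zadditive_expand[OF assms(1), of n u v] by (simp add: assms(2) w t iso_mat_def shear_mat_def)
  qed
  then show ?thesis by blast
qed

lemma bij_shear_mat:
  assumes "M \<in> carrier GL2" shows "bij (shear_mat n1 n2 M)"
proof -
  obtain \<alpha> \<beta> \<gamma> \<delta> where M: "M = (\<alpha>, \<beta>, \<gamma>, \<delta>)" by (cases M)
  define e where "e = \<alpha> * \<delta> - \<beta> * \<gamma>"
  have "e * e = 1" using mdet_sq[of M] assms by (simp add: mem_GL2 M e_def)
  let ?h = "\<lambda>(n, p, q). let u = e * \<delta> * p - e * \<gamma> * q; v = e * \<alpha> * q - e * \<beta> * p in (n - u * n1 - v * n2, u, v)"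
  have 1: "e * \<delta> * (u * \<alpha> + v * \<gamma>) - e * \<gamma> * (u * \<beta> + v * \<delta>) = u"
    "e * \<alpha> * (u * \<beta> + v * \<delta>) - e * \<beta> * (u * \<alpha> + v * \<gamma>) = v"
    "(e * \<delta> * u - e * \<gamma> * v) * \<alpha> + (e * \<alpha> * v - e * \<beta> * u) * \<gamma> = u"
    "(e * \<delta> * u - e * \<gamma> * v) * \<beta> + (e * \<alpha> * v - e * \<beta> * u) * \<delta> = v" for u v
  proof -
    have "e * \<delta> * (u * \<alpha> + v * \<gamma>) - e * \<gamma> * (u * \<beta> + v * \<delta>) = u * (e * e)"
      "e * \<alpha> * (u * \<beta> + v * \<delta>) - e * \<beta> * (u * \<alpha> + v * \<gamma>) = v * (e * e)"
      "(e * \<delta> * u - e * \<gamma> * v) * \<alpha> + (e * \<alpha> * v - e * \<beta> * u) * \<gamma> = u * (e * e)"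
      "(e * \<delta> * u - e * \<gamma> * v) * \<beta> + (e * \<alpha> * v - e * \<beta> * u) * \<delta> = v * (e * e)"
      by (simp_all add: e_def algebra_simps)
    then show "e * \<delta> * (u * \<alpha> + v * \<gamma>) - e * \<gamma> * (u * \<beta> + v * \<delta>) = u"
      "e * \<alpha> * (u * \<beta> + v * \<delta>) - e * \<beta> * (u * \<alpha> + v * \<gamma>) = v"
      "(e * \<delta> * u - e * \<gamma> * v) * \<alpha> + (e * \<alpha> * v - e * \<beta> * u) * \<gamma> = u"
      "(e * \<delta> * u - e * \<gamma> * v) * \<beta> + (e * \<alpha> * v - e * \<beta> * u) * \<delta> = v"
      using \<open>e * e = 1\<close> by simp_all
  qed
  show ?thesis
    by (rule bij_betw_byWitness[where f' = ?h])
      (simp_all add: split_paired_All shear_mat_def M Let_def 1)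
qed

text \<open>The form is recovered as the index form: \<open>1 \<and> x \<and> x\<^sup>2 = -f(u, v)\<close> for \<open>x = n + u\<omega> + v\<theta>\<close>.\<close>

lemma form_val_index: "fmul f (n, u, v) (n, u, v) = (m, p, q) \<Longrightarrow> u * q - v * p = - form_val f u v"
proof -
  assume sq: "fmul f (n, u, v) (n, u, v) = (m, p, q)"
  obtain a b c d where f: "f = (a, b, c, d)" by (cases f)
  have pq: "p = n * u + u * n + b * u * u + d * v * v" "q = n * v + v * n - a * u * u - c * v * v"
    using sq by (simp_all add: f)
  show ?thesis unfolding pq f by (simp add: algebra_simps power2_eq_square power3_eq_cube)
qed

text \<open>An isomorphism preserves 1 \<and> x \<and> x^2 up to its determinant on the quotient by
  the multiples of 1. Comparing the two index forms gives the relation, and the determinant is a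
  unit because \<omega> and \<theta> have preimages.\<close>

lemma iso_mat_mact:
  assumes k: "k \<in> ring_iso (form_ring f) (form_ring g)"
  shows "iso_mat k \<in> carrier GL2" "mact (iso_mat k) g = f"
proof -
  have bij: "bij k" and add: "zadditive k" and one: "k (1, 0, 0) = (1, 0, 0)"
    and mul: "\<And>x y. k (fmul f x y) = fmul g (k x) (k y)"
    using k by (auto simp: ring_iso_form_ring_iff)
  obtain n1 n2 where kM: "k = shear_mat n1 n2 (iso_mat k)" using zadditive_shear_mat[OF add one] by blast
  obtain \<alpha> \<beta> \<gamma> \<delta> where M: "iso_mat k = (\<alpha>, \<beta>, \<gamma>, \<delta>)" by (cases "iso_mat k")
  have kx: "k (n, u, v) = (n + u * n1 + v * n2, u * \<alpha> + v * \<gamma>, u * \<beta> + v * \<delta>)" for n u v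
    using fun_cong[OF kM, of "(n, u, v)"] by (simp add: shear_mat_def M)
  obtain n u v where x: "k (n, u, v) = (0, 1, 0)" using bij by (metis bij_pointE prod_cases3)
  obtain n' u' v' where y: "k (n', u', v') = (0, 0, 1)" using bij by (metis bij_pointE prod_cases3)
  have "(u * v' - v * u') * (\<alpha> * \<delta> - \<beta> * \<gamma>) =
      (u * \<alpha> + v * \<gamma>) * (u' * \<beta> + v' * \<delta>) - (u * \<beta> + v * \<delta>) * (u' * \<alpha> + v' * \<gamma>)"
    by (simp add: algebra_simps)
  also have "\<dots> = 1" using x y by (simp add: kx)
  finally have "\<bar>\<alpha> * \<delta> - \<beta> * \<gamma>\<bar> = 1" by (metis abs_zmult_eq_1 mult.commute abs_one)
  then show G: "iso_mat k \<in> carrier GL2" by (simp add: mem_GL2 M)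
  have e: "(\<alpha> * \<delta> - \<beta> * \<gamma>) * (\<alpha> * \<delta> - \<beta> * \<gamma>) = 1" using mdet_sq[of "iso_mat k"] G by (simp add: mem_GL2 M)
  show "mact (iso_mat k) g = f"
  proof (rule form_eqI)
    fix u v
    obtain m p q where sq: "fmul f (0, u, v) (0, u, v) = (m, p, q)" by (cases "fmul f (0, u, v) (0, u, v)")
    have "fmul g (k (0, u, v)) (k (0, u, v)) = k (m, p, q)" using mul sq by metis
    from form_val_index[OF this[unfolded kx]]
    have "(u * \<alpha> + v * \<gamma>) * (p * \<beta> + q * \<delta>) - (u * \<beta> + v * \<delta>) * (p * \<alpha> + q * \<gamma>)
        = - form_val g (u * \<alpha> + v * \<gamma>) (u * \<beta> + v * \<delta>)" .
    moreover have "(u * \<alpha> + v * \<gamma>) * (p * \<beta> + q * \<delta>) - (u * \<beta> + v * \<delta>) * (p * \<alpha> + q * \<gamma>)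
        = (\<alpha> * \<delta> - \<beta> * \<gamma>) * (u * q - v * p)"
      by (simp add: algebra_simps)
    ultimately have "form_val g (u * \<alpha> + v * \<gamma>) (u * \<beta> + v * \<delta>) = (\<alpha> * \<delta> - \<beta> * \<gamma>) * form_val f u v"
      using form_val_index[OF sq] by simp
    then have "form_val (mact (iso_mat k) g) u v = ((\<alpha> * \<delta> - \<beta> * \<gamma>) * (\<alpha> * \<delta> - \<beta> * \<gamma>)) * form_val f u v"
      by (simp only: M form_val_mact mult.assoc)
    then show "form_val (mact (iso_mat k) g) u v = form_val f u v" by (simp only: e mult_1)
  qed
qed

text \<open>The integer parts n1, n2 of the images of \<omega> and \<theta> are determined by the
  matrix: the product of the images must be an integer, which is a linear system with a unit as
  determinant. Existence makes \<open>iso_mat\<close> surjective, uniqueness makes it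
  injective.\<close>

lemma shear_solution:
  fixes S T n1 n2 :: int
  assumes e: "(\<alpha> * \<delta> - \<beta> * \<gamma>) * (\<alpha> * \<delta> - \<beta> * \<gamma>) = 1"
  shows "n1 * \<gamma> + n2 * \<alpha> = - S \<and> n1 * \<delta> + n2 * \<beta> = T \<longleftrightarrow>
    n1 = (\<alpha> * \<delta> - \<beta> * \<gamma>) * (S * \<beta> + T * \<alpha>) \<and> n2 = - (\<alpha> * \<delta> - \<beta> * \<gamma>) * (S * \<delta> + T * \<gamma>)"
    (is "?l \<longleftrightarrow> ?r")
proof
  let ?e = "\<alpha> * \<delta> - \<beta> * \<gamma>"
  assume l: ?l
  have "?e * n1 = \<alpha> * (n1 * \<delta> + n2 * \<beta>) - \<beta> * (n1 * \<gamma> + n2 * \<alpha>)"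
    "?e * n2 = \<delta> * (n1 * \<gamma> + n2 * \<alpha>) - \<gamma> * (n1 * \<delta> + n2 * \<beta>)"
    by (simp_all add: algebra_simps)
  then have n: "?e * n1 = S * \<beta> + T * \<alpha>" "?e * n2 = - (S * \<delta> + T * \<gamma>)"
    unfolding l[THEN conjunct1] l[THEN conjunct2] by (simp_all add: algebra_simps)
  have "n1 = ?e * (?e * n1)" "n2 = ?e * (?e * n2)" unfolding mult.assoc[symmetric] e by simp_all
  then show ?r unfolding n by (simp add: algebra_simps)
next
  let ?e = "\<alpha> * \<delta> - \<beta> * \<gamma>"
  assume r: ?r
  have "(?e * (S * \<beta> + T * \<alpha>)) * \<gamma> + (- ?e * (S * \<delta> + T * \<gamma>)) * \<alpha> = - S * (?e * ?e)"
    "(?e * (S * \<beta> + T * \<alpha>)) * \<delta> + (- ?e * (S * \<delta> + T * \<gamma>)) * \<beta> = T * (?e * ?e)"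
    by (simp_all add: algebra_simps)
  then show ?l using r by (simp only: e mult_1_right)
qed

lemma fmul_basis_images:
  assumes "g = (a, b, c, d)"
  shows "snd (fmul g (n1, \<alpha>, \<beta>) (n2, \<gamma>, \<delta>)) = (0, 0) \<longleftrightarrow>
    n1 * \<gamma> + n2 * \<alpha> = - (b * \<alpha> * \<gamma> + d * \<beta> * \<delta>) \<and> n1 * \<delta> + n2 * \<beta> = a * \<alpha> * \<gamma> + c * \<beta> * \<delta>"
  by (auto simp: assms algebra_simps)

lemma inj_iso_mat: "inj_on iso_mat (ring_iso (form_ring f) (form_ring g))"
proof (rule inj_onI)
  fix k l assume k: "k \<in> ring_iso (form_ring f) (form_ring g)" and l: "l \<in> ring_iso (form_ring f) (form_ring g)"
    and eq: "iso_mat k = iso_mat l"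
  obtain \<alpha> \<beta> \<gamma> \<delta> where M: "iso_mat k = (\<alpha>, \<beta>, \<gamma>, \<delta>)" by (cases "iso_mat k")
  obtain a b c d where g: "g = (a, b, c, d)" by (cases g)
  obtain a' b' c' d' where f: "f = (a', b', c', d')" by (cases f)
  have e: "(\<alpha> * \<delta> - \<beta> * \<gamma>) * (\<alpha> * \<delta> - \<beta> * \<gamma>) = 1"
    using mdet_sq[of "iso_mat k"] iso_mat_mact(1)[OF k] by (simp add: mem_GL2 M)
  have sol: "\<exists>n1 n2. j = shear_mat n1 n2 (iso_mat k) \<and>
      n1 * \<gamma> + n2 * \<alpha> = - (b * \<alpha> * \<gamma> + d * \<beta> * \<delta>) \<and> n1 * \<delta> + n2 * \<beta> = a * \<alpha> * \<gamma> + c * \<beta> * \<delta>"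
    if j: "j \<in> ring_iso (form_ring f) (form_ring g)" "iso_mat j = iso_mat k" for j
  proof -
    have add: "zadditive j" and one: "j (1, 0, 0) = (1, 0, 0)"
      and jm: "j (fmul f (0, 1, 0) (0, 0, 1)) = fmul g (j (0, 1, 0)) (j (0, 0, 1))"
      using j(1) unfolding ring_iso_form_ring_iff by blast+
    obtain n1 n2 where jM: "j = shear_mat n1 n2 (iso_mat k)"
      using zadditive_shear_mat[OF add one] unfolding j(2) by blast
    have "snd (fmul g (n1, \<alpha>, \<beta>) (n2, \<gamma>, \<delta>)) = (0, 0)"
    proof -
      have "fmul g (n1, \<alpha>, \<beta>) (n2, \<gamma>, \<delta>) = (- (a' * d'), 0, 0)"
        using jm unfolding jM M by (simp add: shear_mat_def f)
      then show ?thesis by simp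
    qed
    then show ?thesis using jM fmul_basis_images[OF g] by blast
  qed
  from sol[OF k refl] sol[OF l eq[symmetric]] show "k = l" using shear_solution[OF e] by metis
qed

text \<open>No multiplication table has to be compared. With n1 and n2 chosen so that the images of
  \<omega> and \<theta> have an integral product, the multiplication pulled back along
  \<open>k\<close> is that of some form f', and \<open>iso_mat_mact\<close> identifies f' as
  f.\<close>

lemma iso_mat_surj:
  assumes M: "M \<in> carrier GL2" and f: "mact M g = f"
  shows "\<exists>k \<in> ring_iso (form_ring f) (form_ring g). iso_mat k = M"
proof -
  obtain \<alpha> \<beta> \<gamma> \<delta> where Md: "M = (\<alpha>, \<beta>, \<gamma>, \<delta>)" by (cases M)
  obtain a b c d where g: "g = (a, b, c, d)" by (cases g)
  have e: "(\<alpha> * \<delta> - \<beta> * \<gamma>) * (\<alpha> * \<delta> - \<beta> * \<gamma>) = 1" using mdet_sq[of M] M by (simp add: mem_GL2 Md)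
  obtain n1 n2 where n: "snd (fmul g (n1, \<alpha>, \<beta>) (n2, \<gamma>, \<delta>)) = (0, 0)"
    using fmul_basis_images[OF g] shear_solution[OF e] by metis
  define k where "k = shear_mat n1 n2 M"
  have bij: "bij k" unfolding k_def by (rule bij_shear_mat[OF M])
  have add: "zadditive k" by (simp add: zadditive_def k_def shear_mat_def Md algebra_simps split: prod.splits)
  have one: "k (1, 0, 0) = (1, 0, 0)" by (simp add: k_def shear_mat_def Md)
  have kM: "iso_mat k = M" by (simp add: k_def shear_mat_def iso_mat_def Md)
  define mul where "mul = (\<lambda>x y. inv_into UNIV k (fmul g (k x) (k y)))"
  have m: "unital_mul mul (1, 0, 0)" unfolding mul_def by (rule unital_mul_transport[OF unital_mul_fmul bij add one])
  have kinv: "k (inv_into UNIV k x) = x" for x using bij by (simp add: bij_is_surj surj_f_inv_f)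
  obtain n' where n': "fmul g (n1, \<alpha>, \<beta>) (n2, \<gamma>, \<delta>) = (n', 0, 0)" using n by (metis prod.collapse)
  have "mul (0, 1, 0) (0, 0, 1) = inv_into UNIV k (n', 0, 0)"
    using n' by (simp add: mul_def k_def shear_mat_def Md)
  also have "\<dots> = (n', 0, 0)"
    by (rule inv_f_eq[OF bij_is_inj[OF bij]]) (simp add: k_def shear_mat_def Md)
  finally obtain f' where f': "mul = fmul f'" using unital_mul_eq_fmul[OF m] by blast
  have "k \<in> ring_iso (form_ring f') (form_ring g)"
    unfolding ring_iso_form_ring_iff f'[symmetric] using bij add one kinv by (simp add: mul_def)
  moreover from iso_mat_mact(2)[OF this] have "f' = f" using f kM by simp
  ultimately show ?thesis using kM by blast
qed

lemma iso_mat_bij: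
  "bij_betw iso_mat (ring_iso (form_ring f) (form_ring g)) {M \<in> carrier GL2. mact M g = f}"
  unfolding bij_betw_def
proof (intro conjI inj_iso_mat equalityI subsetI)
  fix M assume "M \<in> iso_mat ` ring_iso (form_ring f) (form_ring g)"
  then obtain k where "k \<in> ring_iso (form_ring f) (form_ring g)" "M = iso_mat k" by (rule imageE)
  then show "M \<in> {M \<in> carrier GL2. mact M g = f}" using iso_mat_mact by simp
next
  fix M assume "M \<in> {M \<in> carrier GL2. mact M g = f}"
  then obtain k where "k \<in> ring_iso (form_ring f) (form_ring g)" "iso_mat k = M"
    using iso_mat_surj by blast
  then show "M \<in> iso_mat ` ring_iso (form_ring f) (form_ring g)" by (intro image_eqI[of _ _ k]) simp_all
qed

lemma form_ring_iso_iff: "form_ring f \<simeq> form_ring g \<longleftrightarrow> f \<in> forms.orb (carrier GL2) g"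
proof -
  have "form_ring f \<simeq> form_ring g \<longleftrightarrow> {M \<in> carrier GL2. mact M g = f} \<noteq> {}"
    using iso_mat_bij[of f g] unfolding is_ring_iso_def bij_betw_def by (metis image_is_empty)
  also have "\<dots> \<longleftrightarrow> f \<in> forms.orb (carrier GL2) g"
    unfolding forms.orb_def image_iff by blast
  finally show ?thesis .
qed

lemma card_ring_aut_form_ring: "card (ring_aut (form_ring f)) = card (forms.stab (carrier GL2) f)"
proof -
  \<comment> \<open>\<open>Bij\<close> asks for extensional maps, a void condition here because the
    carrier is the whole type.\<close>
  have "ring_aut (form_ring f) = ring_iso (form_ring f) (form_ring f)"
    unfolding ring_aut_def ring_iso_def Bij_def by (auto simp: extensional_def)
  then show ?thesis using bij_betw_same_card[OF iso_mat_bij[of f f]] by (simp add: forms.stab_def)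
qed

section \<open>Trace and discriminant\<close>


context cring
begin

definition additive_functional :: "('a \<Rightarrow> int) \<Rightarrow> bool" where
  "additive_functional F \<longleftrightarrow> (\<forall>x\<in>carrier R. \<forall>y\<in>carrier R. F (x \<oplus> y) = F x + F y)"

lemma additive_functional_add_pow:
  assumes F: "additive_functional F" and x: "x \<in> carrier R"
  shows "F ([k] \<cdot> x) = (k::int) * F x"
proof -
  have add: "F (x \<oplus> y) = F x + F y" if "x \<in> carrier R" "y \<in> carrier R" for x y
    using F that by (simp add: additive_functional_def)
  have zero: "F \<zero> = 0" using add[of \<zero> \<zero>] by simp
  have step: "[(i + j)] \<cdot> x = [i] \<cdot> x \<oplus> [j] \<cdot> x" for i j :: int by (rule add.int_pow_mult[OF x])
  have mem: "[i] \<cdot> x \<in> carrier R" for i :: int by (rule add.int_pow_closed[OF x])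
  have one: "[(1::int)] \<cdot> x = x" by (rule add.int_pow_1[OF x])
  have zeros: "[(0::int)] \<cdot> x = \<zero>" by (simp add: add_pow_def)
  have m1: "F ([(- 1 :: int)] \<cdot> x) = - F x"
    using step[of 1 "- 1"] add[OF mem mem, of 1 "- 1"] one zero zeros by simp
  show ?thesis
  proof (induction k rule: int_induct[where k = 0])
    case base
    then show ?case using zeros zero by simp
  next
    case (step1 i)
    then show ?case using step[of i 1] add[OF mem mem, of i 1] one by (simp add: algebra_simps)
  next
    case (step2 i)
    then show ?case using step[of i "- 1"] add[OF mem mem, of i "- 1"] m1 by (simp add: algebra_simps)
  qed
qed

lemma lin_comb_3:
  assumes "range b \<subseteq> carrier R"
  shows "lin_comb R b n = [(n $ 1)] \<cdot> b 1 \<oplus> ([(n $ 2)] \<cdot> b 2 \<oplus> [(n $ 3)] \<cdot> b 3)"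
proof -
  have mem: "[(n $ i)] \<cdot> b i \<in> carrier R" for i by (rule add.int_pow_closed) (use assms in auto)
  show ?thesis unfolding lin_comb_def UNIV_3 using mem by (simp add: finsum_insert Pi_def)
qed

lemma lin_comb_closed: "range b \<subseteq> carrier R \<Longrightarrow> lin_comb R b n \<in> carrier R"
  unfolding lin_comb_def by (rule finsum_closed) (auto intro!: add.int_pow_closed)

lemma lin_comb_add:
  assumes b: "range b \<subseteq> carrier R"
  shows "lin_comb R b (m + n) = lin_comb R b m \<oplus> lin_comb R b n"
proof -
  have mem: "[k] \<cdot> b i \<in> carrier R" for k :: int and i by (rule add.int_pow_closed) (use b in auto)
  have "[((m + n) $ i)] \<cdot> b i = [(m $ i)] \<cdot> b i \<oplus> [(n $ i)] \<cdot> b i" for i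
    using add.int_pow_mult[of "b i" "m $ i" "n $ i"] b by auto
  then have "lin_comb R b (m + n) = (\<Oplus>i\<in>UNIV. [(m $ i)] \<cdot> b i \<oplus> [(n $ i)] \<cdot> b i)"
    unfolding lin_comb_def by simp
  also have "\<dots> = lin_comb R b m \<oplus> lin_comb R b n"
    unfolding lin_comb_def by (rule finsum_addf) (use mem in auto)
  finally show ?thesis .
qed

lemma additive_functional_lin_comb:
  assumes F: "additive_functional F" and b: "range b \<subseteq> carrier R"
  shows "F (lin_comb R b n) = (\<Sum>j\<in>UNIV. n $ j * F (b j))"
proof -
  have bi: "b i \<in> carrier R" for i using b by auto
  have mem: "[(n $ i)] \<cdot> b i \<in> carrier R" for i by (rule add.int_pow_closed[OF bi])
  show ?thesis
    using F mem unfolding lin_comb_3[OF b] sum_3 additive_functional_def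
    by (simp add: additive_functional_add_pow[OF F bi])
qed

context
  fixes b assumes b: "is_zbasis R b"
begin

lemma zbasis_range: "range b \<subseteq> carrier R"
  using b by (simp add: is_zbasis_def)

lemma zbasis_mem: "b i \<in> carrier R"
  using zbasis_range by auto

lemma lin_comb_coords: "x \<in> carrier R \<Longrightarrow> lin_comb R b (coords R b x) = x"
  using b theI'[of "\<lambda>n. x = lin_comb R b n"] by (simp add: is_zbasis_def coords_def)

lemma coords_lin_comb: "coords R b (lin_comb R b n) = n"
proof -
  have "\<exists>!m. lin_comb R b n = lin_comb R b m"
    using b lin_comb_closed[OF zbasis_range] by (simp add: is_zbasis_def)
  then show ?thesis unfolding coords_def by (rule the1_equality) simp
qed

lemma coords_add:
  assumes "x \<in> carrier R" "y \<in> carrier R"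
  shows "coords R b (x \<oplus> y) = coords R b x + coords R b y"
proof -
  have "x \<oplus> y = lin_comb R b (coords R b x + coords R b y)"
    using assms by (simp add: lin_comb_add[OF zbasis_range] lin_comb_coords)
  then show ?thesis using coords_lin_comb by simp
qed

text \<open>With F the identity this is the change of basis, with F the multiplication by an element
  it is the matrix whose trace is taken.\<close>

lemma coords_matrix:
  assumes F: "\<And>x y. x \<in> carrier R \<Longrightarrow> y \<in> carrier R \<Longrightarrow> F (x \<oplus> y) = F x \<oplus> F y"
    and FR: "\<And>x. x \<in> carrier R \<Longrightarrow> F x \<in> carrier R" and c: "range c \<subseteq> carrier R"
  shows "coords R b (F (lin_comb R c n)) = (\<chi> i j. coords R b (F (c j)) $ i) *v n"
proof (rule vec_eq_iff[THEN iffD2], rule allI)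
  fix i
  have "additive_functional (\<lambda>x. coords R b (F x) $ i)"
    unfolding additive_functional_def using F FR coords_add by simp
  from additive_functional_lin_comb[OF this c]
  show "coords R b (F (lin_comb R c n)) $ i = ((\<chi> i j. coords R b (F (c j)) $ i) *v n) $ i"
    by (simp add: matrix_vector_mult_def mult.commute)
qed

end

lemma transition_inverse:
  assumes b: "is_zbasis R b" and c: "is_zbasis R c"
  shows "(\<chi> i j. coords R b (c j) $ i) ** (\<chi> i j. coords R c (b j) $ i) = mat 1"
proof (rule matrix_eq[THEN iffD2], rule allI)
  fix n
  note id = coords_matrix[where F = "\<lambda>x. x"]
  have "coords R b (lin_comb R c (coords R c (lin_comb R b n))) = n"
    by (simp add: lin_comb_coords[OF c] lin_comb_closed[OF zbasis_range[OF b]] coords_lin_comb[OF b])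
  then show "((\<chi> i j. coords R b (c j) $ i) ** (\<chi> i j. coords R c (b j) $ i)) *v n = mat 1 *v n"
    by (simp add: id[OF b _ _ zbasis_range[OF c]] id[OF c _ _ zbasis_range[OF b]] matrix_vector_mul_assoc)
qed

lemma trace_basis_independent:
  assumes b: "is_zbasis R b" and c: "is_zbasis R c" and x: "x \<in> carrier R"
  shows "trace (\<chi> i j. coords R b (x \<otimes> b j) $ i) = trace (\<chi> i j. coords R c (x \<otimes> c j) $ i)"
proof -
  let ?P = "\<chi> i j. coords R b (c j) $ i" and ?Q = "\<chi> i j. coords R c (b j) $ i"
  let ?A = "\<chi> i j. coords R b (x \<otimes> b j) $ i" and ?B = "\<chi> i j. coords R c (x \<otimes> c j) $ i"
  note id = coords_matrix[where F = "\<lambda>x. x"]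
  note mul = coords_matrix[where F = "\<lambda>y. x \<otimes> y"]
  note lc = lin_comb_coords lin_comb_closed zbasis_range
  have "?B = ?Q ** (?A ** ?P)"
  proof (rule matrix_eq[THEN iffD2], rule allI)
    fix n
    have "?B *v n = coords R c (x \<otimes> lin_comb R c n)"
      by (rule mul[OF c, symmetric]) (use x zbasis_range[OF c] in \<open>auto simp: r_distr\<close>)
    also have "x \<otimes> lin_comb R c n = lin_comb R b (coords R b (x \<otimes> lin_comb R b (coords R b (lin_comb R c n))))"
      using x by (simp add: lc b c)
    also have "coords R b (x \<otimes> lin_comb R b (coords R b (lin_comb R c n))) = ?A *v (?P *v n)"
      by (subst mul[OF b]) (use x zbasis_range[OF b] zbasis_range[OF c] in \<open>auto simp: r_distr id[OF b]\<close>)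
    also have "coords R c (lin_comb R b (?A *v (?P *v n))) = ?Q *v (?A *v (?P *v n))"
      by (rule id[OF c]) (use zbasis_range[OF b] in auto)
    finally show "?B *v n = (?Q ** (?A ** ?P)) *v n" by (simp add: matrix_vector_mul_assoc)
  qed
  then have "trace ?B = trace ((?A ** ?P) ** ?Q)" by (simp only: trace_mul_sym[of ?Q])
  also have "\<dots> = trace ?A" by (simp only: matrix_mul_assoc[symmetric] transition_inverse[OF b c] matrix_mul_rid)
  finally show ?thesis by simp
qed

lemma ring_trace_eq:
  assumes b: "is_zbasis R b" and x: "x \<in> carrier R"
  shows "ring_trace R x = trace (\<chi> i j. coords R b (x \<otimes> b j) $ i)"
  unfolding ring_trace_def Let_def
  by (rule trace_basis_independent[OF someI[of "is_zbasis R", OF b] b x])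

lemma ring_trace_additive:
  assumes b: "is_zbasis R b" shows "additive_functional (ring_trace R)"
  unfolding additive_functional_def
  using zbasis_mem[OF b]
  by (simp add: ring_trace_eq[OF b] l_distr coords_add[OF b] trace_def sum.distrib)

lemma gram_basis_change:
  assumes b: "is_zbasis R b" and c: "is_zbasis R c"
  shows "(\<chi> i j. ring_trace R (c i \<otimes> c j)) =
    transpose (\<chi> i j. coords R b (c j) $ i) ** (\<chi> i j. ring_trace R (b i \<otimes> b j)) ** (\<chi> i j. coords R b (c j) $ i)"
proof -
  let ?P = "\<chi> i j. coords R b (c j) $ i"
  have add: "additive_functional (\<lambda>y. ring_trace R (x \<otimes> y))" "additive_functional (\<lambda>y. ring_trace R (y \<otimes> x))"
    if "x \<in> carrier R" for x
    using ring_trace_additive[OF b] that by (auto simp: additive_functional_def r_distr l_distr)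
  define p where "p = (\<lambda>i j. coords R b (c j) $ i)"
  have cp: "lin_comb R b (\<chi> l. p l j) = c j" for j
  proof -
    have "(\<chi> l. p l j) = coords R b (c j)" by (simp add: vec_eq_iff p_def)
    then show ?thesis using lin_comb_coords[OF b zbasis_mem[OF c]] by simp
  qed
  have "ring_trace R (c i \<otimes> c j) = (\<Sum>l\<in>UNIV. (\<Sum>k\<in>UNIV. p k i * ring_trace R (b k \<otimes> b l)) * p l j)" for i j
  proof -
    have "ring_trace R (c i \<otimes> c j) = (\<Sum>l\<in>UNIV. p l j * ring_trace R (c i \<otimes> b l))"
      using additive_functional_lin_comb[OF add(1)[OF zbasis_mem[OF c, of i]] zbasis_range[OF b], of "\<chi> l. p l j"]
      by (simp add: cp)
    also have "\<dots> = (\<Sum>l\<in>UNIV. p l j * (\<Sum>k\<in>UNIV. p k i * ring_trace R (b k \<otimes> b l)))"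
    proof (rule sum.cong[OF refl])
      fix l
      show "p l j * ring_trace R (c i \<otimes> b l) = p l j * (\<Sum>k\<in>UNIV. p k i * ring_trace R (b k \<otimes> b l))"
        using additive_functional_lin_comb[OF add(2)[OF zbasis_mem[OF b, of l]] zbasis_range[OF b], of "\<chi> k. p k i"]
        by (simp add: cp)
    qed
    finally show ?thesis by (simp add: mult.commute)
  qed
  then show ?thesis by (simp add: vec_eq_iff matrix_matrix_mult_def transpose_def p_def)
qed

lemma cubic_disc_eq:
  assumes b: "is_zbasis R b"
  shows "cubic_disc R = det (\<chi> i j. ring_trace R (b i \<otimes> b j))"
proof -
  have c: "is_zbasis R (SOME b. is_zbasis R b)" by (rule someI[of "is_zbasis R", OF b])
  let ?c = "SOME b. is_zbasis R b"
  let ?P = "\<chi> i j. coords R b (?c j) $ i" and ?Q = "\<chi> i j. coords R ?c (b j) $ i"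
  have "det ?P * det ?Q = 1" using transition_inverse[OF b c] by (metis det_mul det_I)
  then have P: "det ?P * det ?P = 1" by (metis abs_mult_self_eq abs_zmult_eq_1 abs_one mult_1)
  have "cubic_disc R = det (\<chi> i j. ring_trace R (?c i \<otimes> ?c j))" by (simp add: cubic_disc_def Let_def)
  also have "\<dots> = det ?P * det ?P * det (\<chi> i j. ring_trace R (b i \<otimes> b j))"
    unfolding gram_basis_change[OF b c] det_mul det_transpose by simp
  finally show ?thesis using P by simp
qed

end

section \<open>Trace and discriminant of the ring of a form\<close>

definition vec_of :: "int3 \<Rightarrow> int ^ 3" where
  "vec_of x = (\<chi> i. if i = 1 then fst x else if i = 2 then fst (snd x) else snd (snd x))"

lemma vec_of_nth [simp]: "vec_of (n, u, v) $ 1 = n" "vec_of (n, u, v) $ 2 = u" "vec_of (n, u, v) $ 3 = v"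
  by (simp_all add: vec_of_def)

definition std_basis :: "3 \<Rightarrow> int3" where
  "std_basis i = (if i = 1 then (1, 0, 0) else if i = 2 then (0, 1, 0) else (0, 0, 1))"

lemma std_basis_simps [simp]: "std_basis 1 = (1, 0, 0)" "std_basis 2 = (0, 1, 0)" "std_basis 3 = (0, 0, 1)"
  by (simp_all add: std_basis_def)

lemma form_ring_isoD:
  fixes R :: "('a, 'm) ring_scheme" (structure)
  assumes "\<psi> \<in> ring_iso (form_ring f) R"
  shows "\<psi> x \<in> carrier R" "\<psi> (fmul f x y) = \<psi> x \<otimes> \<psi> y" "\<psi> (x + y) = \<psi> x \<oplus> \<psi> y"
    "\<psi> (1, 0, 0) = \<one>" "bij_betw \<psi> UNIV (carrier R)"
  using ring_iso_memE[OF assms] unfolding form_ring_simps by blast+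

lemma iso_zbasis:
  fixes R :: "('a, 'm) ring_scheme" (structure)
  assumes R: "cring R" and \<psi>: "\<psi> \<in> ring_iso (form_ring f) R"
  shows "is_zbasis R (\<psi> \<circ> std_basis)" "coords R (\<psi> \<circ> std_basis) (\<psi> x) = vec_of x"
proof -
  interpret cring R by fact
  have \<psi>R: "\<psi> x \<in> carrier R" and \<psi>a: "\<psi> (x + y) = \<psi> x \<oplus> \<psi> y" and bij: "bij_betw \<psi> UNIV (carrier R)" for x y
    using form_ring_isoD[OF \<psi>] by blast+
  have rng: "range (\<psi> \<circ> std_basis) \<subseteq> carrier R" unfolding image_subset_iff comp_def using \<psi>R by blast
  have inv: "inv_into UNIV \<psi> (\<psi> x) = x" "y \<in> carrier R \<Longrightarrow> \<psi> (inv_into UNIV \<psi> y) = y" for x y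
    using bij by (auto simp: bij_betw_def f_inv_into_f)
  have inva: "inv_into UNIV \<psi> (x \<oplus> y) = inv_into UNIV \<psi> x + inv_into UNIV \<psi> y"
    if "x \<in> carrier R" "y \<in> carrier R" for x y
    using that inv \<psi>a by metis
  have lc: "lin_comb R (\<psi> \<circ> std_basis) n = \<psi> (n $ 1, n $ 2, n $ 3)" for n
  proof -
    have F: "additive_functional (\<lambda>x. fst (inv_into UNIV \<psi> x))" "additive_functional (\<lambda>x. fst (snd (inv_into UNIV \<psi> x)))"
      "additive_functional (\<lambda>x. snd (snd (inv_into UNIV \<psi> x)))"
      unfolding additive_functional_def by (simp_all add: inva)
    have "inv_into UNIV \<psi> (lin_comb R (\<psi> \<circ> std_basis) n) = (n $ 1, n $ 2, n $ 3)"
      using F[THEN additive_functional_lin_comb, OF rng, of n]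
      by (simp add: sum_3 inv prod_eq_iff)
    then show ?thesis using inv(2)[OF lin_comb_closed[OF rng]] by metis
  qed
  have vec: "lin_comb R (\<psi> \<circ> std_basis) (vec_of x) = \<psi> x" for x by (cases x) (simp add: lc)
  show zb: "is_zbasis R (\<psi> \<circ> std_basis)"
    unfolding is_zbasis_def
  proof (intro conjI rng ballI)
    fix y assume y: "y \<in> carrier R"
    show "\<exists>!n. y = lin_comb R (\<psi> \<circ> std_basis) n"
    proof (rule ex1I[of _ "vec_of (inv_into UNIV \<psi> y)"])
      show "y = lin_comb R (\<psi> \<circ> std_basis) (vec_of (inv_into UNIV \<psi> y))" using vec inv(2)[OF y] by simp
      fix n assume "y = lin_comb R (\<psi> \<circ> std_basis) n"
      then have "inv_into UNIV \<psi> y = (n $ 1, n $ 2, n $ 3)" using lc inv(1) by simp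
      then show "n = vec_of (inv_into UNIV \<psi> y)" by (simp add: vec_eq_iff forall_3)
    qed
  qed
  show "coords R (\<psi> \<circ> std_basis) (\<psi> x) = vec_of x" using coords_lin_comb[OF zb, of "vec_of x"] vec by simp
qed

lemma ring_trace_iso:
  fixes R :: "('a, 'm) ring_scheme" (structure)
  assumes R: "cring R" and \<psi>: "\<psi> \<in> ring_iso (form_ring (a, b, c, d)) R"
  shows "ring_trace R (\<psi> (n, u, v)) = 3 * n + b * u - c * v"
proof -
  interpret cring R by fact
  note \<psi>R = form_ring_isoD(1)[OF \<psi>] and \<psi>m = form_ring_isoD(2)[OF \<psi>, symmetric]
  show ?thesis
    using ring_trace_eq[OF iso_zbasis(1)[OF R \<psi>] \<psi>R, of "(n, u, v)"]
    by (simp add: \<psi>m iso_zbasis(2)[OF R \<psi>] trace_def sum_3)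
qed

lemma cubic_disc_iso:
  fixes R :: "('a, 'm) ring_scheme" (structure)
  assumes R: "cring R" and \<psi>: "\<psi> \<in> ring_iso (form_ring f) R"
  shows "cubic_disc R = form_disc f"
proof -
  interpret cring R by fact
  obtain a b c d where f: "f = (a, b, c, d)" by (cases f)
  note \<psi>m = form_ring_isoD(2)[OF \<psi>[unfolded f], symmetric]
  show ?thesis
    unfolding cubic_disc_eq[OF iso_zbasis(1)[OF R \<psi>]]
    by (simp add: det_3 \<psi>m ring_trace_iso[OF R \<psi>[unfolded f]] f algebra_simps power2_eq_square power3_eq_cube)
qed

lemma zmat_iso:
  fixes R :: "('a, 'm) ring_scheme" (structure)
  assumes R: "cring R" and \<psi>: "\<psi> \<in> ring_iso (form_ring f) R"
  shows "zmat R \<longleftrightarrow> zmat_form f"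
proof -
  obtain a b c d where f: "f = (a, b, c, d)" by (cases f)
  have "carrier R = range \<psi>" using \<psi> by (auto simp: ring_iso_def bij_betw_def)
  then have "zmat R \<longleftrightarrow> (\<forall>n u v. 3 dvd 3 * n + b * u - c * v)"
    unfolding zmat_def by (simp add: ring_trace_iso[OF R \<psi>[unfolded f]] split_paired_All)
  also have "\<dots> \<longleftrightarrow> 3 dvd b \<and> 3 dvd c"
  proof
    assume "\<forall>n u v. 3 dvd 3 * n + b * u - c * v"
    from this[rule_format, of 0 1 0] this[rule_format, of 0 0 1] show "3 dvd b \<and> 3 dvd c" by simp
  qed (auto intro!: dvd_add dvd_diff)
  finally show ?thesis by (simp add: f)
qed


section \<open>From isomorphism classes of rings to orbits of forms\<close>

lemma ring_aut_eq: "ring_aut R = ring_iso R R \<inter> extensional (carrier R)"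
  unfolding ring_aut_def ring_iso_def Bij_def by blast

text \<open>The restriction makes the conjugate map \<open>undefined\<close> off the carrier, as
  membership in \<open>Bij\<close> requires.\<close>

lemma conjugate_ring_aut:
  assumes S: "ring S" and \<psi>: "\<psi> \<in> ring_iso R S" and \<phi>: "\<phi> \<in> ring_iso S R"
  shows "(\<lambda>k. restrict (\<psi> \<circ> k \<circ> \<phi>) (carrier S)) ` ring_aut R \<subseteq> ring_aut S"
proof
  fix k' assume "k' \<in> (\<lambda>k. restrict (\<psi> \<circ> k \<circ> \<phi>) (carrier S)) ` ring_aut R"
  then obtain k where k: "k \<in> ring_iso R R" and k': "k' = restrict (\<psi> \<circ> k \<circ> \<phi>) (carrier S)"
    by (auto simp: ring_aut_eq)
  have "\<psi> \<circ> k \<circ> \<phi> \<in> ring_iso S S"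
    using ring_iso_set_trans[OF \<phi> ring_iso_set_trans[OF k \<psi>]] .
  then have "k' \<in> ring_iso S S"
    by (rule ring.ring_iso_restrict[OF S]) (simp add: k')
  then show "k' \<in> ring_aut S" by (simp add: ring_aut_eq k')
qed

lemma card_ring_aut_iso:
  assumes R: "ring R" and S: "ring S" and \<psi>: "\<psi> \<in> ring_iso R S"
  shows "card (ring_aut S) = card (ring_aut R)"
proof -
  define \<phi> where "\<phi> = inv_into (carrier R) \<psi>"
  have \<phi>: "\<phi> \<in> ring_iso S R" unfolding \<phi>_def by (rule ring_iso_set_sym[OF R \<psi>])
  have inv: "\<And>x. x \<in> carrier R \<Longrightarrow> \<phi> (\<psi> x) = x" "\<And>y. y \<in> carrier S \<Longrightarrow> \<psi> (\<phi> y) = y"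
    using \<psi> by (auto simp: \<phi>_def ring_iso_def bij_betw_def f_inv_into_f)
  note cl = ring_iso_memE(1)[OF \<psi>] ring_iso_memE(1)[OF \<phi>]
  let ?F = "\<lambda>k. restrict (\<psi> \<circ> k \<circ> \<phi>) (carrier S)" and ?H = "\<lambda>k. restrict (\<phi> \<circ> k \<circ> \<psi>) (carrier R)"
  have k: "k x \<in> carrier R" if "k \<in> ring_aut R" "x \<in> carrier R" for k x
    using that ring_iso_memE(1) by (auto simp: ring_aut_eq)
  have l: "k x \<in> carrier S" if "k \<in> ring_aut S" "x \<in> carrier S" for k x
    using that ring_iso_memE(1) by (auto simp: ring_aut_eq)
  have "bij_betw ?F (ring_aut R) (ring_aut S)"
  proof (rule bij_betw_byWitness[where f' = ?H])
    show "?F ` ring_aut R \<subseteq> ring_aut S" by (rule conjugate_ring_aut[OF S \<psi> \<phi>])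
    show "?H ` ring_aut S \<subseteq> ring_aut R" by (rule conjugate_ring_aut[OF R \<phi> \<psi>])
    show "\<forall>k\<in>ring_aut R. ?H (?F k) = k"
    proof
      fix j assume j: "j \<in> ring_aut R"
      then have "j \<in> extensional (carrier R)" by (simp add: ring_aut_eq)
      then show "?H (?F j) = j"
        by (intro extensionalityI[OF restrict_extensional]) (use j k cl inv in simp_all)
    qed
    show "\<forall>k\<in>ring_aut S. ?F (?H k) = k"
    proof
      fix j assume j: "j \<in> ring_aut S"
      then have "j \<in> extensional (carrier S)" by (simp add: ring_aut_eq)
      then show "?F (?H j) = j"
        by (intro extensionalityI[OF restrict_extensional]) (use j l cl inv in simp_all)
    qed
  qed
  then show ?thesis by (metis bij_betw_same_card)
qed

text \<open>Every class contains rings of forms, and two of these are isomorphic exactly if the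
  forms share an orbit; so classes and orbits correspond, and automorphism groups have the size of
  the stabilisers.\<close>

lemma weighted_count_eq_mass:
  assumes cub: "\<And>R. R \<in> C \<Longrightarrow> cubic_ring R" and mem: "\<And>f. form_ring f \<in> C \<longleftrightarrow> f \<in> Q"
    and iso: "\<And>R f. R \<in> C \<Longrightarrow> form_ring f \<simeq> R \<Longrightarrow> f \<in> Q"
  shows "weighted_count C = forms.mass (carrier GL2) Q"
proof -
  let ?r = "{(R, S). R \<in> C \<and> S \<in> C \<and> R \<simeq> S}"
  let ?orb = "forms.orb (carrier GL2)"
  have sg: "subgroup (carrier GL2) GL2" by (rule forms.carrier_subgroup)
  have ringC: "ring R" if "R \<in> C" for R using cub[OF that] by (simp add: cubic_ring_def cring.axioms(1))
  have ringf: "ring (form_ring f)" for f using cring_form_ring by (rule cring.axioms(1))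
  have sym: "S \<simeq> R" if "ring R" "R \<simeq> S" for R S :: "int3 ring" using that ring_iso_sym by blast
  have trans: "R \<simeq> T" if "R \<simeq> S" "S \<simeq> T" for R S T :: "int3 ring" using that ring_iso_trans by blast
  define \<Phi> where "\<Phi> = (\<lambda>f. {R \<in> C. form_ring f \<simeq> R})"
  have cls: "?r `` {form_ring f} = \<Phi> f" if "f \<in> Q" for f using that mem by (auto simp: \<Phi>_def)
  have cls': "?r `` {R} = \<Phi> f" if "R \<in> C" "form_ring f \<simeq> R" for R f
    unfolding \<Phi>_def using that sym[OF ringf] trans by blast
  have self: "form_ring f \<in> \<Phi> f" if "f \<in> Q" for f
    using that mem ring_iso_refl by (simp add: \<Phi>_def)
  have eq: "\<Phi> f = \<Phi> g \<longleftrightarrow> ?orb f = ?orb g" if fg: "f \<in> Q" "g \<in> Q" for f g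
  proof
    assume "\<Phi> f = \<Phi> g"
    then have "form_ring g \<in> \<Phi> f" using self[OF fg(2)] by simp
    then have "f \<in> ?orb g" using form_ring_iso_iff by (simp add: \<Phi>_def)
    then show "?orb f = ?orb g" by (rule forms.orb_eq[OF sg])
  next
    assume "?orb f = ?orb g"
    then have "form_ring f \<simeq> form_ring g" using form_ring_iso_iff forms.orb_eq_iff[OF sg] by blast
    then show "\<Phi> f = \<Phi> g" unfolding \<Phi>_def using sym[OF ringf] trans by blast
  qed
  have quot: "C // ?r = \<Phi> ` Q"
  proof (intro equalityI subsetI)
    fix X assume "X \<in> C // ?r"
    then obtain R where R: "R \<in> C" "X = ?r `` {R}" by (auto simp: quotient_def)
    obtain f where f: "form_ring f \<simeq> R"
      using cubic_ring_iso_form_ring[OF cub[OF R(1)]] unfolding is_ring_iso_def by blast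
    then show "X \<in> \<Phi> ` Q" using cls'[OF R(1) f] R(2) iso[OF R(1) f] by blast
  next
    fix X assume "X \<in> \<Phi> ` Q"
    then obtain f where f: "f \<in> Q" "X = \<Phi> f" by blast
    then show "X \<in> C // ?r" unfolding quotient_def using cls[OF f(1)] mem by blast
  qed
  \<comment> \<open>\<open>\<Phi>\<close> is constant on orbits; \<open>\<Psi>\<close> is the
    induced map on orbits, injective there, along which the sum is reindexed.\<close>
  define \<Psi> where "\<Psi> = (\<lambda>X. \<Phi> (SOME f. f \<in> Q \<and> ?orb f = X))"
  have \<Psi>: "\<Psi> (?orb f) = \<Phi> f" if "f \<in> Q" for f
  proof -
    have "(SOME g. g \<in> Q \<and> ?orb g = ?orb f) \<in> Q \<and> ?orb (SOME g. g \<in> Q \<and> ?orb g = ?orb f) = ?orb f"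
      by (rule someI[of _ f]) (use that in simp)
    then show ?thesis using eq[OF _ that] by (simp add: \<Psi>_def)
  qed
  have inj: "inj_on \<Psi> (?orb ` Q)" by (rule inj_onI) (use \<Psi> eq in auto)
  have im: "\<Phi> ` Q = \<Psi> ` (?orb ` Q)" using \<Psi> by (simp add: image_image)
  have "weighted_count C = (\<Sum>X\<in>?orb ` Q. 1 / of_nat (card (ring_aut (SOME R. R \<in> \<Psi> X))))"
    unfolding weighted_count_def quot im by (simp add: sum.reindex[OF inj])
  also have "\<dots> = forms.mass (carrier GL2) Q"
    unfolding forms.mass_def
  proof (rule sum.cong[OF refl])
    fix X assume "X \<in> ?orb ` Q"
    then obtain f where f: "f \<in> Q" "X = ?orb f" by blast
    have "(SOME R. R \<in> \<Phi> f) \<in> \<Phi> f" by (rule someI[of _ "form_ring f"]) (rule self[OF f(1)])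
    then have "form_ring f \<simeq> (SOME R. R \<in> \<Phi> f)" "ring (SOME R. R \<in> \<Phi> f)" using ringC by (auto simp: \<Phi>_def)
    then have "card (ring_aut (SOME R. R \<in> \<Phi> f)) = card (ring_aut (form_ring f))"
      unfolding is_ring_iso_def using card_ring_aut_iso[OF ringf] by blast
    then show "1 / of_nat (card (ring_aut (SOME R. R \<in> \<Psi> X))) = forms.orbit_wt (carrier GL2) X"
      using \<Psi>[OF f(1)] f(2) by (simp add: card_ring_aut_form_ring forms.orbit_wt_orb[OF sg])
  qed
  finally show ?thesis .
qed

lemma weighted_count_disc:
  "weighted_count {R. cubic_ring R \<and> of_int (cubic_disc R) = rat_of_int E}
     = forms.mass (carrier GL2) {f. form_disc f = E}"
proof (rule weighted_count_eq_mass)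
  fix R :: "int3 ring" and f
  assume "R \<in> {R. cubic_ring R \<and> of_int (cubic_disc R) = rat_of_int E}" "form_ring f \<simeq> R"
  then obtain \<psi> where "cring R" "rat_of_int (cubic_disc R) = of_int E" "\<psi> \<in> ring_iso (form_ring f) R"
    unfolding is_ring_iso_def cubic_ring_def by blast
  then show "f \<in> {f. form_disc f = E}" using cubic_disc_iso[of R \<psi> f] by simp
next
  fix f
  show "form_ring f \<in> {R. cubic_ring R \<and> of_int (cubic_disc R) = rat_of_int E} \<longleftrightarrow> f \<in> {f. form_disc f = E}"
    using cubic_disc_iso[OF cring_form_ring ring_iso_set_refl, of f] cubic_ring_form_ring by simp
qed auto

lemma weighted_count_zmat_disc:
  "weighted_count {R. cubic_ring R \<and> zmat R \<and> of_int (cubic_disc R) = rat_of_int E}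
     = forms.mass (carrier GL2) {f. zmat_form f \<and> form_disc f = E}"
proof (rule weighted_count_eq_mass)
  fix R :: "int3 ring" and f
  assume "R \<in> {R. cubic_ring R \<and> zmat R \<and> of_int (cubic_disc R) = rat_of_int E}" "form_ring f \<simeq> R"
  then obtain \<psi> where "cring R" "zmat R" "rat_of_int (cubic_disc R) = of_int E" "\<psi> \<in> ring_iso (form_ring f) R"
    unfolding is_ring_iso_def cubic_ring_def by blast
  then show "f \<in> {f. zmat_form f \<and> form_disc f = E}"
    using cubic_disc_iso[of R \<psi> f] zmat_iso[of R \<psi> f] by simp
next
  fix f
  show "form_ring f \<in> {R. cubic_ring R \<and> zmat R \<and> of_int (cubic_disc R) = rat_of_int E}
      \<longleftrightarrow> f \<in> {f. zmat_form f \<and> form_disc f = E}"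
    using cubic_disc_iso[OF cring_form_ring ring_iso_set_refl, of f] zmat_iso[OF cring_form_ring ring_iso_set_refl, of f]
      cubic_ring_form_ring by simp
qed auto

section \<open>The theorem\<close>


lemma Discs_iff: "D \<in> Discs \<longleftrightarrow> D \<noteq> 0 \<and> (4 dvd D \<or> D mod 4 = 1)"
  unfolding Discs_def by auto

lemma square_mod_4: "4 dvd (y::int) ^ 2 \<or> (\<exists>t. y ^ 2 = 4 * t + 1)"
proof (cases "even y")
  case True
  then show ?thesis by (auto simp: power2_eq_square elim!: evenE)
next
  case False
  then obtain k where "y = 2 * k + 1" by (rule oddE)
  then have "y ^ 2 = 4 * (k ^ 2 + k) + 1" by (simp add: power2_eq_square algebra_simps)
  then show ?thesis by blast
qed

lemma square_plus_four_Discs: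
  assumes "x = y ^ 2 + 4 * k" "x \<noteq> 0" shows "x \<in> Discs"
  using square_mod_4[of y] assms by (auto simp: Discs_iff elim!: dvdE)

lemma square_mult_Discs:
  assumes D: "D \<in> Discs" and m: "m \<noteq> 0" shows "m ^ 2 * D \<in> Discs"
proof -
  from D consider "4 dvd D" | "D mod 4 = 1" by (auto simp: Discs_iff)
  then have "4 dvd m ^ 2 * D \<or> (m ^ 2 * D) mod 4 = 1"
  proof cases
    case 2
    from square_mod_4[of m] show ?thesis
    proof
      assume "\<exists>t. m ^ 2 = 4 * t + 1"
      then obtain t where "m ^ 2 = 4 * t + 1" by blast
      then have "m ^ 2 * D = D + 4 * (t * D)" by (simp add: algebra_simps)
      then show ?thesis using 2 by simp
    qed simp
  qed simp
  then show ?thesis using D m by (simp add: Discs_iff)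
qed

text \<open>Stickelberger's congruence: the discriminant is a square plus a multiple of 4. Hence no
  form is lost by the convention that \<open>h\<close> vanishes outside
  \<open>Discs\<close>.\<close>

lemma form_disc_Discs: "form_disc f \<noteq> 0 \<Longrightarrow> form_disc f \<in> Discs"
proof -
  obtain a b c d where f: "f = (a, b, c, d)" by (cases f)
  have "form_disc f = (a * d + b * c) ^ 2 + 4 * (4 * a * b * c * d - a * c ^ 3 - b ^ 3 * d - 7 * a ^ 2 * d ^ 2)"
    by (simp add: f algebra_simps power2_eq_square power3_eq_cube)
  then show "form_disc f \<noteq> 0 \<Longrightarrow> form_disc f \<in> Discs" by (rule square_plus_four_Discs)
qed

text \<open>The same congruence holds after division by -27, which justifies the convention for
  \<open>h_hat\<close>.\<close>

lemma zmat_form_disc: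
  assumes "zmat_form f" "form_disc f \<noteq> 0"
  shows "\<exists>E \<in> Discs. form_disc f = - 27 * E"
proof -
  obtain a b c d where f: "f = (a, 3 * b, 3 * c, d)" using assms(1) by (cases f) (auto elim!: dvdE)
  let ?E = "(a * d + b * c) ^ 2 + 4 * (a * c ^ 3 + b ^ 3 * d - b ^ 2 * c ^ 2 - 2 * a * b * c * d)"
  have eq: "form_disc f = - 27 * ?E"
    by (simp add: f algebra_simps power2_eq_square power3_eq_cube)
  moreover have "?E \<noteq> 0" using assms(2) eq by auto
  ultimately show ?thesis using square_plus_four_Discs[OF refl] by blast
qed

lemma h_eq_mass:
  assumes "E \<in> Discs" shows "h (of_int E) = form_mass {f. form_disc f = E}"
  using assms weighted_count_disc[of E] by (simp add: h_def)

lemma h_hat_eq_mass: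
  assumes "E \<in> Discs" shows "h_hat (of_int E) = form_mass {f. zmat_form f \<and> form_disc f = - 27 * E}"
  using assms weighted_count_zmat_disc[of "- 27 * E"] by (simp add: h_hat_def)

lemma mass_empty: "form_mass {} = 0"
  by (simp add: forms.mass_def)

text \<open>If D / q^2 is not in \<open>Discs\<close>, then \<open>h\<close> is 0 by convention, and
  the set of forms is empty because the discriminant of any member would lie in
  \<open>Discs\<close>.\<close>

lemma h_quotient:
  assumes D: "D \<in> Discs" and q: "q \<noteq> 0"
  shows "h (of_int D / of_int q ^ 2) = form_mass {f. q ^ 2 * form_disc f = D}"
proof (cases "rat_of_int D / of_int q ^ 2 \<in> of_int ` Discs")
  case True
  then obtain E where E: "E \<in> Discs" "rat_of_int D / of_int q ^ 2 = of_int E" by auto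
  then have "rat_of_int D = of_int (q ^ 2 * E)" using q by (simp add: field_simps)
  then have "D = q ^ 2 * E" by (simp only: of_int_eq_iff)
  then have "{f. q ^ 2 * form_disc f = D} = {f. form_disc f = E}" using q by simp
  then show ?thesis using h_eq_mass[OF E(1)] E(2) by simp
next
  case False
  have "q ^ 2 * form_disc f \<noteq> D" for f
  proof
    assume eq: "q ^ 2 * form_disc f = D"
    then have "form_disc f \<noteq> 0" using D unfolding Discs_iff by force
    then have "form_disc f \<in> Discs" by (rule form_disc_Discs)
    moreover have "rat_of_int D / of_int q ^ 2 = of_int (form_disc f)" using q by (simp add: eq[symmetric])
    ultimately show False using False by blast
  qed
  then have "{f. q ^ 2 * form_disc f = D} = {}" by blast
  then show ?thesis using False mass_empty by (simp only: h_def if_False)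
qed

lemma h_hat_quotient:
  assumes D: "D \<in> Discs" and q: "q \<noteq> 0"
  shows "h_hat (of_int D / of_int q ^ 2) = form_mass {f. zmat_form f \<and> q ^ 2 * form_disc f = - 27 * D}"
proof (cases "rat_of_int D / of_int q ^ 2 \<in> of_int ` Discs")
  case True
  then obtain E where E: "E \<in> Discs" "rat_of_int D / of_int q ^ 2 = of_int E" by auto
  then have "rat_of_int D = of_int (q ^ 2 * E)" using q by (simp add: field_simps)
  then have D': "D = q ^ 2 * E" by (simp only: of_int_eq_iff)
  have "q ^ 2 * x = - 27 * D \<longleftrightarrow> x = - 27 * E" for x
  proof -
    have "- 27 * D = q ^ 2 * (- 27 * E)" by (simp add: D')
    then show ?thesis using q by (simp only: mult_cancel_left) simp
  qed
  then show ?thesis using h_hat_eq_mass[OF E(1)] E(2) by simp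
next
  case False
  have "\<not> (zmat_form f \<and> q ^ 2 * form_disc f = - 27 * D)" for f
  proof
    assume f: "zmat_form f \<and> q ^ 2 * form_disc f = - 27 * D"
    then have "form_disc f \<noteq> 0" using D by (auto simp: Discs_iff)
    then obtain E where E: "E \<in> Discs" "form_disc f = - 27 * E" using zmat_form_disc f by blast
    then have "q ^ 2 * E = D" using f by (simp add: mult.left_commute)
    then have "rat_of_int D / of_int q ^ 2 = of_int E" using q by auto
    then show False using False E(1) by blast
  qed
  then have "{f. zmat_form f \<and> q ^ 2 * form_disc f = - 27 * D} = {}" by blast
  then show ?thesis using False mass_empty by (simp only: h_hat_def if_False)
qed

lemma zmat_form_phi:
  assumes "prime p" "p \<noteq> 3" "root_at p f" shows "zmat_form (phi p f) \<longleftrightarrow> zmat_form f"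
proof -
  have "\<not> 3 dvd p" using assms two_three_prime_int(2) primes_dvd_imp_eq by metis
  then show ?thesis using prime_dvd_mult_iff[OF two_three_prime_int(2), of p] by (cases f) auto
qed

lemma zmat_form_scale:
  assumes "prime p" "p \<noteq> 3" shows "zmat_form (scale p f) \<longleftrightarrow> zmat_form f"
proof -
  have "\<not> 3 dvd p" using assms two_three_prime_int(2) primes_dvd_imp_eq by metis
  then show ?thesis using prime_dvd_mult_iff[OF two_three_prime_int(2), of p] by (cases f) auto
qed

theorem theorem4p1:
  fixes D :: int and p :: nat
  assumes "D \<in> Discs" and "prime p"
  shows "h (of_nat p ^ 6 * of_int D) =
           h (of_nat p ^ 4 * of_int D) + of_nat p * (h (of_int D) - h (of_int D / of_nat p ^ 2)) \<and>
         h_hat (of_nat p ^ 6 * of_int D) =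
           h_hat (of_nat p ^ 4 * of_int D) +
           of_nat p * (h_hat (of_int D) - h_hat (of_int D / of_nat p ^ 2))"
proof -
  define q where "q = int p"
  have q: "prime q" using assms(2) by (simp add: q_def)
  have q0: "q \<noteq> 0" using q by auto
  have pq: "of_nat p = rat_of_int q" by (simp add: q_def)
  have D0: "D \<noteq> 0" using assms(1) by (simp add: Discs_iff)
  have D4: "q ^ 4 * D \<in> Discs" and D6: "q ^ 6 * D \<in> Discs"
    using square_mult_Discs[OF assms(1), of "q ^ 2"] square_mult_Discs[OF assms(1), of "q ^ 3"] q0
    by (simp_all add: power_mult[symmetric])
  have rat: "rat_of_int q ^ k * of_int D = of_int (q ^ k * D)" for k by simp
  have "h (of_int (q ^ 6 * D)) = h (of_int (q ^ 4 * D)) + of_int q * (h (of_int D) - h (of_int D / of_int q ^ 2))"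
    unfolding h_eq_mass[OF D4] h_eq_mass[OF D6] h_eq_mass[OF assms(1)] h_quotient[OF assms(1) q0]
    using mass_identity[OF q D0, of "\<lambda>_. True"] by simp
  moreover have "h_hat (of_int (q ^ 6 * D)) =
      h_hat (of_int (q ^ 4 * D)) + of_int q * (h_hat (of_int D) - h_hat (of_int D / of_int q ^ 2))"
  proof (cases "q = 3")
    case True
    have "9 * x = - 27 * D \<longleftrightarrow> x = - 3 * D" for x by auto
    then show ?thesis
      unfolding h_hat_eq_mass[OF D4] h_hat_eq_mass[OF D6] h_hat_eq_mass[OF assms(1)] h_hat_quotient[OF assms(1) q0]
      using mass_identity_zmat_3[OF D0] True by simp
  next
    case False
    show ?thesis
      unfolding h_hat_eq_mass[OF D4] h_hat_eq_mass[OF D6] h_hat_eq_mass[OF assms(1)] h_hat_quotient[OF assms(1) q0]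
      using mass_identity[OF q, of "- 27 * D" zmat_form] D0
        zmat_form_mact zmat_form_phi[OF q False] zmat_form_scale[OF q False]
      by (simp add: mult.left_commute)
  qed
  ultimately show ?thesis unfolding pq rat by blast
qed

end
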